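(* Let $\phi$ be a Maass eigencuspform of level $1$ and $f$ a holomorphic newform of squarefree level $q$. Let $p$ be a prime divisor of $q$. Then the normalized local integral satisfies $\tilde I_p=1/p$.
   Context: Maass eigencuspform of level 1: a $\mathrm{SL}(2,\mathbb{Z})$-invariant eigenfunction of the hyperbolic Laplacian on the upper half-plane, decaying rapidly at the cusp, that is an eigenfunction of all Hecke operators and of $\phi(z)\mapsto\phi(-\bar z)$ (assumed even under the latter). A holomorphic newform of level $q$ is taken with trivial nebentypus on $\Gamma_0(q)$ and even weight. Let $\mathbb{A}$ be the adele ring of $\mathbb{Q}$. Regard (the adelizations of) $\phi$ and $f$ as pure tensors $\phi=\bigotimes\phi_v$, $f=\bigotimes f_v$ in cuspidal automorphic representations $\pi_\phi=\bigotimes\pi_{\phi,v}$, $\pi_f=\bigotimes\pi_{f,v}$ of $\mathrm{PGL}_2(\mathbb{A})$. Write $G_p=\mathrm{PGL}_2(\mathbb{Q}_p)$, $K_p=\mathrm{PGL}_2(\mathbb{Z}_p)$. For $p\mid q$: $\pi_{\phi,p}$ is an unramified principal series of $G_p$ with Satake parameters $\alpha=\alpha_\phi(p)$, $\beta=\beta_\phi(p)$ ($\alpha\beta=1$), and $\phi_p$ is a nonzero vector on its unique $K_p$-fixed line; $\pi_{f,p}$ is a (possibly trivial) unramified quadratic twist of the Steinberg representation of $G_p$, and $f_p$ is a nonzero vector on its unique line fixed by the Iwahori subgroup of $K_p$ of matrices upper-triangular mod $p$. Put $\bar f_p=\begin{pmatrix}-1&\\&1\end{pmatrix}\cdot f_p$,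 which equals $f_p$ at finite primes. Let $\langle\,,\rangle$ denote the (unique up to scalar) $G_p$-invariant Hermitian pairings and define matrix coefficients $$\Phi_{\phi,p}(g)=\frac{\langle g\cdot\phi_p,\phi_p\rangle}{\langle\phi_p,\phi_p\rangle},\quad\Phi_{f,p}(g)=\frac{\langle g\cdot f_p,f_p\rangle}{\langle f_p,f_p\rangle},\quad\Phi_{\bar f,p}(g)=\frac{\langle g\cdot\bar f_p,\bar f_p\rangle}{\langle\bar f_p,\bar f_p\rangle}.$$ With $dg$ the Haar measure on $G_p$ giving $K_p$ volume $1$, set $$I_p=\int_{G_p}\Phi_{\phi,p}(g)\Phi_{f,p}(g)\Phi_{\bar f,p}(g)\,dg,\qquad\tilde I_p=\left(\frac{\zeta_p(2)^3}{\zeta_p(2)}\,\frac{L_p(\tfrac12,\phi\times f\times f)}{L_p(1,\mathrm{ad}\,\phi)\,L_p(1,\mathrm{ad}\,f)^2}\right)^{-1}I_p,$$ where $\zeta_p(s)=(1-p^{-s})^{-1}$ and, for $p\mid q$, $$L_p(1,\mathrm{ad}\,f)=\zeta_p(2),\qquad L_p(1,\mathrm{ad}\,\phi)=[(1-\alpha^2p^{-1})(1-p^{-1})(1-\beta^2p^{-1})]^{-1},$$ $$L_p(\tfrac12,\phi\times f\times f)=[(1-\alpha p^{-1/2})(1-\beta p^{-1/2})(1-\alpha p^{-3/2})(1-\beta p^{-3/2})]^{-1}.$$ *)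

theory Defs
  imports
    "HOL-Analysis.Analysis"
    "HOL-Computational_Algebra.Computational_Algebra"
    "HOL-Library.Function_Algebras"
begin

section \<open>The field of p-adic numbers\<close>

definition padic_abs :: "nat \<Rightarrow> rat \<Rightarrow> real" where
  "padic_abs p r =
     (if r = 0 then 0
      else real p powi (int (multiplicity (int p) (snd (quotient_of r)))
                        - int (multiplicity (int p) (fst (quotient_of r)))))"

text \<open>
  There is no type of p-adic numbers in the libraries.  We say instead that a complete metric
  field \<open>'k\<close> is the completion of the rationals with respect to the p-adic absolute
  value; this determines \<open>'k\<close> up to a unique isometric isomorphism.  The p-adic
  absolute value of \<open>x\<close> is \<open>dist x 0\<close>.
\<close>

definition is_padic_field :: "nat \<Rightarrow> 'k::{field_char_0,complete_space} itself \<Rightarrow> bool" where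
  "is_padic_field p _ \<longleftrightarrow>
     prime p \<and>
     (\<forall>r::rat. dist (of_rat r :: 'k) 0 = padic_abs p r) \<and>
     (\<forall>x y z::'k. dist (x + z) (y + z) = dist x y) \<and>
     (\<forall>x y::'k. dist (x * y) 0 = dist x 0 * dist y 0) \<and>
     closure (range (of_rat :: rat \<Rightarrow> 'k)) = UNIV"

definition pval :: "nat \<Rightarrow> 'k::{zero,metric_space} \<Rightarrow> int" where
  "pval p x = (THE n. dist x 0 = real p powi (- n))"

section \<open>The group PGL(2)\<close>

definition mat2 :: "'a \<Rightarrow> 'a \<Rightarrow> 'a \<Rightarrow> 'a \<Rightarrow> 'a::zero^2^2" where
  "mat2 a b c d = vector [vector [a, b], vector [c, d]]"

definition smult_mat :: "'a::times \<Rightarrow> 'a^2^2 \<Rightarrow> 'a^2^2" where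
  "smult_mat c A = (\<chi> i j. c * A $ i $ j)"

definition pgl2_rel :: "'k::field^2^2 \<Rightarrow> 'k^2^2 \<Rightarrow> bool" where
  "pgl2_rel A B \<longleftrightarrow> invertible A \<and> invertible B \<and> (\<exists>c. c \<noteq> 0 \<and> B = smult_mat c A)"

lemma smult_mat_mult:
  fixes A B :: "'k::field^2^2"
  shows "smult_mat c A ** smult_mat d B = smult_mat (c * d) (A ** B)"
  by (simp add: smult_mat_def matrix_matrix_mult_def vec_eq_iff sum_distrib_left ac_simps)

quotient_type (overloaded) 'k pgl2 = "'k::field^2^2" / partial: pgl2_rel
proof (rule part_equivpI)
  have "invertible (mat 1 :: 'k^2^2)"
    by (simp add: invertible_def exI[of _ "mat 1"])
  moreover have "(mat 1 :: 'k^2^2) = smult_mat 1 (mat 1)"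
    by (simp add: smult_mat_def vec_eq_iff)
  ultimately show "\<exists>A :: 'k^2^2. pgl2_rel A A"
    unfolding pgl2_rel_def by (metis zero_neq_one)
  show "symp (pgl2_rel :: 'k^2^2 \<Rightarrow> _)"
  proof (rule sympI)
    fix A B :: "'k^2^2"
    assume "pgl2_rel A B"
    then obtain c where c: "invertible A" "invertible B" "c \<noteq> 0" "B = smult_mat c A"
      unfolding pgl2_rel_def by blast
    then have "A = smult_mat (inverse c) B"
      by (simp add: smult_mat_def vec_eq_iff)
    with c show "pgl2_rel B A"
      unfolding pgl2_rel_def by (metis inverse_nonzero_iff_nonzero)
  qed
  show "transp (pgl2_rel :: 'k^2^2 \<Rightarrow> _)"
  proof (rule transpI)
    fix A B C :: "'k^2^2"
    assume "pgl2_rel A B" "pgl2_rel B C"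
    then obtain c d where cd: "invertible A" "invertible C" "c \<noteq> 0" "d \<noteq> 0"
        "B = smult_mat c A" "C = smult_mat d B"
      unfolding pgl2_rel_def by blast
    then have "C = smult_mat (d * c) A" "d * c \<noteq> 0"
      by (simp_all add: smult_mat_def vec_eq_iff)
    with cd show "pgl2_rel A C"
      unfolding pgl2_rel_def by blast
  qed
qed

lemma pgl2_rel_refl: "invertible A \<Longrightarrow> pgl2_rel A A"
  unfolding pgl2_rel_def by (auto intro!: exI[of _ 1] simp: smult_mat_def vec_eq_iff)

instantiation pgl2 :: (field) monoid_mult
begin

lift_definition one_pgl2 :: "'a pgl2" is "mat 1"
  by (rule pgl2_rel_refl) (simp add: invertible_def exI[of _ "mat 1"])

lift_definition times_pgl2 :: "'a pgl2 \<Rightarrow> 'a pgl2 \<Rightarrow> 'a pgl2" is "\<lambda>A B. A ** B"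
proof -
  fix A A' B B' :: "'a^2^2"
  assume "pgl2_rel A A'" "pgl2_rel B B'"
  then obtain c d where "c \<noteq> 0" "d \<noteq> 0" "A' = smult_mat c A" "B' = smult_mat d B"
      and inv: "invertible A" "invertible B" "invertible A'" "invertible B'"
    unfolding pgl2_rel_def by blast
  then have "c * d \<noteq> 0" "A' ** B' = smult_mat (c * d) (A ** B)"
    by (simp_all add: smult_mat_mult)
  with inv show "pgl2_rel (A ** B) (A' ** B')"
    unfolding pgl2_rel_def by (blast intro: invertible_mult)
qed

instance
proof
  fix a b c :: "'a pgl2"
  show "a * b * c = a * (b * c)"
  proof transfer
    fix A B C :: "'a^2^2"
    assume "pgl2_rel A A" "pgl2_rel B B" "pgl2_rel C C"
    then have "invertible (A ** (B ** C))"
      by (simp add: pgl2_rel_def invertible_mult)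
    then show "pgl2_rel (A ** B ** C) (A ** (B ** C))"
      by (simp add: matrix_mul_assoc pgl2_rel_refl)
  qed
  show "1 * a = a"
    by transfer simp
  show "a * 1 = a"
    by transfer simp
qed

end

text \<open>The quotient topology from the general linear group, itself a subspace of the matrices.\<close>

instantiation pgl2 :: ("{field,topological_space}") topological_space
begin

definition open_pgl2 :: "'a pgl2 set \<Rightarrow> bool" where
  "open_pgl2 U \<longleftrightarrow>
     openin (top_of_set {A :: 'a^2^2. invertible A}) {A. invertible A \<and> abs_pgl2 A \<in> U}"

instance
proof
  have "{A :: 'a^2^2. invertible A \<and> abs_pgl2 A \<in> UNIV} = topspace (top_of_set {A. invertible A})"
    by simp
  then show "open (UNIV :: 'a pgl2 set)"
    unfolding open_pgl2_def by (metis openin_topspace)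
next
  fix S T :: "'a pgl2 set"
  assume "open S" "open T"
  moreover have "{A :: 'a^2^2. invertible A \<and> abs_pgl2 A \<in> S \<inter> T}
      = {A. invertible A \<and> abs_pgl2 A \<in> S} \<inter> {A. invertible A \<and> abs_pgl2 A \<in> T}"
    by auto
  ultimately show "open (S \<inter> T)"
    unfolding open_pgl2_def by (simp add: openin_Int)
next
  fix K :: "'a pgl2 set set"
  assume "\<forall>S\<in>K. open S"
  then have "openin (top_of_set {A :: 'a^2^2. invertible A})
      (\<Union>S\<in>K. {A. invertible A \<and> abs_pgl2 A \<in> S})"
    unfolding open_pgl2_def by (intro openin_Union) auto
  moreover have "(\<Union>S\<in>K. {A :: 'a^2^2. invertible A \<and> abs_pgl2 A \<in> S})
      = {A. invertible A \<and> abs_pgl2 A \<in> \<Union>K}"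
    by auto
  ultimately show "open (\<Union>K)"
    unfolding open_pgl2_def by simp
qed

end

definition pgl2_mat :: "'k \<Rightarrow> 'k \<Rightarrow> 'k \<Rightarrow> 'k \<Rightarrow> 'k::field pgl2" where
  "pgl2_mat a b c d = abs_pgl2 (mat2 a b c d)"

definition K_max :: "'k::{field,metric_space} pgl2 set" where
  "K_max = {pgl2_mat a b c d | a b c d.
     dist a 0 \<le> 1 \<and> dist b 0 \<le> 1 \<and> dist c 0 \<le> 1 \<and> dist d 0 \<le> 1 \<and> dist (a * d - b * c) 0 = 1}"

definition Iwahori :: "'k::{field,metric_space} pgl2 set" where
  "Iwahori = {pgl2_mat a b c d | a b c d.
     dist a 0 \<le> 1 \<and> dist b 0 \<le> 1 \<and> dist c 0 < 1 \<and> dist d 0 \<le> 1 \<and> dist (a * d - b * c) 0 = 1}"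

definition haar_pgl2 :: "'k::{field,metric_space} pgl2 measure \<Rightarrow> bool" where
  "haar_pgl2 \<mu> \<longleftrightarrow>
     sets \<mu> = sets borel \<and>
     (\<forall>g. \<forall>A\<in>sets borel. emeasure \<mu> ((\<lambda>x. g * x) ` A) = emeasure \<mu> A) \<and>
     emeasure \<mu> K_max = 1"

section \<open>Representations\<close>

locale complex_rep = vector_space smul
  for smul :: "complex \<Rightarrow> 'v::ab_group_add \<Rightarrow> 'v" +
  fixes \<rho> :: "'g::monoid_mult \<Rightarrow> 'v \<Rightarrow> 'v"
  assumes rep_linear: "Vector_Spaces.linear smul smul (\<rho> g)"
    and rep_one: "\<rho> 1 v = v"
    and rep_mult: "\<rho> (g * h) v = \<rho> g (\<rho> h v)"

definition irreducible_rep ::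
    "(complex \<Rightarrow> 'v::ab_group_add \<Rightarrow> 'v) \<Rightarrow> ('g::monoid_mult \<Rightarrow> 'v \<Rightarrow> 'v) \<Rightarrow> bool" where
  "irreducible_rep smul \<rho> \<longleftrightarrow>
     complex_rep smul \<rho> \<and> (\<exists>v::'v. v \<noteq> 0) \<and>
     (\<forall>W. module.subspace smul W \<and> (\<forall>g. \<forall>w\<in>W. \<rho> g w \<in> W) \<longrightarrow> W = {0} \<or> W = UNIV)"

definition invariant_hermitian ::
    "(complex \<Rightarrow> 'v::ab_group_add \<Rightarrow> 'v) \<Rightarrow> ('g \<Rightarrow> 'v \<Rightarrow> 'v) \<Rightarrow> ('v \<Rightarrow> 'v \<Rightarrow> complex) \<Rightarrow> bool" where
  "invariant_hermitian smul \<rho> h \<longleftrightarrow>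
     (\<forall>u v w. h (u + v) w = h u w + h v w) \<and>
     (\<forall>c u w. h (smul c u) w = c * h u w) \<and>
     (\<forall>u v. h v u = cnj (h u v)) \<and>
     (\<forall>g u v. h (\<rho> g u) (\<rho> g v) = h u v)"

definition unitarizable ::
    "(complex \<Rightarrow> 'v::ab_group_add \<Rightarrow> 'v) \<Rightarrow> ('g \<Rightarrow> 'v \<Rightarrow> 'v) \<Rightarrow> bool" where
  "unitarizable smul \<rho> \<longleftrightarrow>
     (\<exists>h. invariant_hermitian smul \<rho> h \<and> (\<forall>v. v \<noteq> 0 \<longrightarrow> Re (h v v) > 0))"

definition matrix_coeff :: "('g \<Rightarrow> 'v \<Rightarrow> 'v) \<Rightarrow> ('v \<Rightarrow> 'v \<Rightarrow> complex) \<Rightarrow> 'v \<Rightarrow> 'g \<Rightarrow> complex" where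
  "matrix_coeff \<rho> h v g = h (\<rho> g v) v / h v v"

definition fun_smul :: "complex \<Rightarrow> ('a \<Rightarrow> complex) \<Rightarrow> 'a \<Rightarrow> complex" where
  "fun_smul c F = (\<lambda>x. c * F x)"

definition right_smooth :: "('k::{field,topological_space} pgl2 \<Rightarrow> complex) \<Rightarrow> bool" where
  "right_smooth F \<longleftrightarrow> (\<exists>U. open U \<and> 1 \<in> U \<and> (\<forall>g. \<forall>u\<in>U. F (g * u) = F g))"

text \<open>
  Normalized induction of the character \<open>diag(a,d) \<mapsto> \<chi>\<^sub>1(a) \<chi>\<^sub>2(d)\<close> of the upper triangular
  Borel subgroup, where \<open>\<chi>\<^sub>1\<close>, \<open>\<chi>\<^sub>2\<close> are the unramified characters with
  \<open>\<chi>\<^sub>1(p) = \<alpha>\<close> and \<open>\<chi>\<^sub>2(p) = \<beta>\<close>.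
\<close>

definition induced_space ::
    "nat \<Rightarrow> complex \<Rightarrow> complex \<Rightarrow> ('k::{field,metric_space} pgl2 \<Rightarrow> complex) set" where
  "induced_space p \<alpha> \<beta> = {F. right_smooth F \<and>
     (\<forall>a b d g. a \<noteq> 0 \<and> d \<noteq> 0 \<longrightarrow>
        F (pgl2_mat a b 0 d * g) =
          \<alpha> powi pval p a * \<beta> powi pval p d * of_real (sqrt (dist a 0 / dist d 0)) * F g)}"

definition unramified_principal_series ::
    "nat \<Rightarrow> complex \<Rightarrow> complex \<Rightarrow> (complex \<Rightarrow> 'v::ab_group_add \<Rightarrow> 'v) \<Rightarrow>
     ('k::{field,metric_space} pgl2 \<Rightarrow> 'v \<Rightarrow> 'v) \<Rightarrow> bool" where
  "unramified_principal_series p \<alpha> \<beta> smul \<rho> \<longleftrightarrow>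
     irreducible_rep smul \<rho> \<and> \<alpha> * \<beta> = 1 \<and>
     (\<exists>T. Vector_Spaces.linear smul fun_smul T \<and> inj T \<and> range T = induced_space p \<alpha> \<beta> \<and>
          (\<forall>g v. T (\<rho> g v) = (\<lambda>x. T v (x * g))))"

text \<open>
  The Steinberg representation is the quotient of the space of smooth functions on the
  projective line (smooth functions on the group that are left invariant under the Borel
  subgroup) by the constants.  The quotient map \<open>Q\<close> is only used on that space; it costs nothing
  to let it be defined and linear on all functions on the group.
\<close>

definition smooth_on_P1 :: "('k::{field,topological_space} pgl2 \<Rightarrow> complex) set" where
  "smooth_on_P1 = {F. right_smooth F \<and>
     (\<forall>a b d g. a \<noteq> 0 \<and> d \<noteq> 0 \<longrightarrow> F (pgl2_mat a b 0 d * g) = F g)}"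

definition is_steinberg ::
    "(complex \<Rightarrow> 'v::ab_group_add \<Rightarrow> 'v) \<Rightarrow> ('k::{field,topological_space} pgl2 \<Rightarrow> 'v \<Rightarrow> 'v) \<Rightarrow> bool"
    where
  "is_steinberg smul \<rho> \<longleftrightarrow>
     (\<exists>Q. Vector_Spaces.linear fun_smul smul Q \<and>
          Q ` smooth_on_P1 = UNIV \<and>
          {F \<in> smooth_on_P1. Q F = 0} = {F. \<exists>c. F = (\<lambda>_. c)} \<and>
          (\<forall>g. \<forall>F\<in>smooth_on_P1. Q (\<lambda>x. F (x * g)) = \<rho> g (Q F)))"

text \<open>
  The character \<open>g \<mapsto> \<epsilon> ^ v(det g)\<close> for \<open>\<epsilon> = 1\<close> or \<open>\<epsilon> = -1\<close>; it does not depend on the chosen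
  representative of \<open>g\<close>, since scaling by \<open>c\<close> changes the determinant by \<open>c\<^sup>2\<close>.
\<close>

definition unram_quad_char :: "nat \<Rightarrow> complex \<Rightarrow> 'k::{field,metric_space} pgl2 \<Rightarrow> complex" where
  "unram_quad_char p \<epsilon> g = \<epsilon> powi pval p (det (rep_pgl2 g))"

definition unramified_quadratic_twist_of_steinberg ::
    "nat \<Rightarrow> (complex \<Rightarrow> 'v::ab_group_add \<Rightarrow> 'v) \<Rightarrow>
     ('k::{field,metric_space} pgl2 \<Rightarrow> 'v \<Rightarrow> 'v) \<Rightarrow> bool" where
  "unramified_quadratic_twist_of_steinberg p smul \<rho> \<longleftrightarrow>
     irreducible_rep smul \<rho> \<and>
     (\<exists>\<epsilon>\<in>{1, -1}. is_steinberg smul (\<lambda>g v. smul (unram_quad_char p \<epsilon> g) (\<rho> g v)))"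

section \<open>Automorphic forms on the upper half-plane\<close>

definition upper_half_plane :: "complex set" where
  "upper_half_plane = {z. Im z > 0}"

definition real_of_int_mat :: "int^2^2 \<Rightarrow> real^2^2" where
  "real_of_int_mat A = (\<chi> i j. of_int (A $ i $ j))"

text \<open>The weight \<open>k\<close> action of real matrices with positive determinant, for even \<open>k\<close>.\<close>

definition slash :: "nat \<Rightarrow> real^2^2 \<Rightarrow> (complex \<Rightarrow> complex) \<Rightarrow> complex \<Rightarrow> complex" where
  "slash k A f z =
     (let num = of_real (A$1$1) * z + of_real (A$1$2);
          den = of_real (A$2$1) * z + of_real (A$2$2)
      in of_real (det A ^ (k div 2)) / den ^ k * f (num / den))"

definition SL2Z :: "(int^2^2) set" where
  "SL2Z = {A. det A = 1}"

definition Gamma0 :: "nat \<Rightarrow> (int^2^2) set" where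
  "Gamma0 q = {A \<in> SL2Z. int q dvd A $ 2 $ 1}"

text \<open>
  The \<open>n\<close>-th Hecke operator at level \<open>q\<close> with trivial nebentypus, in the normalization
  independent of the weight; for weight \<open>k\<close> the classical one is \<open>n\<close> to the power \<open>(k - 1)/2\<close>
  times this.
\<close>

definition hecke :: "nat \<Rightarrow> nat \<Rightarrow> nat \<Rightarrow> (complex \<Rightarrow> complex) \<Rightarrow> complex \<Rightarrow> complex" where
  "hecke k q n f z =
     of_real (real n powr (-1/2)) *
     (\<Sum>a\<in>{a. a dvd n \<and> coprime a q}. \<Sum>b<n div a.
        slash k (mat2 (real a) (real b) 0 (real (n div a))) f z)"

definition hecke_eigenform :: "nat \<Rightarrow> nat \<Rightarrow> (complex \<Rightarrow> complex) \<Rightarrow> bool" where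
  "hecke_eigenform k q f \<longleftrightarrow>
     (\<forall>n>0. \<exists>c. \<forall>z\<in>upper_half_plane. hecke k q n f z = c * f z)"

definition dx :: "(complex \<Rightarrow> complex) \<Rightarrow> complex \<Rightarrow> complex" where
  "dx f z = vector_derivative (\<lambda>t::real. f (z + of_real t)) (at 0)"

definition dy :: "(complex \<Rightarrow> complex) \<Rightarrow> complex \<Rightarrow> complex" where
  "dy f z = vector_derivative (\<lambda>t::real. f (z + \<i> * of_real t)) (at 0)"

fun Ck_on_uhp :: "nat \<Rightarrow> (complex \<Rightarrow> complex) \<Rightarrow> bool" where
  "Ck_on_uhp 0 f \<longleftrightarrow> continuous_on upper_half_plane f"
| "Ck_on_uhp (Suc n) f \<longleftrightarrow>
     f differentiable_on upper_half_plane \<and> Ck_on_uhp n (dx f) \<and> Ck_on_uhp n (dy f)"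

definition hyperbolic_laplacian :: "(complex \<Rightarrow> complex) \<Rightarrow> complex \<Rightarrow> complex" where
  "hyperbolic_laplacian f z = - of_real ((Im z)^2) * (dx (dx f) z + dy (dy f) z)"

definition even_maass_eigencuspform :: "(complex \<Rightarrow> complex) \<Rightarrow> bool" where
  "even_maass_eigencuspform \<phi> \<longleftrightarrow>
     (\<exists>z\<in>upper_half_plane. \<phi> z \<noteq> 0) \<and>
     (\<forall>n. Ck_on_uhp n \<phi>) \<and>
     (\<forall>\<gamma>\<in>SL2Z. \<forall>z\<in>upper_half_plane. slash 0 (real_of_int_mat \<gamma>) \<phi> z = \<phi> z) \<and>
     (\<exists>c. \<forall>z\<in>upper_half_plane. hyperbolic_laplacian \<phi> z = c * \<phi> z) \<and>
     (\<forall>N::nat. \<exists>C. \<forall>z. Im z \<ge> 1 \<longrightarrow> norm (\<phi> z) \<le> C / Im z ^ N) \<and>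
     hecke_eigenform 0 1 \<phi> \<and>
     (\<forall>z\<in>upper_half_plane. \<phi> (- cnj z) = \<phi> z)"

definition cusp_form :: "nat \<Rightarrow> nat \<Rightarrow> (complex \<Rightarrow> complex) \<Rightarrow> bool" where
  "cusp_form k q f \<longleftrightarrow>
     f holomorphic_on upper_half_plane \<and>
     (\<forall>\<gamma>\<in>Gamma0 q. \<forall>z\<in>upper_half_plane. slash k (real_of_int_mat \<gamma>) f z = f z) \<and>
     (\<forall>\<gamma>\<in>SL2Z. \<forall>e>0. \<exists>Y>0. \<forall>z. Im z > Y \<longrightarrow> norm (slash k (real_of_int_mat \<gamma>) f z) < e)"

definition Gamma0_cosets :: "nat \<Rightarrow> (int^2^2) set set" where
  "Gamma0_cosets q =
     SL2Z // {(\<gamma>, \<delta>). \<gamma> \<in> SL2Z \<and> \<delta> \<in> SL2Z \<and> (\<exists>\<epsilon>\<in>Gamma0 q. \<delta> = \<epsilon> ** \<gamma>)}"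

text \<open>
  The integral over a fundamental domain for \<open>Gamma0 q\<close> is unfolded to the standard fundamental
  domain of the modular group by summing over the cosets in \<open>Gamma0_cosets q\<close>; by the
  modularity of \<open>f\<close> and \<open>g\<close> the summands do not depend on the representatives.
\<close>

definition petersson ::
    "nat \<Rightarrow> nat \<Rightarrow> (complex \<Rightarrow> complex) \<Rightarrow> (complex \<Rightarrow> complex) \<Rightarrow> complex" where
  "petersson k q f g =
     (LINT z : {z. \<bar>Re z\<bar> \<le> 1/2 \<and> norm z \<ge> 1 \<and> Im z > 0} | lborel.
        (\<Sum>C\<in>Gamma0_cosets q.
           slash k (real_of_int_mat (SOME \<gamma>. \<gamma> \<in> C)) f z
           * cnj (slash k (real_of_int_mat (SOME \<gamma>. \<gamma> \<in> C)) g z))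
        * of_real (Im z ^ k / (Im z)\<^sup>2))"

text \<open>
  Newforms up to scalar multiples: Hecke eigenforms that are orthogonal to all oldforms
  \<open>z \<mapsto> g (d z)\<close>, \<open>g\<close> of level \<open>M\<close>, where \<open>M\<close> is a proper divisor of \<open>q\<close> and \<open>d\<close> divides \<open>q/M\<close>.
\<close>

definition holomorphic_newform :: "nat \<Rightarrow> nat \<Rightarrow> (complex \<Rightarrow> complex) \<Rightarrow> bool" where
  "holomorphic_newform k q f \<longleftrightarrow>
     even k \<and> k > 0 \<and> q > 0 \<and>
     cusp_form k q f \<and> (\<exists>z\<in>upper_half_plane. f z \<noteq> 0) \<and>
     hecke_eigenform k q f \<and>
     (\<forall>M d g. M < q \<and> M * d dvd q \<and> cusp_form k M g \<longrightarrow>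
        petersson k q f (\<lambda>z. g (of_nat d * z)) = 0)"

section \<open>Local components of automorphic forms\<close>

text \<open>
  \<open>Gamma0_away p N\<close> consists of the matrices in \<open>GL\<^sub>2(\<int>[1/p])\<close> of positive determinant whose
  lower left entry is divisible by \<open>N\<close>, with \<open>N\<close> prime to \<open>p\<close>: the rational matrices of positive
  determinant that lie in the level \<open>N\<close> compact open subgroup at every prime other than \<open>p\<close>.
\<close>

definition Z_inv :: "nat \<Rightarrow> rat set" where
  "Z_inv p = {r. \<exists>n. r * of_nat p ^ n \<in> \<int>}"

definition Gamma0_away :: "nat \<Rightarrow> nat \<Rightarrow> (rat^2^2) set" where
  "Gamma0_away p N =
     {A. (\<forall>i j. A $ i $ j \<in> Z_inv p) \<and> A $ 2 $ 1 / of_nat N \<in> Z_inv p \<and>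
         det A > 0 \<and> 1 / det A \<in> Z_inv p}"

text \<open>
  \<open>F\<close> is the adelization of the weight \<open>k\<close> form \<open>f\<close>, restricted to the elements
  \<open>(x, g)\<close> of \<open>GL\<^sub>2(\<real>)\<^sup>+ \<times> PGL\<^sub>2(\<rat>\<^sub>p)\<close> of the adelic group with trivial components
  at the other primes.  Here \<open>N\<close> is the part of the level prime to \<open>p\<close> and \<open>U\<close> is the level
  subgroup at \<open>p\<close>.  By strong approximation these conditions determine \<open>F\<close>; the value \<open>0\<close>
  off the positive determinants is only a convention.
\<close>

definition adelization_at ::
    "nat \<Rightarrow> nat \<Rightarrow> 'k::field_char_0 pgl2 set \<Rightarrow> nat \<Rightarrow> (complex \<Rightarrow> complex) \<Rightarrow>
     ((real^2^2) \<times> 'k pgl2 \<Rightarrow> complex) \<Rightarrow> bool" where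
  "adelization_at p N U k f F \<longleftrightarrow>
     (\<forall>x g. det x \<le> 0 \<longrightarrow> F (x, g) = 0) \<and>
     (\<forall>\<gamma>\<in>Gamma0_away p N. \<forall>x g. det x > 0 \<longrightarrow>
        F ((\<chi> i j. of_rat (\<gamma> $ i $ j)) ** x, abs_pgl2 (\<chi> i j. of_rat (\<gamma> $ i $ j)) * g) = F (x, g)) \<and>
     (\<forall>x g. \<forall>u\<in>U. F (x, g * u) = F (x, g)) \<and>
     (\<forall>x. det x > 0 \<longrightarrow> F (x, 1) = slash k x f \<i>)"

text \<open>
  If \<open>f\<close> generates the cuspidal automorphic representation \<open>\<pi>\<close> and is a pure tensor in it, then
  the representation of \<open>PGL\<^sub>2(\<rat>\<^sub>p)\<close> generated by its adelization under right translation is the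
  local component of \<open>\<pi>\<close> at \<open>p\<close>, the adelization corresponding to the local vector \<open>v\<close>.
  Restricting functions as in \<open>adelization_at\<close> is equivariant and does not kill the adelization,
  so it is injective on this irreducible representation.
\<close>

definition local_component ::
    "nat \<Rightarrow> nat \<Rightarrow> 'k::field_char_0 pgl2 set \<Rightarrow> nat \<Rightarrow> (complex \<Rightarrow> complex) \<Rightarrow>
     (complex \<Rightarrow> 'v::ab_group_add \<Rightarrow> 'v) \<Rightarrow> ('k pgl2 \<Rightarrow> 'v \<Rightarrow> 'v) \<Rightarrow> 'v \<Rightarrow> bool" where
  "local_component p N U k f smul \<rho> v \<longleftrightarrow>
     irreducible_rep smul \<rho> \<and> unitarizable smul \<rho> \<and>
     (\<exists>T. Vector_Spaces.linear smul fun_smul T \<and> inj T \<and>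
          (\<forall>g w. T (\<rho> g w) = (\<lambda>(x, h). T w (x, h * g))) \<and>
          adelization_at p N U k f (T v))"

section \<open>Local factors and the normalized local integral\<close>

definition zeta_p :: "nat \<Rightarrow> real \<Rightarrow> complex" where
  "zeta_p p s = of_real (1 / (1 - real p powr (-s)))"

definition L_ad_steinberg :: "nat \<Rightarrow> complex" where
  "L_ad_steinberg p = zeta_p p 2"

definition L_ad_unramified :: "nat \<Rightarrow> complex \<Rightarrow> complex \<Rightarrow> complex" where
  "L_ad_unramified p \<alpha> \<beta> =
     inverse ((1 - \<alpha>\<^sup>2 / of_nat p) * (1 - 1 / of_nat p) * (1 - \<beta>\<^sup>2 / of_nat p))"

definition L_half_triple :: "nat \<Rightarrow> complex \<Rightarrow> complex \<Rightarrow> complex" where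
  "L_half_triple p \<alpha> \<beta> =
     inverse ((1 - \<alpha> * of_real (real p powr (-1/2))) * (1 - \<beta> * of_real (real p powr (-1/2)))
            * (1 - \<alpha> * of_real (real p powr (-3/2))) * (1 - \<beta> * of_real (real p powr (-3/2))))"

definition local_integral ::
    "'k::{field,metric_space} pgl2 measure \<Rightarrow>
     ('k pgl2 \<Rightarrow> 'v \<Rightarrow> 'v) \<Rightarrow> ('v \<Rightarrow> 'v \<Rightarrow> complex) \<Rightarrow> 'v \<Rightarrow>
     ('k pgl2 \<Rightarrow> 'w \<Rightarrow> 'w) \<Rightarrow> ('w \<Rightarrow> 'w \<Rightarrow> complex) \<Rightarrow> 'w \<Rightarrow> complex" where
  "local_integral \<mu> \<rho>\<^sub>\<phi> h\<^sub>\<phi> v\<^sub>\<phi> \<rho>\<^sub>f h\<^sub>f v\<^sub>f =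
     (\<integral>g. matrix_coeff \<rho>\<^sub>\<phi> h\<^sub>\<phi> v\<^sub>\<phi> g * matrix_coeff \<rho>\<^sub>f h\<^sub>f v\<^sub>f g
          * matrix_coeff \<rho>\<^sub>f h\<^sub>f (\<rho>\<^sub>f (pgl2_mat (-1) 0 0 1) v\<^sub>f) g \<partial>\<mu>)"

definition normalized_local_integral ::
    "nat \<Rightarrow> complex \<Rightarrow> complex \<Rightarrow> 'k::{field,metric_space} pgl2 measure \<Rightarrow>
     ('k pgl2 \<Rightarrow> 'v \<Rightarrow> 'v) \<Rightarrow> ('v \<Rightarrow> 'v \<Rightarrow> complex) \<Rightarrow> 'v \<Rightarrow>
     ('k pgl2 \<Rightarrow> 'w \<Rightarrow> 'w) \<Rightarrow> ('w \<Rightarrow> 'w \<Rightarrow> complex) \<Rightarrow> 'w \<Rightarrow> complex" where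
  "normalized_local_integral p \<alpha> \<beta> \<mu> \<rho>\<^sub>\<phi> h\<^sub>\<phi> v\<^sub>\<phi> \<rho>\<^sub>f h\<^sub>f v\<^sub>f =
     inverse (zeta_p p 2 ^ 3 / zeta_p p 2
              * (L_half_triple p \<alpha> \<beta> / (L_ad_unramified p \<alpha> \<beta> * (L_ad_steinberg p)\<^sup>2)))
     * local_integral \<mu> \<rho>\<^sub>\<phi> h\<^sub>\<phi> v\<^sub>\<phi> \<rho>\<^sub>f h\<^sub>f v\<^sub>f"

end

theory Submission
  imports Defs "HOL-Number_Theory.Cong"
begin

text \<open>
  Both matrix coefficients are right invariant under the Iwahori subgroup \<open>I\<close>, so the integral is a sum
  over \<open>G/I\<close>.  The reduced words of the extended affine Weyl group give the coset representatives
  \<open>\<omega>\<^sup>a ((p\<^sup>n, y), (0, 1)) \<omega>\<^sup>b\<close> with \<open>0 \<le> y < p\<^sup>n\<close>, where \<open>\<omega> = ((0, 1), (p, 0))\<close>.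
  The Iwahori-fixed vector of the twisted Steinberg representation is, up to sign, fixed by \<open>\<omega>\<close> and by
  \<open>U\<^sub>p\<close>, so its squared matrix coefficient is \<open>p\<^sup>-\<^sup>2\<^sup>n\<close> there and the unramified twist disappears.
  The spherical coefficient depends on the \<open>K\<close>-double coset only and satisfies the recurrence of the
  Hecke operator, which sums the resulting series in closed form.  Unitarity bounds the
  spherical coefficients by 1; together with irreducibility it keeps all local factors finite and nonzero.
\<close>


section \<open>The field of p-adic numbers\<close>

text \<open>The pairings in the theorem are only assumed invariant and nonzero, so a priori they may
  be indefinite and \<open>h v v\<close> could vanish; division by zero would then make the matrix
  coefficient identically 0. Irreducibility excludes this. The estimate of the spherical
  coefficients may come from a different, positive definite form, because the numbers
  \<open>hecke_seq lam n\<close> depend on the Hecke eigenvalue alone. Put \<kappa> = \<alpha> /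
  sqrt p, u = \<beta> / sqrt p and P = p. The local integral is (1 - 1/P) (1 + \<kappa>) (1 + u) /
  (P (1 - \<kappa>/P) (1 - u/P)), and the normalizing factor is (1 - \<kappa>^2) (1 - 1/P) (1 - u^2)
  / ((1 - \<kappa>) (1 - u) (1 - \<kappa>/P) (1 - u/P)). Their quotient is 1/P as soon as no factor
  vanishes. The values to be excluded are therefore \<kappa> = 1, -1, then u = 1, -1, and finally
  \<kappa> = p and u = p. The first pair contradicts irreducibility, the second is reduced to the
  first by the equality case of Cauchy-Schwarz, and the last two violate the bound by 1.\<close>

abbreviation nrm :: "'k::{field_char_0,complete_space} \<Rightarrow> real" where
  "nrm x \<equiv> dist x 0"

locale padic =
  fixes p :: nat and K :: "'k::{field_char_0,complete_space} itself"
  assumes padic: "is_padic_field p K"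
begin

lemma prime_p: "prime p"
  using padic unfolding is_padic_field_def by auto

lemma p_gt_1: "p > 1"
  using prime_p prime_gt_1_nat by blast

lemma nrm_rat: "nrm (of_rat r :: 'k) = padic_abs p r"
  using padic unfolding is_padic_field_def by auto

lemma dist_nrm: "dist x y = nrm (x - y :: 'k)"
proof -
  have "dist (x - y + y) (0 + y) = dist (x - y) 0"
    using padic unfolding is_padic_field_def by blast
  then show ?thesis by simp
qed

lemma nrm_mult: "nrm (x * y :: 'k) = nrm x * nrm y"
  using padic unfolding is_padic_field_def by blast

lemma nrm_eq_0 [simp]: "nrm (x :: 'k) = 0 \<longleftrightarrow> x = 0"
  by simp

lemma nrm_pos [simp]: "0 < nrm (x :: 'k) \<longleftrightarrow> x \<noteq> 0"
  by simp

lemma nrm_1 [simp]: "nrm (1 :: 'k) = 1"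
proof -
  have "nrm (1 * 1 :: 'k) = nrm (1 :: 'k) * nrm (1 :: 'k)" by (rule nrm_mult)
  then show ?thesis by (metis mult_cancel_left1 mult_1 nrm_eq_0 zero_neq_one)
qed

lemma nrm_minus [simp]: "nrm (- x :: 'k) = nrm x"
  using dist_nrm[of 0 x] by (simp add: dist_commute)

lemma nrm_diff_commute: "nrm (x - y :: 'k) = nrm (y - x)"
  by (metis nrm_minus minus_diff_eq)

lemma nrm_inverse: "nrm (inverse x :: 'k) = inverse (nrm x)"
proof (cases "x = 0")
  case False
  have "nrm (x * inverse x) = nrm x * nrm (inverse x)" by (rule nrm_mult)
  then show ?thesis using False by (simp add: field_simps)
qed simp

lemma nrm_divide: "nrm (x / y :: 'k) = nrm x / nrm y"
  by (simp add: divide_inverse nrm_mult nrm_inverse)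

lemma nrm_power: "nrm (x ^ n :: 'k) = nrm x ^ n"
  by (induction n) (simp_all add: nrm_mult)

lemma nrm_of_int:
  "a \<noteq> 0 \<Longrightarrow> nrm (of_int a :: 'k) = real p powi (- int (multiplicity (int p) a))"
  using nrm_rat[of "of_int a"] by (simp add: padic_abs_def)

text \<open>The bridge between norm estimates and congruences modulo \<open>p ^ n\<close>.\<close>

lemma nrm_of_int_le_iff:
  "nrm (of_int a :: 'k) \<le> (1 / real p) ^ n \<longleftrightarrow> int p ^ n dvd a"
proof (cases "a = 0")
  case False
  have "nrm (of_int a :: 'k) = (1 / real p) ^ multiplicity (int p) a"
    using False by (simp add: nrm_of_int power_int_minus power_one_over inverse_eq_divide)
  moreover have "(1 / real p) ^ m \<le> (1 / real p) ^ n \<longleftrightarrow> n \<le> m" for m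
    using p_gt_1 by (subst power_decreasing_iff) auto
  moreover have "int p ^ n dvd a \<longleftrightarrow> n \<le> multiplicity (int p) a"
    using False p_gt_1 prime_p
    by (subst power_dvd_iff_le_multiplicity) auto
  ultimately show ?thesis by simp
qed simp

lemma nrm_of_int_le_1: "nrm (of_int a :: 'k) \<le> 1"
  using nrm_of_int_le_iff[of a 0] by simp

lemma nrm_p: "nrm (of_nat p :: 'k) = 1 / real p"
proof -
  have "multiplicity (int p) (int p) = 1"
    using prime_p by (intro multiplicity_self) (auto simp: prime_elem_not_unit)
  then show ?thesis
    using nrm_of_int[of "int p"] p_gt_1 by (simp add: power_int_minus inverse_eq_divide)
qed

lemma nrm_p_power: "nrm (of_nat p ^ n :: 'k) = (1 / real p) ^ n"
  by (simp add: nrm_power nrm_p)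

text \<open>\<open>is_padic_field\<close> gives the norm on rationals but does not postulate the
  strong triangle inequality. Dividing by the larger summand reduces it to closure of the unit ball
  under addition; there a fraction in lowest terms has denominator prime to \<open>p\<close>, so
  only integral numerators matter.\<close>

lemma ultrametric_rat:
  "nrm (of_rat (r + s) :: 'k) \<le> max (nrm (of_rat r :: 'k)) (nrm (of_rat s :: 'k))"
proof -
  have unit: "nrm (of_rat (r + s) :: 'k) \<le> 1"
    if rs: "nrm (of_rat r :: 'k) \<le> 1" "nrm (of_rat s :: 'k) \<le> 1" for r s
  proof -
    have repr: "\<exists>a b. nrm (of_int b :: 'k) = 1 \<and> b \<noteq> 0 \<and> r = of_int a / of_int b"
      if "nrm (of_rat r :: 'k) \<le> 1" for r
    proof -
      obtain a b where q: "quotient_of r = (a, b)" by force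
      have b: "b > 0" and cop: "coprime a b" and r: "r = of_int a / of_int b"
        using q quotient_of_denom_pos quotient_of_coprime quotient_of_div by blast+
      have "nrm (of_int b :: 'k) = 1"
      proof (rule ccontr)
        assume "nrm (of_int b :: 'k) \<noteq> 1"
        then have "multiplicity (int p) b \<noteq> 0"
          using nrm_of_int[of b] b by (intro notI) simp
        then have pb: "int p dvd b"
          using not_dvd_imp_multiplicity_0[of "int p" b] by linarith
        then have "\<not> int p dvd a"
          using cop p_gt_1 coprime_common_divisor[of a b "int p"] by auto
        then have "\<not> nrm (of_int a :: 'k) < 1"
          using nrm_of_int[of a] not_dvd_imp_multiplicity_0[of "int p" a] by (cases "a = 0") auto
        moreover have "nrm (of_int b :: 'k) < 1"
          using nrm_of_int_le_1[of b] \<open>nrm (of_int b :: 'k) \<noteq> 1\<close> by simp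
        moreover have "nrm (of_int a :: 'k) = nrm (of_rat r :: 'k) * nrm (of_int b :: 'k)"
          using b by (simp add: r of_rat_divide flip: nrm_mult)
        ultimately show False
          using that by (metis mult_left_le_one_le zero_le_dist le_less_trans)
      qed
      then show ?thesis using b r by blast
    qed
    obtain a b c d where "nrm (of_int b :: 'k) = 1" "b \<noteq> 0" "r = of_int a / of_int b"
      "nrm (of_int d :: 'k) = 1" "d \<noteq> 0" "s = of_int c / of_int d"
      using repr[OF rs(1)] repr[OF rs(2)] by blast
    moreover from this have "r + s = of_int (a * d + c * b) / of_int (b * d)"
      by (simp add: field_simps)
    ultimately show ?thesis
      using nrm_of_int_le_1[of "a * d + c * b"]
      by (simp add: of_rat_divide nrm_divide nrm_mult of_rat_mult del: of_int_add)
  qed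
  have *: "nrm (of_rat (r + s) :: 'k) \<le> nrm (of_rat r :: 'k)"
    if "nrm (of_rat s :: 'k) \<le> nrm (of_rat r :: 'k)" for r s
  proof (cases "r = 0")
    case False
    have "nrm (of_rat (1 + s / r) :: 'k) \<le> 1"
      using that False by (intro unit) (auto simp: of_rat_divide nrm_divide)
    moreover have "of_rat (r + s) = (of_rat r * of_rat (1 + s / r) :: 'k)"
      using False by (simp flip: of_rat_mult add: field_simps)
    ultimately show ?thesis
      by (simp add: nrm_mult mult_left_le)
  qed (use that in auto)
  show ?thesis
    using *[of s r] *[of r s] by (cases "nrm (of_rat s :: 'k) \<le> nrm (of_rat r :: 'k)") (auto simp: add.commute)
qed

lemma rat_approx: "e > 0 \<Longrightarrow> \<exists>r. nrm (x - of_rat r :: 'k) < e"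
proof -
  assume "e > 0"
  moreover have "x \<in> closure (range (of_rat :: rat \<Rightarrow> 'k))"
    using padic unfolding is_padic_field_def by blast
  ultimately obtain y where "y \<in> range (of_rat :: rat \<Rightarrow> 'k)" "dist y x < e"
    unfolding closure_approachable by blast
  then show ?thesis
    by (metis dist_commute dist_nrm rangeE)
qed

lemma nrm_triangle: "nrm (x + y :: 'k) \<le> nrm x + nrm y"
  using dist_triangle[of x "- y" 0] dist_nrm[of x "- y"] by (metis dist_commute diff_minus_eq_add nrm_minus)

text \<open>Density of the rationals: approximation within \<open>e / 4\<close> costs less than
  \<open>e\<close> through the ordinary triangle inequality, and \<open>ultrametric_rat\<close>
  applies to the approximants.\<close>

lemma ultrametric: "nrm (x + y :: 'k) \<le> max (nrm x) (nrm y)"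
proof (rule field_le_epsilon)
  fix e :: real assume "e > 0"
  then obtain r s where r: "nrm (x - of_rat r) < e / 4" and s: "nrm (y - of_rat s) < e / 4"
    using rat_approx[of "e / 4"] by (metis divide_pos_pos zero_less_numeral)
  have "nrm (x + y) \<le> nrm (of_rat (r + s) :: 'k) + nrm ((x - of_rat r) + (y - of_rat s))"
    using nrm_triangle[of "of_rat (r + s)" "(x - of_rat r) + (y - of_rat s)"] by (simp add: of_rat_add)
  moreover have "nrm ((x - of_rat r) + (y - of_rat s)) \<le> nrm (x - of_rat r) + nrm (y - of_rat s)"
    by (rule nrm_triangle)
  moreover have "nrm (of_rat r :: 'k) \<le> nrm x + nrm (x - of_rat r)"
    using nrm_triangle[of x "of_rat r - x"] nrm_diff_commute[of x "of_rat r"] by simp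
  moreover have "nrm (of_rat s :: 'k) \<le> nrm y + nrm (y - of_rat s)"
    using nrm_triangle[of y "of_rat s - y"] nrm_diff_commute[of y "of_rat s"] by simp
  moreover have "nrm x \<le> max (nrm x) (nrm y)" "nrm y \<le> max (nrm x) (nrm y)"
    by simp_all
  ultimately have "nrm (of_rat r :: 'k) \<le> max (nrm x) (nrm y) + e / 4"
    "nrm (of_rat s :: 'k) \<le> max (nrm x) (nrm y) + e / 4"
    "nrm (x + y) \<le> nrm (of_rat (r + s) :: 'k) + e / 2"
    using r s by linarith+
  then show "nrm (x + y) \<le> max (nrm x) (nrm y) + e"
    using ultrametric_rat[of r s] \<open>e > 0\<close> by linarith
qed

lemma ultrametric_le: "nrm (x :: 'k) \<le> c \<Longrightarrow> nrm y \<le> c \<Longrightarrow> nrm (x + y) \<le> c"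
  using ultrametric[of x y] by simp

lemma ultrametric_less: "nrm (x :: 'k) < c \<Longrightarrow> nrm y < c \<Longrightarrow> nrm (x + y) < c"
  using ultrametric[of x y] by simp

lemma ultrametric_diff_le: "nrm (x :: 'k) \<le> c \<Longrightarrow> nrm y \<le> c \<Longrightarrow> nrm (x - y) \<le> c"
  using ultrametric_le[of x c "- y"] by simp

lemma nrm_add_eq: "nrm (y :: 'k) < nrm x \<Longrightarrow> nrm (x + y) = nrm x"
  using ultrametric[of x y] ultrametric[of "x + y" "- y"] by (simp add: max_def split: if_splits)

lemma nrm_add_eq': "nrm (y :: 'k) < nrm x \<Longrightarrow> nrm (y + x) = nrm x"
  using nrm_add_eq[of y x] by (simp add: add.commute)

lemma nrm_diff_eq: "nrm (y :: 'k) < nrm x \<Longrightarrow> nrm (x - y) = nrm x"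
  using nrm_add_eq[of "- y" x] by simp

text \<open>A rational closer to \<open>x\<close> than \<open>nrm x\<close> has the same norm, so
  completion adds no new values.\<close>

lemma nrm_eq_powi: "(x :: 'k) \<noteq> 0 \<Longrightarrow> \<exists>n. nrm x = real p powi (- n)"
proof -
  assume x: "x \<noteq> 0"
  then obtain r where "nrm (x - of_rat r) < nrm x"
    using rat_approx[of "nrm x" x] by auto
  then have r: "nrm (of_rat r :: 'k) = nrm x"
    using nrm_diff_eq[of "x - of_rat r" x] by simp
  then have "r \<noteq> 0" using x by auto
  then show ?thesis
    using nrm_rat[of r] unfolding r padic_abs_def
    by (intro exI[of _ "int (multiplicity (int p) (fst (quotient_of r)))
      - int (multiplicity (int p) (snd (quotient_of r)))"]) simp
qed

lemma powi_p_inj: "real p powi m = real p powi n \<longleftrightarrow> m = n"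
  using p_gt_1 power_int_strict_increasing[of m n "real p"] power_int_strict_increasing[of n m "real p"]
  by (cases m n rule: linorder_cases) auto

lemma powi_p_less: "real p powi m < real p powi n \<longleftrightarrow> m < n"
  using p_gt_1 power_int_strict_increasing[of m n "real p"] power_int_strict_increasing[of n m "real p"]
  by (cases m n rule: linorder_cases) auto

lemma powi_p_le: "real p powi m \<le> real p powi n \<longleftrightarrow> m \<le> n"
  using powi_p_less[of n m] by linarith

lemma pval_eqI: "nrm (x :: 'k) = real p powi (- n) \<Longrightarrow> pval p x = n"
  unfolding pval_def by (rule the_equality) (auto simp: powi_p_inj)

lemma nrm_pval: "(x :: 'k) \<noteq> 0 \<Longrightarrow> nrm x = real p powi (- pval p x)"
  using nrm_eq_powi[of x] pval_eqI[of x] by auto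

lemma pval_mult: "(x :: 'k) \<noteq> 0 \<Longrightarrow> y \<noteq> 0 \<Longrightarrow> pval p (x * y) = pval p x + pval p y"
  using p_gt_1 by (intro pval_eqI) (simp add: nrm_mult nrm_pval[of x] nrm_pval[of y] flip: power_int_add)

lemma pval_cong: "nrm (x :: 'k) = nrm (y :: 'k) \<Longrightarrow> pval p x = pval p y"
  by (simp add: pval_def)

lemma pval_p: "pval p (of_nat p :: 'k) = 1"
  by (rule pval_eqI) (simp add: nrm_p power_int_minus inverse_eq_divide)

text \<open>Discreteness of the value group. It turns the strict condition on the lower left entry
  of an Iwahori matrix into a weak one with a factor \<open>p\<close>.\<close>

lemma nrm_less_iff: "nrm (x :: 'k) < nrm (y :: 'k) \<longleftrightarrow> y \<noteq> 0 \<and> nrm x \<le> nrm y / real p"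
proof (cases "x = 0 \<or> y = 0")
  case False
  have "nrm y / real p = real p powi (- pval p y - 1)"
    using False p_gt_1 by (simp add: nrm_pval[of y] power_int_diff)
  then show ?thesis
    using False p_gt_1 by (auto simp: nrm_pval[of x] nrm_pval[of y] powi_p_less powi_p_le)
qed auto

text \<open>The ring of integers modulo \<open>p ^ n\<close> is Z modulo \<open>p ^ n\<close>: a
  rational \<open>a / b\<close> close to \<open>x\<close> has \<open>b\<close> prime to
  \<open>p\<close>, and \<open>y\<close> is \<open>a\<close> times an inverse of
  \<open>b\<close>.\<close>

lemma residue:
  assumes "nrm (x :: 'k) \<le> 1"
  shows "\<exists>!y. y < p ^ n \<and> nrm (x - of_nat y) \<le> (1 / real p) ^ n"
proof -
  obtain r where r: "nrm (x - of_rat r) < (1 / real p) ^ n"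
    using rat_approx[of "(1 / real p) ^ n" x] p_gt_1 by auto
  have r1: "nrm (of_rat r :: 'k) \<le> 1"
  proof -
    have "(1 / real p) ^ n \<le> 1"
      using p_gt_1 by (intro power_le_one) auto
    then have "nrm (x - of_rat r) \<le> 1"
      using r by simp
    then show ?thesis
      using ultrametric_diff_le[of x 1 "x - of_rat r"] assms by simp
  qed
  obtain a b where q: "quotient_of r = (a, b)" by force
  have b: "b > 0" and cop: "coprime a b" and rab: "r = of_int a / of_int b"
    using q quotient_of_denom_pos quotient_of_coprime quotient_of_div by blast+
  have "\<not> int p dvd b"
  proof
    assume pb: "int p dvd b"
    then have "\<not> int p dvd a"
      using cop p_gt_1 coprime_common_divisor[of a b "int p"] by auto
    then have "nrm (of_int a :: 'k) > 1 / real p" "nrm (of_int b :: 'k) \<le> 1 / real p"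
      using nrm_of_int_le_iff[of a 1] nrm_of_int_le_iff[of b 1] pb by auto
    moreover have "nrm (of_int a :: 'k) = nrm (of_rat r :: 'k) * nrm (of_int b :: 'k)"
      using b by (simp add: rab of_rat_divide flip: nrm_mult)
    ultimately show False
      using mult_right_mono[OF r1, of "nrm (of_int b :: 'k)"] by simp
  qed
  then have "coprime b (int p ^ n)"
    using prime_p prime_imp_coprime[of "int p" b] by (simp add: coprime_commute)
  then obtain c where c: "[b * c = 1] (mod int p ^ n)"
    using cong_solve_coprime_int by blast
  define y where "y = nat ((a * c) mod int p ^ n)"
  have y: "int y = (a * c) mod int p ^ n"
    using p_gt_1 by (simp add: y_def)
  have "y < p ^ n"
  proof -
    have "int y < int (p ^ n)"
      using p_gt_1 by (simp add: y)
    then show ?thesis by (simp only: of_nat_less_iff)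
  qed
  moreover have "nrm (x - of_nat y) \<le> (1 / real p) ^ n"
  proof -
    have "[a - b * int y = a - b * (a * c)] (mod int p ^ n)"
      unfolding y by (intro cong_diff cong_mult) (auto simp: cong_def)
    moreover have "[a - b * (a * c) = a - a * 1] (mod int p ^ n)"
      using cong_mult[OF cong_refl[of a] c] by (intro cong_diff) (auto simp: ac_simps)
    ultimately have "[a - b * int y = 0] (mod int p ^ n)"
      using cong_trans by fastforce
    then have "int p ^ n dvd a - b * int y" by (simp add: cong_0_iff)
    then have "nrm (of_int (a - b * int y) :: 'k) \<le> (1 / real p) ^ n"
      by (simp only: nrm_of_int_le_iff)
    moreover have "nrm (of_int b :: 'k) = 1"
      using nrm_of_int[of b] b not_dvd_imp_multiplicity_0[OF \<open>\<not> int p dvd b\<close>] by simp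
    moreover have "of_rat r - of_nat y = (of_int (a - b * int y) / of_int b :: 'k)"
      using b by (simp add: rab of_rat_divide field_simps)
    ultimately have "nrm (of_rat r - of_nat y :: 'k) \<le> (1 / real p) ^ n"
      by (simp add: nrm_divide)
    then show ?thesis
      using r ultrametric_le[of "x - of_rat r" "(1 / real p) ^ n" "of_rat r - of_nat y"] by simp
  qed
  moreover have "y' = y" if "y' < p ^ n" "nrm (x - of_nat y') \<le> (1 / real p) ^ n" for y'
  proof -
    have "nrm (of_int (int y - int y') :: 'k) \<le> (1 / real p) ^ n"
      using ultrametric_diff_le[OF that(2) \<open>nrm (x - of_nat y) \<le> _\<close>] by simp
    then have "int p ^ n dvd int y - int y'" by (simp only: nrm_of_int_le_iff)
    then have "int y mod int p ^ n = int y' mod int p ^ n"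
      by (simp add: mod_eq_dvd_iff)
    then show ?thesis
      using \<open>y < p ^ n\<close> that(1) by (simp flip: of_nat_power zmod_int)
  qed
  ultimately show ?thesis by blast
qed

lemma residue_unique:
  assumes "y < p ^ n" "y' < p ^ n" "nrm (of_nat y - of_nat y' :: 'k) \<le> (1 / real p) ^ n"
  shows "y = y'"
  using residue[of "of_nat y" n] assms nrm_of_int_le_1[of "int y"] by auto

end

section \<open>The group PGL(2) and its compact open subgroups\<close>

lemma mat2_nth [simp]:
  "mat2 a b c d $ 1 $ 1 = a" "mat2 a b c d $ 1 $ 2 = b"
  "mat2 a b c d $ 2 $ 1 = c" "mat2 a b c d $ 2 $ 2 = d"
  by (simp_all add: mat2_def)

lemma mat2_eta: "A = mat2 (A $ 1 $ 1) (A $ 1 $ 2) (A $ 2 $ 1) (A $ 2 $ 2)"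
  by (simp add: vec_eq_iff forall_2)

lemma det_mat2 [simp]: "det (mat2 a b c d :: 'a::comm_ring_1^2^2) = a * d - b * c"
  by (simp add: det_2)

lemma mat2_mult:
  "mat2 a b c d ** mat2 a' b' c' d' =
     mat2 (a * a' + b * c') (a * b' + b * d') (c * a' + d * c') (c * b' + d * d' :: 'a::semiring_1)"
  by (simp add: vec_eq_iff forall_2 matrix_matrix_mult_def sum_2)

lemma mat_1_eq_mat2: "mat 1 = (mat2 1 0 0 1 :: 'a::zero_neq_one^2^2)"
  by (simp add: vec_eq_iff forall_2 mat_def)

lemma smult_mat_mat2: "smult_mat t (mat2 a b c d) = mat2 (t * a) (t * b) (t * c) (t * d)"
  by (simp add: vec_eq_iff forall_2 smult_mat_def)

lemma mat2_eq_iff: "mat2 a b c d = mat2 a' b' c' d' \<longleftrightarrow> a = a' \<and> b = b' \<and> c = c' \<and> d = d'"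
  by (auto simp: vec_eq_iff forall_2)

lemma pgl2_rel_self: "pgl2_rel A A \<longleftrightarrow> det A \<noteq> 0"
  using pgl2_rel_refl[of A] by (auto simp: pgl2_rel_def invertible_det_nz)

lemma pgl2_mat_mult:
  assumes "a * d - b * c \<noteq> 0" "a' * d' - b' * c' \<noteq> 0"
  shows "pgl2_mat a b c d * pgl2_mat a' b' c' d' =
     pgl2_mat (a * a' + b * c') (a * b' + b * d') (c * a' + d * c') (c * b' + d * d')"
  unfolding pgl2_mat_def using assms
  by (subst times_pgl2.abs_eq) (simp_all add: pgl2_rel_self mat2_mult)

lemma abs_pgl2_eq_iff:
  "det A \<noteq> 0 \<Longrightarrow> det B \<noteq> 0 \<Longrightarrow> abs_pgl2 A = abs_pgl2 B \<longleftrightarrow> (\<exists>t. t \<noteq> 0 \<and> B = smult_mat t A)"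
  using Quotient3_rel[OF Quotient3_pgl2, of A B] pgl2_rel_self[of A] pgl2_rel_self[of B]
  by (auto simp: pgl2_rel_def invertible_det_nz)

lemma pgl2_mat_eq_iff:
  assumes "a * d - b * c \<noteq> 0" "a' * d' - b' * c' \<noteq> 0"
  shows "pgl2_mat a b c d = pgl2_mat a' b' c' d' \<longleftrightarrow>
     (\<exists>t. t \<noteq> 0 \<and> a' = t * a \<and> b' = t * b \<and> c' = t * c \<and> d' = t * d)"
  unfolding pgl2_mat_def using assms
  by (subst abs_pgl2_eq_iff) (simp_all add: smult_mat_mat2 mat2_eq_iff)

lemma pgl2_mat_scale:
  assumes "a * d - b * c \<noteq> 0" "t \<noteq> 0"
  shows "pgl2_mat (t * a) (t * b) (t * c) (t * d) = pgl2_mat a b c d"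
proof -
  have "t * a * (t * d) - t * b * (t * c) = t * t * (a * d - b * c)"
    by (simp add: algebra_simps)
  then have "t * a * (t * d) - t * b * (t * c) \<noteq> 0" using assms by simp
  then show ?thesis using assms pgl2_mat_eq_iff[of a d b c "t * a" "t * d" "t * b" "t * c"] by metis
qed

lemma pgl2_mat_eqI:
  assumes "a * d - b * c \<noteq> 0" "t \<noteq> 0" "a' = t * a" "b' = t * b" "c' = t * c" "d' = t * d"
  shows "pgl2_mat a b c d = pgl2_mat a' b' c' d'"
  using pgl2_mat_scale[OF assms(1,2)] assms by simp

lemma det_rep_pgl2: "det (rep_pgl2 g) \<noteq> 0"
  using Quotient3_rep_reflp[OF Quotient3_pgl2, of g] pgl2_rel_self by blast

lemma abs_rep_pgl2: "abs_pgl2 (rep_pgl2 g) = g"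
  using Quotient3_abs_rep[OF Quotient3_pgl2] by blast

lemma pgl2_cases [case_names mat]:
  obtains a b c d where "a * d - b * c \<noteq> 0" "g = pgl2_mat a b c d"
  using det_rep_pgl2[of g] abs_rep_pgl2[of g] mat2_eta[of "rep_pgl2 g"]
  by (metis det_mat2 pgl2_mat_def)

lemma one_pgl2_eq: "1 = pgl2_mat 1 0 0 1"
  by (simp add: one_pgl2_def pgl2_mat_def mat_1_eq_mat2)

text \<open>The type is an instance of \<open>monoid_mult\<close> only, so inversion is introduced
  separately.\<close>

definition pinv :: "'a::field pgl2 \<Rightarrow> 'a pgl2" where
  "pinv g = (THE h. g * h = 1 \<and> h * g = 1)"

lemma pinv_eqI:
  assumes "g * h = 1" "h * g = 1"
  shows "pinv g = h"
  unfolding pinv_def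
proof (rule the_equality)
  fix h' assume "g * h' = 1 \<and> h' * g = 1"
  then show "h' = h" by (metis assms(1) mult.assoc mult_1 mult.right_neutral)
qed (use assms in auto)

lemma pgl2_mat_mult_adjugate:
  assumes "a * d - b * c \<noteq> 0"
  shows "pgl2_mat a b c d * pgl2_mat d (- b) (- c) a = 1"
proof -
  have "d * a - (- b) * (- c) \<noteq> 0" using assms by (simp add: mult.commute)
  note pgl2_mat_mult[OF assms this]
  also have "pgl2_mat (a * d + b * - c) (a * - b + b * a) (c * d + d * - c) (c * - b + d * a) =
      pgl2_mat 1 0 0 1"
    by (rule sym, rule pgl2_mat_eqI[of _ _ _ _ "a * d - b * c"]) (use assms in \<open>auto simp: algebra_simps\<close>)
  finally show ?thesis by (simp add: one_pgl2_eq)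
qed

lemma pinv_pgl2_mat:
  assumes "a * d - b * c \<noteq> 0"
  shows "pinv (pgl2_mat a b c d) = pgl2_mat d (- b) (- c) a"
proof (rule pinv_eqI)
  have "d * a - (- b) * (- c) \<noteq> 0" using assms by (simp add: mult.commute)
  then show "pgl2_mat d (- b) (- c) a * pgl2_mat a b c d = 1"
    using pgl2_mat_mult_adjugate[of d a "- b" "- c"] by simp
qed (rule pgl2_mat_mult_adjugate[OF assms])

lemma mult_pinv [simp]: "g * pinv g = 1" and pinv_mult [simp]: "pinv g * g = 1"
proof -
  obtain a b c d where g: "a * d - b * c \<noteq> 0" "g = pgl2_mat a b c d" by (rule pgl2_cases)
  then have "d * a - (- b) * (- c) \<noteq> 0" by (simp add: mult.commute)
  then show "g * pinv g = 1" "pinv g * g = 1"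
    using g pgl2_mat_mult_adjugate[of d a "- b" "- c"] pgl2_mat_mult_adjugate[of a d b c]
    by (simp_all add: pinv_pgl2_mat)
qed

lemma mult_pinv_cancel [simp]: "g * (pinv g * h) = h" and pinv_mult_cancel [simp]: "pinv g * (g * h) = h"
  by (simp_all flip: mult.assoc)

lemma pinv_pinv [simp]: "pinv (pinv g) = g"
  by (rule pinv_eqI) simp_all

lemma pinv_prod: "pinv (g * h) = pinv h * pinv g"
  by (rule pinv_eqI) (simp_all add: mult.assoc)

lemma mem_translate_iff: "x \<in> (\<lambda>y. g * y) ` S \<longleftrightarrow> pinv g * x \<in> S"
  by (metis image_iff mult_pinv_cancel pinv_mult_cancel)

section \<open>Membership in the Iwahori and maximal compact subgroups, and openness\<close>

context padic begin

text \<open>The definition asks for some normalized representative; the criterion is homogeneous in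
  the entries and can be tested on any one. The determinant needs no mention because
  \<open>a * d\<close> strictly dominates \<open>b * c\<close>.\<close>

lemma mem_Iwahori_iff:
  fixes a b c d :: 'k
  assumes det: "a * d - b * c \<noteq> 0"
  shows "pgl2_mat a b c d \<in> Iwahori \<longleftrightarrow> nrm a = nrm d \<and> nrm b \<le> nrm d \<and> nrm c < nrm d"
proof
  assume "pgl2_mat a b c d \<in> Iwahori"
  then obtain a' b' c' d' where eq: "pgl2_mat a b c d = pgl2_mat a' b' c' d'"
    and le: "nrm a' \<le> 1" "nrm b' \<le> 1" "nrm c' < 1" "nrm d' \<le> 1" and 1: "nrm (a' * d' - b' * c') = 1"
    unfolding Iwahori_def by blast
  have "nrm (b' * c') < 1"
    using le mult_le_less_imp_less[of "nrm b'" 1 "nrm c'" 1] mult_left_le_one_le[of "nrm c'" "nrm b'"]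
    by (simp add: nrm_mult)
  then have "nrm (a' * d') = 1"
    using nrm_add_eq'[of "b' * c'" "a' * d' - b' * c'"] 1 by simp
  then have "nrm a' = 1" "nrm d' = 1"
    using le mult_left_le_one_le[of "nrm a'" "nrm d'"] mult_left_le_one_le[of "nrm d'" "nrm a'"]
    by (simp_all add: nrm_mult mult.commute)
  moreover have "a' * d' - b' * c' \<noteq> 0" using 1 by auto
  then obtain t where "t \<noteq> 0" "a' = t * a" "b' = t * b" "c' = t * c" "d' = t * d"
    using eq pgl2_mat_eq_iff[OF det, of a' d' b' c'] by blast
  moreover from this have "nrm t * nrm b \<le> nrm t * nrm d" "nrm t * nrm c < nrm t * nrm d"
    "nrm t * nrm a = nrm t * nrm d"
    using le calculation(1,2) by (simp_all flip: nrm_mult)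
  ultimately show "nrm a = nrm d \<and> nrm b \<le> nrm d \<and> nrm c < nrm d"
    by simp
next
  assume *: "nrm a = nrm d \<and> nrm b \<le> nrm d \<and> nrm c < nrm d"
  then have "d \<noteq> 0" by auto
  have "pgl2_mat a b c d = pgl2_mat (inverse d * a) (inverse d * b) (inverse d * c) (inverse d * d)"
    using \<open>d \<noteq> 0\<close> by (intro pgl2_mat_eqI[OF det, of "inverse d"]) auto
  moreover have "nrm (inverse d * a) = 1" "nrm (inverse d * b) \<le> 1" "nrm (inverse d * c) < 1"
    using * \<open>d \<noteq> 0\<close> by (auto simp: nrm_divide inverse_eq_divide)
  moreover have "nrm (inverse d * a * (inverse d * d) - inverse d * b * (inverse d * c)) = 1"
  proof -
    have "nrm (inverse d * b * (inverse d * c)) < 1"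
      using calculation(3,4) mult_left_le_one_le[of "nrm (inverse d * c)" "nrm (inverse d * b)"]
      by (metis nrm_mult zero_le_dist order.strict_trans1)
    then show ?thesis
      using nrm_diff_eq[of "inverse d * b * (inverse d * c)" "inverse d * a * (inverse d * d)"]
        calculation(2) \<open>d \<noteq> 0\<close> by simp
  qed
  ultimately show "pgl2_mat a b c d \<in> Iwahori"
    unfolding Iwahori_def mem_Collect_eq using \<open>d \<noteq> 0\<close>
    by (intro exI[of _ "inverse d * a"] exI[of _ "inverse d * b"] exI[of _ "inverse d * c"]
        exI[of _ "inverse d * d"]) (auto simp: nrm_mult nrm_inverse)
qed

lemma one_in_Iwahori: "(1 :: 'k pgl2) \<in> Iwahori"
  unfolding one_pgl2_eq by (subst mem_Iwahori_iff) auto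

lemma Iwahori_mult:
  assumes "g \<in> Iwahori" "h \<in> Iwahori"
  shows "g * h \<in> (Iwahori :: 'k pgl2 set)"
proof -
  obtain a b c d where g: "a * d - b * c \<noteq> 0" "g = pgl2_mat a b c d" by (rule pgl2_cases)
  obtain a' b' c' d' where h: "a' * d' - b' * c' \<noteq> 0" "h = pgl2_mat a' b' c' d'" by (rule pgl2_cases)
  have n: "nrm a = nrm d" "nrm b \<le> nrm d" "nrm c < nrm d"
    "nrm a' = nrm d'" "nrm b' \<le> nrm d'" "nrm c' < nrm d'"
    using assms g h mem_Iwahori_iff by blast+
  then have pos: "0 < nrm d" "0 < nrm d'"
    using zero_le_dist[of c 0] zero_le_dist[of c' 0] by linarith+
  have "(a * a' + b * c') * (c * b' + d * d') - (a * b' + b * d') * (c * a' + d * c')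
      = (a * d - b * c) * (a' * d' - b' * c')"
    by (simp add: algebra_simps)
  also have "\<dots> \<noteq> 0" using g h by simp
  finally have det: "(a * a' + b * c') * (c * b' + d * d') - (a * b' + b * d') * (c * a' + d * c') \<noteq> 0" .
  have 1: "nrm (b * c') < nrm d * nrm d'"
    unfolding nrm_mult
    using mult_right_mono[OF n(2), of "nrm c'"] mult_strict_left_mono[OF n(6) pos(1)] by simp
  have 2: "nrm (c * b') < nrm d * nrm d'"
    unfolding nrm_mult
    using mult_left_mono[OF n(5), of "nrm c"] mult_strict_right_mono[OF n(3) pos(2)] by simp
  have e1: "nrm (a * a' + b * c') = nrm d * nrm d'"
    using nrm_add_eq[of "b * c'" "a * a'"] 1 n by (simp add: nrm_mult)
  have e2: "nrm (c * b' + d * d') = nrm d * nrm d'"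
    using nrm_add_eq'[of "c * b'" "d * d'"] 2 by (simp add: nrm_mult)
  have e3: "nrm (a * b' + b * d') \<le> nrm d * nrm d'"
    using n by (intro ultrametric_le) (auto simp: nrm_mult mult_left_mono mult_right_mono)
  have e4: "nrm (c * a' + d * c') < nrm d * nrm d'"
    using n pos by (intro ultrametric_less) (auto simp: nrm_mult)
  show ?thesis
    unfolding g(2) h(2) pgl2_mat_mult[OF g(1) h(1)] mem_Iwahori_iff[OF det]
    using e1 e2 e3 e4 by simp
qed

lemma pinv_Iwahori: "g \<in> Iwahori \<Longrightarrow> pinv g \<in> (Iwahori :: 'k pgl2 set)"
proof -
  assume I: "g \<in> Iwahori"
  obtain a b c d where g: "a * d - b * c \<noteq> 0" "g = pgl2_mat a b c d" by (rule pgl2_cases)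
  have "d * a - (- b) * (- c) \<noteq> 0" using g by (simp add: mult.commute)
  with I g show ?thesis
    by (simp add: pinv_pgl2_mat mem_Iwahori_iff)
qed

lemma mem_K_max_I:
  fixes a b c d :: 'k
  assumes "nrm a \<le> 1" "nrm b \<le> 1" "nrm c \<le> 1" "nrm d \<le> 1" "nrm (a * d - b * c) = 1"
  shows "pgl2_mat a b c d \<in> K_max"
  using assms unfolding K_max_def by blast

text \<open>Both sides are homogeneous of degree two, so the bounds hold for every representative.
  They serve to show that an element lies outside \<open>K_max\<close>.\<close>

lemma mem_K_max_D:
  fixes a b c d :: 'k
  assumes "pgl2_mat a b c d \<in> K_max" and det: "a * d - b * c \<noteq> 0"
  shows "nrm a ^ 2 \<le> nrm (a * d - b * c)" "nrm b ^ 2 \<le> nrm (a * d - b * c)"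
    "nrm c ^ 2 \<le> nrm (a * d - b * c)" "nrm d ^ 2 \<le> nrm (a * d - b * c)"
proof -
  obtain a' b' c' d' where eq: "pgl2_mat a b c d = pgl2_mat a' b' c' d'"
    and le: "nrm a' \<le> 1" "nrm b' \<le> 1" "nrm c' \<le> 1" "nrm d' \<le> 1" and 1: "nrm (a' * d' - b' * c') = 1"
    using assms(1) unfolding K_max_def by blast
  have "a' * d' - b' * c' \<noteq> 0" using 1 by auto
  then obtain t where t: "t \<noteq> 0" "a' = t * a" "b' = t * b" "c' = t * c" "d' = t * d"
    using eq pgl2_mat_eq_iff[OF det, of a' d' b' c'] by blast
  have "a' * d' - b' * c' = t ^ 2 * (a * d - b * c)"
    by (simp add: t power2_eq_square algebra_simps)
  then have D: "nrm t ^ 2 * nrm (a * d - b * c) = 1"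
    using 1 by (simp add: nrm_mult nrm_power)
  have "nrm x ^ 2 \<le> nrm (a * d - b * c)" if "nrm (t * x) \<le> 1" for x
  proof -
    have "nrm t ^ 2 * nrm x ^ 2 \<le> nrm t ^ 2 * nrm (a * d - b * c)"
      unfolding D using that by (simp add: nrm_mult power_le_one flip: power_mult_distrib)
    then show ?thesis using t(1) by simp
  qed
  then show "nrm a ^ 2 \<le> nrm (a * d - b * c)" "nrm b ^ 2 \<le> nrm (a * d - b * c)"
    "nrm c ^ 2 \<le> nrm (a * d - b * c)" "nrm d ^ 2 \<le> nrm (a * d - b * c)"
    using le t by auto
qed

lemma Iwahori_subset_K_max: "(Iwahori :: 'k pgl2 set) \<subseteq> K_max"
proof
  fix g :: "'k pgl2" assume "g \<in> Iwahori"
  then show "g \<in> K_max"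
    unfolding Iwahori_def by clarify (rule mem_K_max_I, auto)
qed

lemma K_max_mult:
  assumes "g \<in> K_max" "h \<in> K_max"
  shows "g * h \<in> (K_max :: 'k pgl2 set)"
proof -
  obtain a b c d where g: "g = pgl2_mat a b c d" "nrm a \<le> 1" "nrm b \<le> 1" "nrm c \<le> 1" "nrm d \<le> 1"
      "nrm (a * d - b * c) = 1"
    using assms(1) unfolding K_max_def by blast
  obtain a' b' c' d' where h: "h = pgl2_mat a' b' c' d'" "nrm a' \<le> 1" "nrm b' \<le> 1" "nrm c' \<le> 1" "nrm d' \<le> 1"
      "nrm (a' * d' - b' * c') = 1"
    using assms(2) unfolding K_max_def by blast
  have nz: "a * d - b * c \<noteq> 0" "a' * d' - b' * c' \<noteq> 0" using g h by auto
  have "(a * a' + b * c') * (c * b' + d * d') - (a * b' + b * d') * (c * a' + d * c')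
      = (a * d - b * c) * (a' * d' - b' * c')"
    by (simp add: algebra_simps)
  then have "nrm ((a * a' + b * c') * (c * b' + d * d') - (a * b' + b * d') * (c * a' + d * c')) = 1"
    using g h by (simp only: nrm_mult) 
  then show ?thesis
    unfolding g(1) h(1) pgl2_mat_mult[OF nz] using g h
    by (intro mem_K_max_I ultrametric_le) (auto simp: nrm_mult intro!: mult_le_one)
qed

text \<open>For \<open>A'\<close> near \<open>A\<close> the adjugate of \<open>A\<close> times
  \<open>A'\<close> is the scalar matrix \<open>D\<close> plus entries smaller than
  \<open>nrm D\<close>, hence represents an Iwahori element. The radius \<open>nrm D / M\<close> is
  chosen for this, \<open>M\<close> bounding the entries of the adjugate.\<close>

lemma open_left_translate_Iwahori: "open ((\<lambda>x. g * x) ` (Iwahori :: 'k pgl2 set))"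
  unfolding open_pgl2_def openin_euclidean_subtopology_iff
proof (intro conjI ballI)
  let ?S = "{A :: 'k^2^2. invertible A \<and> abs_pgl2 A \<in> (\<lambda>x. g * x) ` Iwahori}"
  show "?S \<subseteq> {A. invertible A}" by blast
  fix A :: "'k^2^2" assume A: "A \<in> ?S"
  define a b c d where "a = A $ 1 $ 1" and "b = A $ 1 $ 2" and "c = A $ 2 $ 1" and "d = A $ 2 $ 2"
  have Aeq: "A = mat2 a b c d" unfolding a_def b_def c_def d_def by (rule mat2_eta)
  have det: "a * d - b * c \<noteq> 0" using A unfolding Aeq by (simp add: invertible_det_nz)
  define D where "D = a * d - b * c"
  define M where "M = Max {nrm a, nrm b, nrm c, nrm d, 1}"
  have M: "nrm a \<le> M" "nrm b \<le> M" "nrm c \<le> M" "nrm d \<le> M" "1 \<le> M" unfolding M_def by auto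
  define e where "e = nrm D / M"
  have e: "0 < e" using det M by (simp add: e_def D_def)
  show "\<exists>e>0. \<forall>A'\<in>{A. invertible A}. dist A' A < e \<longrightarrow> A' \<in> ?S"
  proof (intro exI[of _ e] conjI ballI impI e)
    fix A' :: "'k^2^2" assume inv: "A' \<in> {A. invertible A}" and close: "dist A' A < e"
    define a' b' c' d' where "a' = A' $ 1 $ 1" and "b' = A' $ 1 $ 2" and "c' = A' $ 2 $ 1" and "d' = A' $ 2 $ 2"
    have Aeq': "A' = mat2 a' b' c' d'" unfolding a'_def b'_def c'_def d'_def by (rule mat2_eta)
    have det': "a' * d' - b' * c' \<noteq> 0" using inv unfolding Aeq' by (simp add: invertible_det_nz)
    have "dist (A' $ i $ j) (A $ i $ j) < e" for i j
      using dist_vec_nth_le[of A' i A] dist_vec_nth_le[of "A' $ i" j "A $ i"] close by linarith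
    then have cl: "nrm (a' - a) < e" "nrm (b' - b) < e" "nrm (c' - c) < e" "nrm (d' - d) < e"
      unfolding a_def b_def c_def d_def a'_def b'_def c'_def d'_def by (metis dist_nrm)+
    have sm: "nrm (x * y) < nrm D" if "nrm x \<le> M" "nrm y < e" for x y :: 'k
    proof -
      have "nrm x * nrm y \<le> M * nrm y" using that by (intro mult_right_mono) auto
      also have "\<dots> < M * e" using that M by (intro mult_strict_left_mono) auto
      also have "\<dots> = nrm D" using M by (simp add: e_def)
      finally show ?thesis by (simp add: nrm_mult)
    qed
    have dinv: "d * a - (- b) * (- c) \<noteq> 0" using det by (simp add: mult.commute)
    have 1: "nrm (d * (a' - a) + - b * (c' - c)) < nrm D"
      and 2: "nrm (d * (b' - b) + - b * (d' - d)) < nrm D"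
      and 3: "nrm (- c * (a' - a) + a * (c' - c)) < nrm D"
      and 4: "nrm (- c * (b' - b) + a * (d' - d)) < nrm D"
      using cl M by (intro ultrametric_less sm; simp)+
    have "pgl2_mat d (- b) (- c) a * pgl2_mat a' b' c' d' =
       pgl2_mat (d * a' + - b * c') (d * b' + - b * d') (- c * a' + a * c') (- c * b' + a * d')"
      by (rule pgl2_mat_mult[OF dinv det'])
    also have "\<dots> \<in> Iwahori"
    proof (subst mem_Iwahori_iff)
      have "(d * a' + - b * c') * (- c * b' + a * d') - (d * b' + - b * d') * (- c * a' + a * c')
        = (a * d - b * c) * (a' * d' - b' * c')" by (simp add: algebra_simps)
      then show "(d * a' + - b * c') * (- c * b' + a * d') - (d * b' + - b * d') * (- c * a' + a * c') \<noteq> 0"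
        using det det' by simp
      have "d * a' + - b * c' = D + (d * (a' - a) + - b * (c' - c))"
        by (simp add: D_def algebra_simps)
      then have i: "nrm (d * a' + - b * c') = nrm D" using nrm_add_eq[OF 1] by simp
      have "- c * b' + a * d' = D + (- c * (b' - b) + a * (d' - d))"
        by (simp add: D_def algebra_simps)
      then have ii: "nrm (- c * b' + a * d') = nrm D" using nrm_add_eq[OF 4] by simp
      have iii: "d * b' + - b * d' = d * (b' - b) + - b * (d' - d)"
        "- c * a' + a * c' = - c * (a' - a) + a * (c' - c)"
        by (simp_all add: algebra_simps)
      show "nrm (d * a' + - b * c') = nrm (- c * b' + a * d') \<and>
        nrm (d * b' + - b * d') \<le> nrm (- c * b' + a * d') \<and>
        nrm (- c * a' + a * c') < nrm (- c * b' + a * d')"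
        unfolding i ii iii using 2 3 by simp
    qed
    finally have "pinv (abs_pgl2 A) * abs_pgl2 A' \<in> Iwahori"
      unfolding Aeq Aeq' using pinv_pgl2_mat[OF det] by (simp add: pgl2_mat_def)
    moreover have "pinv g * abs_pgl2 A \<in> Iwahori"
      using A by (simp add: mem_translate_iff)
    ultimately have "pinv g * abs_pgl2 A * (pinv (abs_pgl2 A) * abs_pgl2 A') \<in> Iwahori"
      using Iwahori_mult by blast
    then show "A' \<in> ?S"
      using inv by (simp add: mem_translate_iff mult.assoc)
  qed
qed

lemma open_Iwahori: "open (Iwahori :: 'k pgl2 set)"
  using open_left_translate_Iwahori[of 1] by simp

end

section \<open>Iwahori cosets and the Haar measure\<close>

context padic begin

abbreviation pp :: 'k where "pp \<equiv> of_nat p"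

text \<open>For \<open>y < p ^ n\<close> these represent the left cosets in the Iwahori double coset
  of diag(p^n, 1), which defines the n-th power of the operator U_p.\<close>

definition tmat :: "nat \<Rightarrow> nat \<Rightarrow> 'k pgl2" where
  "tmat n y = pgl2_mat (of_nat p ^ n) (of_nat y) 0 1"

text \<open>The Atkin-Lehner element. It normalizes the Iwahori subgroup and is an involution in
  PGL(2), so its exponents below are booleans.\<close>

definition om :: "'k pgl2" where
  "om = pgl2_mat 0 1 (of_nat p) 0"

definition ompow :: "bool \<Rightarrow> 'k pgl2" where
  "ompow b = (if b then om else 1)"

lemma pp_nonzero [simp]: "pp \<noteq> 0"
  using p_gt_1 by simp

lemma p_nonzero [simp]: "p \<noteq> 0"
  using p_gt_1 by simp

lemma om_om [simp]: "om * om = 1"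
proof -
  have "om * om = pgl2_mat pp 0 0 pp"
    unfolding om_def by (subst pgl2_mat_mult) simp_all
  also have "\<dots> = 1"
    unfolding one_pgl2_eq by (rule sym, rule pgl2_mat_eqI[of _ _ _ _ pp]) simp_all
  finally show ?thesis .
qed

lemma om_om_mult [simp]: "om * (om * x) = x"
  by (simp flip: mult.assoc)

lemma pinv_om [simp]: "pinv om = om"
  by (rule pinv_eqI) simp_all

lemma ompow_ompow: "ompow a * ompow b = ompow (a \<noteq> b)"
  by (simp add: ompow_def)

lemma pgl2_mat_mult_om:
  "a * d - b * c \<noteq> 0 \<Longrightarrow> pgl2_mat a b c d * om = pgl2_mat (b * pp) a (d * pp) c"
  unfolding om_def by (subst pgl2_mat_mult) simp_all

lemma om_mult_pgl2_mat:
  "a * d - b * c \<noteq> 0 \<Longrightarrow> om * pgl2_mat a b c d = pgl2_mat c d (pp * a) (pp * b)"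
  unfolding om_def by (subst pgl2_mat_mult) simp_all

lemma nrm_mult_pp: "nrm (x * pp) = nrm x / real p"
  by (simp add: nrm_mult nrm_p)

lemma nrm_pp_mult: "nrm (pp * x) = nrm x / real p"
  by (simp add: nrm_mult nrm_p)

lemma real_p_gt_1: "real p > 1"
  using p_gt_1 by simp

lemma of_nat_p_plus_1: "(of_nat p + 1 :: complex) \<noteq> 0"
  by (metis of_nat_1 of_nat_add of_nat_eq_0_iff add_is_0 zero_neq_one)

lemma divide_p_less: "(t :: real) > 0 \<Longrightarrow> t / real p < t"
  using real_p_gt_1 by (simp add: divide_less_eq)

text \<open>Conjugation exchanges the off-diagonal entries up to a factor \<open>p\<close>;
  discreteness of the norm trades the strict bound on one for the weak bound on the other.\<close>

lemma om_Iwahori_om: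
  assumes "i \<in> Iwahori" shows "om * i * om \<in> Iwahori"
proof -
  obtain a b c d where i: "a * d - b * c \<noteq> 0" "i = pgl2_mat a b c d" by (rule pgl2_cases)
  then have n: "nrm a = nrm d" "nrm b \<le> nrm d" "nrm c < nrm d"
    using assms mem_Iwahori_iff by blast+
  have D: "c * (pp * b) - d * (pp * a) = - pp * (a * d - b * c)"
    by (simp add: algebra_simps)
  then have D': "c * (pp * b) - d * (pp * a) \<noteq> 0" using i(1) by simp
  have "om * i * om = pgl2_mat (d * pp) c (pp * b * pp) (pp * a)"
    unfolding i(2) om_mult_pgl2_mat[OF i(1)] by (subst pgl2_mat_mult_om) (use D' in auto)
  also have "\<dots> \<in> Iwahori"
  proof (subst mem_Iwahori_iff)
    have "d * pp * (pp * a) - c * (pp * b * pp) = pp * pp * (a * d - b * c)"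
      by (simp add: algebra_simps)
    then show "d * pp * (pp * a) - c * (pp * b * pp) \<noteq> 0" using i(1) by simp
    have "nrm c \<le> nrm a / real p" using n nrm_less_iff[of c d] by simp
    moreover have "nrm b / real p < nrm a"
    proof -
      have "nrm b / real p \<le> nrm a / real p" using n by (simp add: divide_right_mono)
      also have "\<dots> < nrm a"
        using n zero_le_dist[of c 0] by (intro divide_p_less) linarith
      finally show ?thesis .
    qed
    ultimately show "nrm (d * pp) = nrm (pp * a) \<and> nrm c \<le> nrm (pp * a) \<and> nrm (pp * b * pp) < nrm (pp * a)"
      using n divide_strict_right_mono[of "nrm b / real p" "nrm a" "real p"] real_p_gt_1
      by (simp add: nrm_mult_pp nrm_pp_mult)
  qed
  finally show ?thesis .
qed

section \<open>Representatives of the left cosets of the Iwahori subgroup\<close>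

definition same_coset :: "'k pgl2 \<Rightarrow> 'k pgl2 \<Rightarrow> bool" where
  "same_coset g h \<longleftrightarrow> pinv g * h \<in> Iwahori"

lemma same_coset_sym: "same_coset g h \<Longrightarrow> same_coset h g"
  unfolding same_coset_def using pinv_Iwahori[of "pinv g * h"] by (simp add: pinv_prod)

lemma same_coset_trans: "same_coset g h \<Longrightarrow> same_coset h x \<Longrightarrow> same_coset g x"
  unfolding same_coset_def using Iwahori_mult[of "pinv g * h" "pinv h * x"] by (simp add: mult.assoc)

lemma same_coset_left [simp]: "same_coset (x * g) (x * h) \<longleftrightarrow> same_coset g h"
  by (simp add: same_coset_def pinv_prod mult.assoc)

text \<open>Right multiplication by \<open>om\<close> is well defined on left cosets because
  \<open>om\<close> normalizes the subgroup.\<close>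

lemma same_coset_om: "same_coset (g * om) (h * om) \<longleftrightarrow> same_coset g h"
proof -
  have *: "same_coset (g * om) (h * om)" if "same_coset g h" for g h
    using om_Iwahori_om[of "pinv g * h"] that by (simp add: same_coset_def pinv_prod mult.assoc)
  from *[of g h] *[of "g * om" "h * om"] show ?thesis by (auto simp: mult.assoc)
qed

lemma same_coset_ompow: "same_coset (g * ompow b) (h * ompow b) \<longleftrightarrow> same_coset g h"
  by (simp add: ompow_def same_coset_om)

lemma same_coset_iff_coset: "same_coset g h \<longleftrightarrow> h \<in> (\<lambda>x. g * x) ` Iwahori"
  by (simp add: same_coset_def mem_translate_iff)

text \<open>When the bottom row is dominated by \<open>d\<close>, a lower unipotent from the Iwahori
  subgroup clears \<open>c\<close>, and scaling by \<open>d\<close> leaves an affine matrix.\<close>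

lemma same_coset_upper:
  assumes det: "a * d - b * c \<noteq> 0" and lt: "nrm c < nrm d"
  shows "same_coset (pgl2_mat ((a * d - b * c) / d\<^sup>2) (b / d) 0 1) (pgl2_mat a b c d)"
proof -
  have d: "d \<noteq> 0" using lt by auto
  define u where "u = (a * d - b * c) / d\<^sup>2"
  have u: "u \<noteq> 0" using det d by (simp add: u_def)
  have e: "1 * 1 - (0::'k) * (c / d) \<noteq> 0" by simp
  have "u + b / d * (c / d) = inverse d * a"
    using d by (simp add: u_def field_simps power2_eq_square)
  then have eq: "pgl2_mat a b c d = pgl2_mat u (b / d) 0 1 * pgl2_mat 1 0 (c / d) 1"
    using u d e by (subst pgl2_mat_mult) (auto intro!: pgl2_mat_eqI[OF det, of "inverse d"] simp: field_simps)
  have "pgl2_mat 1 0 (c / d) 1 \<in> Iwahori"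
    using lt d by (subst mem_Iwahori_iff) (auto simp: nrm_divide)
  then show ?thesis
    unfolding same_coset_iff_coset eq u_def[symmetric] by blast
qed

lemma same_coset_tmat_integral:
  assumes "u \<noteq> 0" "nrm u \<le> 1" "nrm v \<le> 1"
  shows "\<exists>n y. y < p ^ n \<and> nrm u = (1 / real p) ^ n \<and> same_coset (tmat n y) (pgl2_mat u v 0 1)"
proof -
  have "real p powi - pval p u \<le> real p powi 0"
    using assms nrm_pval[of u] by simp
  then have "pval p u \<ge> 0" by (simp only: powi_p_le)
  then obtain n where "pval p u = int n" using nonneg_int_cases by blast
  then have n: "nrm u = (1 / real p) ^ n"
    using assms nrm_pval[of u] by (simp add: power_int_minus power_one_over inverse_eq_divide)
  obtain y where y: "y < p ^ n" "nrm (v - of_nat y) \<le> (1 / real p) ^ n"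
    using residue[OF assms(3), of n] by blast
  have "pinv (tmat n y) * pgl2_mat u v 0 1 = pgl2_mat u (v - of_nat y) 0 (pp ^ n)"
    unfolding tmat_def using assms by (simp add: pinv_pgl2_mat pgl2_mat_mult)
  also have "\<dots> \<in> Iwahori"
    using assms y n real_p_gt_1 by (subst mem_Iwahori_iff) (auto simp: nrm_p_power)
  finally show ?thesis using y n same_coset_def by blast
qed

text \<open>Indices \<open>(n, y, a, b)\<close> of the coset representatives; for \<open>n = 0\<close> the case \<open>a = True\<close> would be
  redundant, since \<open>tmat 0 0 = 1\<close>.\<close>

definition coset_rep :: "nat \<times> nat \<times> bool \<times> bool \<Rightarrow> 'k pgl2" where
  "coset_rep = (\<lambda>(n, y, a, b). ompow a * tmat n y * ompow b)"

definition coset_fibre :: "nat \<Rightarrow> (nat \<times> bool \<times> bool) set" where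
  "coset_fibre n = {..<p ^ n} \<times> (if n = 0 then {False} else UNIV) \<times> UNIV"

lemma coset_rep_flip: "coset_rep (n, y, a, b) * om = coset_rep (n, y, a, \<not> b)"
  by (simp add: coset_rep_def ompow_def mult.assoc)

lemma coset_rep_cover_upper:
  assumes "u \<noteq> 0"
  shows "\<exists>j\<in>Sigma UNIV coset_fibre. same_coset (coset_rep j) (pgl2_mat u v 0 1)"
proof (cases "nrm u \<le> 1 \<and> nrm v \<le> 1")
  case True
  then obtain n y where "y < p ^ n" "same_coset (tmat n y) (pgl2_mat u v 0 1)"
    using same_coset_tmat_integral[OF assms] by blast
  then show ?thesis
    by (intro bexI[of _ "(n, y, False, False)"]) (auto simp: coset_rep_def coset_fibre_def ompow_def)
next
  case False
  \<comment> \<open>One \<open>om\<close> on the left, followed by one on the right if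
    \<open>u\<close> dominates \<open>v\<close>, makes the affine matrix integral. The strict bound
    on \<open>u'\<close> forces \<open>n > 0\<close> later, where the index with
    \<open>a = True\<close> is admissible.\<close>
  have "\<exists>u' v' b. u' \<noteq> 0 \<and> nrm u' < 1 \<and> nrm v' \<le> 1 \<and>
    same_coset (pgl2_mat u' v' 0 1) (om * pgl2_mat u v 0 1 * ompow b)"
  proof (cases "nrm u < nrm v")
    case True
    then have v: "nrm v > 1" "v \<noteq> 0" using False by auto
    then have pv: "nrm v / real p \<ge> 1"
      using nrm_less_iff[of 1 v] p_gt_1 by (simp add: field_simps)
    have "om * pgl2_mat u v 0 1 * ompow False = pgl2_mat 0 1 (pp * u) (pp * v)"
      using assms by (simp add: ompow_def om_mult_pgl2_mat)
    moreover have "same_coset (pgl2_mat ((0 * (pp * v) - 1 * (pp * u)) / (pp * v)\<^sup>2) (1 / (pp * v)) 0 1)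
       (pgl2_mat 0 1 (pp * u) (pp * v))"
      using True assms p_gt_1 by (intro same_coset_upper) (auto simp: nrm_pp_mult divide_strict_right_mono)
    moreover have "nrm (1 / (pp * v)) \<le> 1"
      using pv v real_p_gt_1 by (simp add: nrm_divide nrm_pp_mult divide_le_eq)
    moreover have "(0 * (pp * v) - 1 * (pp * u)) / (pp * v)\<^sup>2 = - ((u / v) * (1 / (pp * v)))"
      using v by (simp add: field_simps power2_eq_square)
    moreover have "nrm (- ((u / v) * (1 / (pp * v)))) < 1"
    proof -
      have "nrm (u / v) * nrm (1 / (pp * v)) \<le> nrm (u / v)"
        using \<open>nrm (1 / (pp * v)) \<le> 1\<close> by (intro mult_left_le) auto
      also have "\<dots> < 1" using True v by (simp add: nrm_divide)
      finally show ?thesis by (simp only: nrm_minus nrm_mult)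
    qed
    moreover have "- ((u / v) * (1 / (pp * v))) \<noteq> 0" using assms v by simp
    ultimately show ?thesis by metis
  next
    case vu: False
    then have u: "nrm u > 1" using False by auto
    have "om * pgl2_mat u v 0 1 * ompow True = pgl2_mat pp 0 (pp * v * pp) (pp * u)"
      using assms by (simp add: ompow_def om_mult_pgl2_mat pgl2_mat_mult_om)
    moreover have "nrm (pp * v * pp) < nrm (pp * u)"
    proof -
      have "nrm v / real p \<le> nrm u / real p" using vu p_gt_1 by (simp add: divide_right_mono)
      also have "\<dots> < nrm u" using assms p_gt_1 by (simp add: field_simps)
      finally show ?thesis
        using divide_strict_right_mono[of "nrm v / real p" "nrm u" "real p"] real_p_gt_1
        by (simp add: nrm_mult_pp nrm_pp_mult)
    qed
    then have "same_coset (pgl2_mat ((pp * (pp * u) - 0 * (pp * v * pp)) / (pp * u)\<^sup>2) (0 / (pp * u)) 0 1)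
       (pgl2_mat pp 0 (pp * v * pp) (pp * u))"
      using assms by (intro same_coset_upper) auto
    moreover have "(pp * (pp * u) - 0 * (pp * v * pp)) / (pp * u)\<^sup>2 = 1 / u"
      using assms by (simp add: field_simps power2_eq_square)
    moreover have "nrm (1 / u) < 1" "1 / u \<noteq> 0" using u assms by (simp_all add: nrm_divide)
    ultimately show ?thesis by (metis div_0 dist_self zero_le_one)
  qed
  then obtain u' v' b where u': "u' \<noteq> 0" "nrm u' < 1" "nrm v' \<le> 1"
    and c: "same_coset (pgl2_mat u' v' 0 1) (om * pgl2_mat u v 0 1 * ompow b)"
    by blast
  obtain n y where ny: "y < p ^ n" "nrm u' = (1 / real p) ^ n" "same_coset (tmat n y) (pgl2_mat u' v' 0 1)"
    using same_coset_tmat_integral[of u' v'] u' by auto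
  have "n \<noteq> 0" using ny(2) u'(2) by (intro notI) simp
  have "same_coset (tmat n y) (om * pgl2_mat u v 0 1 * ompow b)"
    using ny(3) c same_coset_trans by blast
  then have "same_coset (om * (tmat n y * ompow b)) (om * (om * pgl2_mat u v 0 1 * ompow b * ompow b))"
    unfolding same_coset_left same_coset_ompow .
  then have "same_coset (coset_rep (n, y, True, b)) (pgl2_mat u v 0 1)"
    by (simp add: coset_rep_def mult.assoc ompow_ompow) (simp add: ompow_def)
  then show ?thesis
    using ny \<open>n \<noteq> 0\<close> by (intro bexI[of _ "(n, y, True, b)"]) (auto simp: coset_fibre_def)
qed

text \<open>If \<open>d\<close> does not dominate the bottom row, right multiplication by
  \<open>om\<close> exchanges the roles of its entries; the representative found is then flipped
  back.\<close>

lemma coset_rep_cover: "\<exists>j\<in>Sigma UNIV coset_fibre. same_coset (coset_rep j) g"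
proof -
  have *: "\<exists>j\<in>Sigma UNIV coset_fibre. same_coset (coset_rep j) (pgl2_mat a b c d)"
    if "a * d - b * c \<noteq> 0" "nrm c < nrm d" for a b c d
    using coset_rep_cover_upper same_coset_upper[OF that] that same_coset_trans
    by (metis divide_eq_0_iff nrm_pos power_eq_0_iff zero_le_dist order.strict_trans1)
  obtain a b c d where g: "a * d - b * c \<noteq> 0" "g = pgl2_mat a b c d" by (rule pgl2_cases)
  show ?thesis
  proof (cases "nrm c < nrm d")
    case False
    have "c \<noteq> 0" using False g by auto
    then have "nrm (d * pp) < nrm c"
      using False divide_p_less[of "nrm d"] by (cases "d = 0") (auto simp: nrm_mult_pp)
    moreover have "b * pp * c - a * (d * pp) = - pp * (a * d - b * c)"
      by (simp add: algebra_simps)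
    then have "b * pp * c - a * (d * pp) \<noteq> 0" using g by simp
    ultimately obtain j where j: "j \<in> Sigma UNIV coset_fibre" "same_coset (coset_rep j) (g * om)"
      using * pgl2_mat_mult_om[OF g(1)] g(2) by metis
    obtain n y s t where jeq: "j = (n, y, s, t)" by (cases j) auto
    have "same_coset (coset_rep j * om) g"
      using j(2) same_coset_om[of "coset_rep j" "g * om"] by (simp add: mult.assoc)
    then show ?thesis
      using j(1) by (intro bexI[of _ "(n, y, s, \<not> t)"]) (auto simp: jeq coset_rep_flip coset_fibre_def)
  qed (use * g in auto)
qed

lemma nrm_one_minus: "nrm x \<le> 1 \<Longrightarrow> nrm (1 - pp * x) = 1"
  using nrm_diff_eq[of "pp * x" 1] real_p_gt_1 by (simp add: nrm_pp_mult)

text \<open>Already \<open>K_max\<close> separates the cosets: the entry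
  \<open>1 - p * y * y'\<close> is a unit, while the determinant has valuation
  \<open>n + n' + 1\<close>. With \<open>om\<close> on the right both the entry and the determinant
  gain a factor \<open>p\<close>, which leaves room only for \<open>om * om = 1\<close>.\<close>

lemma same_coset_tmat_om_tmat:
  assumes "same_coset (tmat n y) (om * tmat n' y' * ompow b)"
  shows "n = 0 \<and> n' = 0"
proof -
  have y1: "nrm (1 - pp * (of_nat y * of_nat y')) = 1"
    using nrm_of_int_le_1[of "int (y * y')"] by (intro nrm_one_minus) simp
  have q: "nrm pp = 1 / real p" "1 / real p < 1" "1 / real p > 0" using p_gt_1 by (simp_all add: nrm_p)
  have 1: "pinv (tmat n y) * (om * tmat n' y') =
     pgl2_mat (- of_nat y * (pp * pp ^ n')) (1 - pp * (of_nat y * of_nat y')) (pp ^ n * (pp * pp ^ n')) (pp ^ n * (pp * of_nat y'))"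
    unfolding tmat_def by (simp add: om_mult_pgl2_mat pinv_pgl2_mat pgl2_mat_mult algebra_simps)
  have D: "- of_nat y * (pp * pp ^ n') * (pp ^ n * (pp * of_nat y')) - (1 - pp * (of_nat y * of_nat y')) * (pp ^ n * (pp * pp ^ n'))
     = - (pp ^ Suc (n + n'))"
    by (simp add: algebra_simps power_add)
  then have D0: "- of_nat y * (pp * pp ^ n') * (pp ^ n * (pp * of_nat y')) - (1 - pp * (of_nat y * of_nat y')) * (pp ^ n * (pp * pp ^ n')) \<noteq> 0"
    by simp
  show ?thesis
  proof (cases b)
    case False
    have "pgl2_mat (- of_nat y * (pp * pp ^ n')) (1 - pp * (of_nat y * of_nat y')) (pp ^ n * (pp * pp ^ n')) (pp ^ n * (pp * of_nat y')) \<in> K_max"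
      using assms Iwahori_subset_K_max False 1 by (auto simp: same_coset_def ompow_def)
    from mem_K_max_D(2)[OF this D0] have "1 \<le> (1 / real p) ^ Suc (n + n')"
      unfolding D y1 by (simp add: nrm_p_power del: power_Suc)
    moreover have "(1 / real p) ^ Suc (n + n') < 1"
      using q by (intro power_Suc_less_one) auto
    ultimately show ?thesis by simp
  next
    case True
    have "pinv (tmat n y) * (om * tmat n' y') * om \<in> K_max"
      using assms Iwahori_subset_K_max True by (auto simp: same_coset_def ompow_def mult.assoc)
    then have K: "pgl2_mat ((1 - pp * (of_nat y * of_nat y')) * pp) (- of_nat y * (pp * pp ^ n')) (pp ^ n * (pp * of_nat y') * pp) (pp ^ n * (pp * pp ^ n')) \<in> K_max"
      unfolding 1 pgl2_mat_mult_om[OF D0] .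
    have D2: "(1 - pp * (of_nat y * of_nat y')) * pp * (pp ^ n * (pp * pp ^ n')) - - of_nat y * (pp * pp ^ n') * (pp ^ n * (pp * of_nat y') * pp)
      = pp ^ (2 + (n + n'))"
      by (simp add: algebra_simps power_add power2_eq_square)
    have "nrm ((1 - pp * (of_nat y * of_nat y')) * pp) ^ 2 \<le> (1 / real p) ^ (2 + (n + n'))"
      using mem_K_max_D(1)[OF K] unfolding D2 nrm_p_power by simp
    then have "(1 / real p) ^ 2 \<le> (1 / real p) ^ (2 + (n + n'))"
      by (simp add: nrm_mult y1 q(1))
    then have "2 + (n + n') \<le> 2"
      using q by (subst (asm) power_decreasing_iff) auto
    then show ?thesis by simp
  qed
qed

lemma coset_rep_inj:
  assumes "j \<in> Sigma UNIV coset_fibre" "j' \<in> Sigma UNIV coset_fibre" "same_coset (coset_rep j) (coset_rep j')"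
  shows "j = j'"
proof -
  obtain n y a b where j: "j = (n, y, a, b)" by (cases j) auto
  obtain n' y' a' b' where j': "j' = (n', y', a', b')" by (cases j') auto
  have y: "y < p ^ n" "y' < p ^ n'" and n0: "n = 0 \<Longrightarrow> \<not> a" "n' = 0 \<Longrightarrow> \<not> a'"
    using assms unfolding j j' by (auto simp: coset_fibre_def split: if_splits)
  \<comment> \<open>Cancelling the outer involutions of the first representative leaves
    \<open>tmat n y\<close> on one side, and the other side records whether the bits differ.\<close>
  have "same_coset (ompow a * (coset_rep j * ompow b)) (ompow a * (coset_rep j' * ompow b))"
    using assms(3) by (simp add: same_coset_ompow)
  moreover have "ompow a * (coset_rep j * ompow b) = tmat n y"
    by (simp add: j coset_rep_def ompow_def mult.assoc)
  moreover have "ompow a * (coset_rep j' * ompow b) = ompow (a \<noteq> a') * tmat n' y' * ompow (b' \<noteq> b)"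
    unfolding j' coset_rep_def ompow_ompow[symmetric] by (simp only: prod.case mult.assoc)
  ultimately have c: "same_coset (tmat n y) (ompow (a \<noteq> a') * tmat n' y' * ompow (b' \<noteq> b))"
    by simp
  have a: "a = a'"
  proof (rule ccontr)
    assume "a \<noteq> a'"
    then have "n = 0 \<and> n' = 0"
      using c same_coset_tmat_om_tmat[of n y n' y' "b' \<noteq> b"] by (simp add: ompow_def)
    then show False using n0 \<open>a \<noteq> a'\<close> by auto
  qed
  have m: "pinv (tmat n y) * tmat n' y' = pgl2_mat (pp ^ n') (of_nat y' - of_nat y) 0 (pp ^ n)"
    by (simp add: tmat_def pinv_pgl2_mat pgl2_mat_mult)
  have b: "b = b'"
  proof (rule ccontr)
    assume "b \<noteq> b'"
    then have "pinv (tmat n y) * tmat n' y' * om \<in> Iwahori"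
      using c a by (simp add: ompow_def same_coset_def mult.assoc)
    then have "pgl2_mat ((of_nat y' - of_nat y) * pp) (pp ^ n') (pp ^ n * pp) 0 \<in> Iwahori"
      unfolding m by (simp add: pgl2_mat_mult_om)
    then show False by (subst (asm) mem_Iwahori_iff) auto
  qed
  have "pgl2_mat (pp ^ n') (of_nat y' - of_nat y) 0 (pp ^ n) \<in> Iwahori"
    using c a b by (simp add: ompow_def same_coset_def m)
  then have e: "nrm (pp ^ n') = nrm (pp ^ n)" "nrm (of_nat y' - of_nat y :: 'k) \<le> nrm (pp ^ n)"
    by (simp_all add: mem_Iwahori_iff)
  have "n = n'"
    using e(1) p_gt_1 by (simp add: nrm_p_power power_one_over)
  then show ?thesis
    using e(2) residue_unique[of y' n y] y a b by (simp add: j j' nrm_p_power)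
qed

subsection \<open>Integration of Iwahori-invariant functions\<close>

text \<open>The cosets correspond to the \<open>p + 1\<close> points of the projective line over the
  residue field, read off from the first column: \<open>Iwahori\<close> is the point at infinity and
  \<open>y\<close> the ratio of the two entries.\<close>

lemma K_max_eq: "K_max = Iwahori \<union> (\<Union>y<p. (\<lambda>x. pgl2_mat (of_nat y) 1 1 0 * x) ` (Iwahori :: 'k pgl2 set))"
proof (intro equalityI subsetI)
  fix g :: "'k pgl2" assume "g \<in> K_max"
  then obtain a b c d where g: "g = pgl2_mat a b c d" "nrm a \<le> 1" "nrm b \<le> 1" "nrm c \<le> 1" "nrm d \<le> 1"
      "nrm (a * d - b * c) = 1"
    unfolding K_max_def by blast
  have nz: "a * d - b * c \<noteq> 0" using g by auto
  show "g \<in> Iwahori \<union> (\<Union>y<p. (\<lambda>x. pgl2_mat (of_nat y) 1 1 0 * x) ` Iwahori)"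
  proof (cases "nrm c < 1")
    case True
    then have "g \<in> Iwahori" unfolding Iwahori_def using g by blast
    then show ?thesis by blast
  next
    case False
    then have c: "nrm c = 1" "c \<noteq> 0" using g by auto
    obtain y where y: "y < p" "nrm (a / c - of_nat y) \<le> 1 / real p"
      using residue[of "a / c" 1] g c by (auto simp: nrm_divide)
    have "nrm (a - of_nat y * c) = nrm (a / c - of_nat y) * nrm c"
      unfolding nrm_mult[symmetric] using c by (simp add: algebra_simps)
    also have "\<dots> < 1" using y c real_p_gt_1 by (simp add: order.strict_trans1)
    finally have lt: "nrm (a - of_nat y * c) < 1" .
    have "pinv (pgl2_mat (of_nat y) 1 1 0) * g = pgl2_mat (- c) (- d) (- (a - of_nat y * c)) (- (b - of_nat y * d))"
      unfolding g(1) using nz by (subst pinv_pgl2_mat) (simp_all add: pgl2_mat_mult)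
    also have "\<dots> \<in> Iwahori"
      unfolding Iwahori_def
    proof (intro CollectI exI conjI)
      have "(- c) * (- (b - of_nat y * d)) - (- d) * (- (a - of_nat y * c)) = - (a * d - b * c)"
        by (simp add: algebra_simps)
      then show "nrm ((- c) * (- (b - of_nat y * d)) - (- d) * (- (a - of_nat y * c))) = 1"
        using g by (simp only: nrm_minus)
      have "nrm (of_nat y * d) \<le> 1"
        using g nrm_of_int_le_1[of "int y"] by (simp add: nrm_mult mult_le_one)
      then show "nrm (- (b - of_nat y * d)) \<le> 1"
        using g ultrametric_diff_le by (simp only: nrm_minus)
    qed (use g lt nrm_diff_commute[of a "of_nat y * c"] in auto)
    finally show ?thesis using y(1) by (auto simp: mem_translate_iff)
  qed
next
  have K: "pgl2_mat (of_nat y) 1 1 0 * x \<in> K_max" if "x \<in> Iwahori" for x :: "'k pgl2" and y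
    using nrm_of_int_le_1[of "int y"] that Iwahori_subset_K_max
    by (intro K_max_mult mem_K_max_I) auto
  fix g :: "'k pgl2" assume "g \<in> Iwahori \<union> (\<Union>y<p. (\<lambda>x. pgl2_mat (of_nat y) 1 1 0 * x) ` Iwahori)"
  then consider "g \<in> Iwahori" | y x where "x \<in> Iwahori" "g = pgl2_mat (of_nat y) 1 1 0 * x"
    by auto
  then show "g \<in> K_max"
  proof cases
    case 1
    then show ?thesis using Iwahori_subset_K_max by (rule subsetD[rotated])
  next
    case 2
    then show ?thesis using K by simp
  qed
qed

lemma emeasure_translate_Iwahori:
  assumes "haar_pgl2 \<mu>"
  shows "emeasure \<mu> ((\<lambda>x. g * x) ` Iwahori) = emeasure \<mu> (Iwahori :: 'k pgl2 set)"
  using assms borel_open[OF open_Iwahori] unfolding haar_pgl2_def by simp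

lemma emeasure_Iwahori:
  assumes "haar_pgl2 \<mu>"
  shows "emeasure \<mu> (Iwahori :: 'k pgl2 set) = ennreal (1 / (real p + 1))"
proof -
  define A where "A y = (\<lambda>x. pgl2_mat (of_nat y) 1 1 0 * x) ` (Iwahori :: 'k pgl2 set)" for y
  have sets: "sets \<mu> = sets borel" using assms by (simp add: haar_pgl2_def)
  have m: "Iwahori \<in> sets \<mu>" "A y \<in> sets \<mu>" for y
    unfolding sets A_def using open_Iwahori open_left_translate_Iwahori by auto
  have disj: "disjoint_family_on A {..<p}"
    unfolding disjoint_family_on_def
  proof (intro ballI impI, rule ccontr)
    fix y y' assume y: "y \<in> {..<p}" "y' \<in> {..<p}" "y \<noteq> y'" "A y \<inter> A y' \<noteq> {}"
    then have "same_coset (pgl2_mat (of_nat y) 1 1 0) (pgl2_mat (of_nat y') 1 1 0)"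
      unfolding A_def using same_coset_iff_coset same_coset_trans same_coset_sym by blast
    then have "pgl2_mat (- 1) 0 (of_nat y - of_nat y') (- 1) \<in> (Iwahori :: 'k pgl2 set)"
      by (simp add: same_coset_def pinv_pgl2_mat pgl2_mat_mult)
    then have "nrm (of_nat y - of_nat y' :: 'k) < nrm (1 :: 'k)"
      by (subst (asm) mem_Iwahori_iff) auto
    then have "nrm (of_nat y - of_nat y' :: 'k) \<le> (1 / real p) ^ 1"
      unfolding nrm_less_iff by simp
    then show False using residue_unique[of y 1 y'] y by simp
  qed
  have disj2: "Iwahori \<inter> (\<Union>y<p. A y) = {}"
  proof (rule ccontr)
    assume "Iwahori \<inter> (\<Union>y<p. A y) \<noteq> {}"
    then obtain y g where "g \<in> Iwahori" "g \<in> A y" by blast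
    then have "same_coset (pgl2_mat (of_nat y) 1 1 0) 1"
      unfolding A_def using same_coset_iff_coset[of _ g] same_coset_iff_coset[of 1 g] same_coset_trans same_coset_sym by (metis image_eqI mult_1)
    then have "pgl2_mat (of_nat y) 1 1 0 \<in> (Iwahori :: 'k pgl2 set)"
      using same_coset_sym unfolding same_coset_def by (metis mult_1 mult_pinv)
    then show False by (subst (asm) mem_Iwahori_iff) auto
  qed
  have "1 = emeasure \<mu> (K_max :: 'k pgl2 set)"
    using assms by (simp add: haar_pgl2_def)
  also have "\<dots> = emeasure \<mu> (Iwahori \<union> (\<Union>y<p. A y))"
    unfolding K_max_eq A_def ..
  also have "\<dots> = emeasure \<mu> Iwahori + emeasure \<mu> (\<Union>y<p. A y)"
    using m disj2 by (intro plus_emeasure[symmetric]) auto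
  also have "emeasure \<mu> (\<Union>y<p. A y) = (\<Sum>y<p. emeasure \<mu> (A y))"
    using m disj by (intro sum_emeasure[symmetric]) auto
  also have "\<dots> = of_nat p * emeasure \<mu> Iwahori"
    by (simp add: A_def emeasure_translate_Iwahori[OF assms])
  finally have eq: "1 = emeasure \<mu> Iwahori + of_nat p * emeasure \<mu> (Iwahori :: 'k pgl2 set)" .
  then have "emeasure \<mu> (Iwahori :: 'k pgl2 set) \<noteq> top"
    by (intro notI) (simp add: top_unique)
  then obtain r where r: "r \<ge> 0" "emeasure \<mu> (Iwahori :: 'k pgl2 set) = ennreal r"
    by (metis ennreal_cases)
  have "ennreal 1 = ennreal (r + real p * r)"
    using eq r by (simp add: ennreal_of_nat_eq_real_of_nat flip: ennreal_mult' ennreal_plus)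
  then have "1 = r + real p * r"
    using r by (subst (asm) ennreal_inj) auto
  then have "r = 1 / (real p + 1)"
    by (simp add: field_simps)
  then show ?thesis using r by simp
qed

text \<open>Pushing the Haar measure forward along this map turns the integral into a sum over
  indices.\<close>

definition coset_index :: "'k pgl2 \<Rightarrow> nat \<times> nat \<times> bool \<times> bool" where
  "coset_index g = (THE j. j \<in> Sigma UNIV coset_fibre \<and> same_coset (coset_rep j) g)"

lemma coset_index: "coset_index g \<in> Sigma UNIV coset_fibre" "same_coset (coset_rep (coset_index g)) g"
proof -
  have "\<exists>!j. j \<in> Sigma UNIV coset_fibre \<and> same_coset (coset_rep j) g"
  proof (rule ex_ex1I)
    show "\<exists>j. j \<in> Sigma UNIV coset_fibre \<and> same_coset (coset_rep j) g" using coset_rep_cover by blast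
    show "j = j'" if "j \<in> Sigma UNIV coset_fibre \<and> same_coset (coset_rep j) g" "j' \<in> Sigma UNIV coset_fibre \<and> same_coset (coset_rep j') g" for j j'
      using that coset_rep_inj[of j j'] same_coset_trans[OF _ same_coset_sym, of "coset_rep j" g "coset_rep j'"] by simp
  qed
  from theI'[OF this] show "coset_index g \<in> Sigma UNIV coset_fibre" "same_coset (coset_rep (coset_index g)) g"
    unfolding coset_index_def by blast+
qed

lemma coset_index_eq_iff:
  assumes "j \<in> Sigma UNIV coset_fibre"
  shows "coset_index g = j \<longleftrightarrow> g \<in> (\<lambda>x. coset_rep j * x) ` Iwahori"
proof
  assume "coset_index g = j"
  then show "g \<in> (\<lambda>x. coset_rep j * x) ` Iwahori"
    using coset_index(2)[of g] by (simp add: same_coset_iff_coset)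
next
  assume "g \<in> (\<lambda>x. coset_rep j * x) ` Iwahori"
  then have "same_coset (coset_rep j) (coset_rep (coset_index g))"
    by (intro same_coset_trans[OF _ same_coset_sym[OF coset_index(2)]]) (simp add: same_coset_iff_coset)
  from coset_rep_inj[OF assms coset_index(1) this] show "coset_index g = j" by (rule sym)
qed

lemma sum_bool_pairs:
  "(\<Sum>(a, b)\<in>UNIV. g a b) = g False False + g False True + g True False + g True True"
  for g :: "bool \<Rightarrow> bool \<Rightarrow> real"
proof -
  have "(\<Sum>(a, b)\<in>UNIV. g a b) = (\<Sum>a\<in>UNIV. \<Sum>b\<in>UNIV. g a b)"
    by (simp only: sum.cartesian_product UNIV_Times_UNIV)
  then show ?thesis by (simp add: UNIV_bool)
qed

text \<open>The values may not depend on \<open>y\<close>, so every triple \<open>(n, a, b)\<close>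
  counts \<open>p ^ n\<close> times. The case \<open>n = 0\<close> mirrors
  \<open>coset_fibre\<close>, and \<open>p + 1\<close> is the inverse volume of the Iwahori
  subgroup.\<close>

lemma integral_Iwahori_cosets:
  fixes f :: "'k pgl2 \<Rightarrow> complex"
  assumes haar: "haar_pgl2 \<mu>"
    and inv: "\<And>g i. i \<in> Iwahori \<Longrightarrow> f (g * i) = f g"
    and val: "\<And>n y a b. y < p ^ n \<Longrightarrow> f (ompow a * tmat n y * ompow b) = val n a b"
    and summ: "\<And>a b. summable (\<lambda>n. real p ^ n * norm (val n a b))"
  shows "integral\<^sup>L \<mu> f = (\<Sum>n. of_nat (p ^ n) * (val n False False + val n False True +
      (if n = 0 then 0 else val n True False + val n True True))) / (of_nat p + 1)"
proof -
  let ?J = "Sigma UNIV coset_fibre"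
  define F where "F = (\<lambda>(n :: nat, y :: nat, a, b). val n a b)"
  define c where "c = 1 / (real p + 1)"
  have fin: "finite (coset_fibre n)" for n by (auto simp: coset_fibre_def)
  have count: "countable ?J" by simp
  have sets: "sets \<mu> = sets borel" using haar by (simp add: haar_pgl2_def)
  then have space: "space \<mu> = UNIV" using sets_eq_imp_space_eq[of \<mu> borel] by simp
  have fF: "f g = F (coset_index g)" for g
  proof -
    obtain n y a b where j: "coset_index g = (n, y, a, b)" using prod_cases4 by blast
    have y: "y < p ^ n" using coset_index(1)[of g] unfolding j by (auto simp: coset_fibre_def)
    obtain i where i: "i \<in> Iwahori" "g = coset_rep (coset_index g) * i"
      using coset_index(2)[of g] unfolding same_coset_iff_coset by blast
    have "f g = f (coset_rep (coset_index g))" using inv[OF i(1), of "coset_rep (coset_index g)"] i(2) by simp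
    then show ?thesis using val[OF y, of a b] by (simp add: j F_def coset_rep_def)
  qed
  have pre: "coset_index -` {j} \<inter> space \<mu> = (\<lambda>x. coset_rep j * x) ` Iwahori" if "j \<in> ?J" for j
    using coset_index_eq_iff[OF that] space by auto
  have meas: "coset_index \<in> measurable \<mu> (count_space ?J)"
    unfolding measurable_count_space_eq_countable[OF count]
    using coset_index(1) pre open_left_translate_Iwahori by (auto simp: sets)
  \<comment> \<open>All fibres are translates of \<open>Iwahori\<close>, hence the image measure is
    a constant multiple of counting measure.\<close>
  have "distr \<mu> (count_space ?J) coset_index = density (count_space ?J) (\<lambda>_. ennreal c)"
  proof (rule measure_eqI_countable)
    fix j assume j: "j \<in> ?J"
    have "emeasure (distr \<mu> (count_space ?J) coset_index) {j} = emeasure \<mu> (coset_index -` {j} \<inter> space \<mu>)"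
      using meas j by (intro emeasure_distr) auto
    also have "\<dots> = ennreal c"
      unfolding pre[OF j] c_def using emeasure_translate_Iwahori[OF haar] emeasure_Iwahori[OF haar] by simp
    also have "\<dots> = emeasure (density (count_space ?J) (\<lambda>_. ennreal c)) {j}"
      using j by (simp add: emeasure_density nn_integral_count_space_indicator)
    finally show "emeasure (distr \<mu> (count_space ?J) coset_index) {j} = emeasure (density (count_space ?J) (\<lambda>_. ennreal c)) {j}" .
  qed (use count in auto)
  then have "integral\<^sup>L \<mu> f = integral\<^sup>L (density (count_space ?J) (\<lambda>_. ennreal c)) F"
    using integral_distr[OF meas, of F] fF by (metis (no_types, lifting) Bochner_Integration.integral_cong borel_measurable_count_space)
  also have "\<dots> = integral\<^sup>L (count_space ?J) (\<lambda>j. c *\<^sub>R F j)"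
    by (rule integral_density) (auto simp: c_def)
  also have "\<dots> = c *\<^sub>R infsetsum F ?J"
    by (simp add: infsetsum_def)
  also have "infsetsum F ?J = (\<Sum>\<^sub>an. \<Sum>\<^sub>ax\<in>coset_fibre n. F (n, x))"
  proof (rule infsetsum_Sigma)
    show "Infinite_Set_Sum.abs_summable_on F ?J"
    proof (subst Infinite_Set_Sum.abs_summable_on_Sigma_iff, safe)
      have "summable (\<lambda>n. \<Sum>x\<in>coset_fibre n. norm (F (n, x)))"
      proof (rule summable_comparison_test')
        show "summable (\<lambda>n. \<Sum>(a,b)\<in>UNIV. real p ^ n * norm (val n a b))"
          using summ by (intro summable_sum) auto
        fix n :: nat
        \<comment> \<open>Enlarging the fibre to all four pairs of bits gives a bound of the same
          shape for \<open>n = 0\<close>.\<close>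
        have "(\<Sum>x\<in>coset_fibre n. norm (F (n, x))) \<le> (\<Sum>x\<in>{..<p ^ n} \<times> UNIV \<times> UNIV. norm (F (n, x)))"
          by (rule sum_mono2) (auto simp: coset_fibre_def split: if_splits)
        also have "\<dots> = (\<Sum>y\<in>{..<p ^ n}. \<Sum>ab\<in>UNIV \<times> UNIV. norm (F (n, y, ab)))"
          by (simp add: sum.cartesian_product)
        also have "\<dots> = (\<Sum>(a,b)\<in>UNIV. real p ^ n * norm (val n a b))"
          by (simp add: F_def case_prod_unfold sum_distrib_left)
        finally show "norm (\<Sum>x\<in>coset_fibre n. norm (F (n, x))) \<le> (\<Sum>(a,b)\<in>UNIV. real p ^ n * norm (val n a b))"
          by (simp add: sum_nonneg)
      qed
      then show "Infinite_Set_Sum.abs_summable_on (\<lambda>n. infsetsum (\<lambda>x. norm (F (n, x))) (coset_fibre n)) UNIV"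
        using fin by (simp add: abs_summable_on_nat_iff' sum_nonneg)
    qed (use fin in auto)
  qed (use fin in \<open>auto intro: countable_finite\<close>)
  also have "\<dots> = (\<Sum>\<^sub>an. of_nat (p ^ n) * (val n False False + val n False True +
      (if n = 0 then 0 else val n True False + val n True True)))"
  proof (rule infsetsum_cong)
    fix n :: nat
    have "(\<Sum>\<^sub>ax\<in>coset_fibre n. F (n, x)) = (\<Sum>y<p ^ n. \<Sum>a\<in>(if n = 0 then {False} else UNIV). \<Sum>b\<in>UNIV. val n a b)"
    proof -
      have "(\<Sum>\<^sub>ax\<in>coset_fibre n. F (n, x)) = (\<Sum>(y, a, b)\<in>coset_fibre n. val n a b)"
        using fin by (simp add: F_def)
      also have "\<dots> = (\<Sum>y<p ^ n. \<Sum>a\<in>(if n = 0 then {False} else UNIV). \<Sum>b\<in>UNIV. val n a b)"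
        by (simp only: coset_fibre_def sum.cartesian_product)
      finally show ?thesis .
    qed
    also have "\<dots> = of_nat (p ^ n) * (val n False False + val n False True +
      (if n = 0 then 0 else val n True False + val n True True))"
      by (simp add: UNIV_bool algebra_simps)
    finally show "(\<Sum>\<^sub>ax\<in>coset_fibre n. F (n, x)) = of_nat (p ^ n) * (val n False False + val n False True +
      (if n = 0 then 0 else val n True False + val n True True))" .
  qed simp
  also have "\<dots> = (\<Sum>n. of_nat (p ^ n) * (val n False False + val n False True +
      (if n = 0 then 0 else val n True False + val n True True)))"
  proof (rule infsetsum_nat')
    show "Infinite_Set_Sum.abs_summable_on (\<lambda>n. of_nat (p ^ n) * (val n False False + val n False True +
      (if n = 0 then 0 else val n True False + val n True True))) UNIV"
      unfolding abs_summable_on_nat_iff'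
    proof (rule summable_comparison_test')
      show "summable (\<lambda>n. \<Sum>(a,b)\<in>UNIV. real p ^ n * norm (val n a b))"
        using summ by (intro summable_sum) auto
      fix n :: nat
      define w where "w = val n False False + val n False True + (if n = 0 then 0 else val n True False + val n True True)"
      have e: "(\<Sum>(a,b)\<in>UNIV. real p ^ n * norm (val n a b)) =
          real p ^ n * (norm (val n False False) + norm (val n False True) + norm (val n True False) + norm (val n True True))"
        by (subst sum_bool_pairs) (simp only: distrib_left)
      have "norm w \<le> norm (val n False False) + norm (val n False True) + norm (val n True False) + norm (val n True True)"
      proof (cases "n = 0")
        case True
        then have "norm w \<le> norm (val n False False) + norm (val n False True)"
          unfolding w_def by (simp only: if_True add_0_right norm_triangle_ineq simp_thms)
        then show ?thesis
          using norm_ge_zero[of "val n True False"] norm_ge_zero[of "val n True True"] by linarith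
      next
        case False
        then have "w = val n False False + val n False True + val n True False + val n True True"
          by (simp add: w_def)
        then show ?thesis
          by (metis (no_types) norm_triangle_le norm_triangle_mono norm_triangle_ineq order_refl)
      qed
      from mult_left_mono[OF this, of "real p ^ n"]
      have "norm (norm (of_nat (p ^ n) * w)) \<le> (\<Sum>(a,b)\<in>UNIV. real p ^ n * norm (val n a b))"
        unfolding e by (simp add: norm_mult norm_power)
      then show "norm (norm (of_nat (p ^ n) * (val n False False + val n False True +
        (if n = 0 then 0 else val n True False + val n True True)))) \<le> (\<Sum>(a,b)\<in>UNIV. real p ^ n * norm (val n a b))"
        unfolding w_def .
    qed
  qed
  finally show ?thesis by (simp add: c_def scaleR_conv_of_real)
qed

end

section \<open>Invariant Hermitian forms\<close>

lemma sum_fun_apply: "(\<Sum>i\<in>A. f i) x = (\<Sum>i\<in>A. f i x)"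
  by (induction A rule: infinite_finite_induct) simp_all

lemma linearD:
  assumes "Vector_Spaces.linear s t f"
  shows "f (x + y) = f x + f y" "f (s c x) = t c (f x)" "f 0 = 0" "f (\<Sum>i\<in>A. g i) = (\<Sum>i\<in>A. f (g i))"
    "f (x - y) = f x - f y"
proof -
  interpret Vector_Spaces.linear s t f by fact
  show "f (x + y) = f x + f y" "f (s c x) = t c (f x)" "f 0 = 0" "f (\<Sum>i\<in>A. g i) = (\<Sum>i\<in>A. f (g i))"
    "f (x - y) = f x - f y"
    by (rule add scale zero sum diff)+
qed

lemma invariant_hermitianD:
  assumes "invariant_hermitian smul \<rho> h"
  shows "h (u + v) w = h u w + h v w" "h (smul c u) w = c * h u w" "h v u = cnj (h u v)"
    "h (\<rho> g u) (\<rho> g v) = h u v"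
  using assms unfolding invariant_hermitian_def by blast+

lemma hermitian_add_right:
  assumes "invariant_hermitian smul \<rho> h"
  shows "h w (u + v) = h w u + h w v"
  using invariant_hermitianD[OF assms] by (metis complex_cnj_add)

lemma hermitian_smul_right:
  assumes "invariant_hermitian smul \<rho> h"
  shows "h w (smul c u) = cnj c * h w u"
  using invariant_hermitianD[OF assms] by (metis complex_cnj_mult)

lemma hermitian_zero_left:
  assumes "invariant_hermitian smul \<rho> h"
  shows "h 0 w = 0"
  using invariant_hermitianD(1)[OF assms, of 0 0 w] by simp

lemma hermitian_sum_left:
  assumes "invariant_hermitian smul \<rho> h"
  shows "h (\<Sum>i\<in>A. f i) w = (\<Sum>i\<in>A. h (f i) w)"
  by (induction A rule: infinite_finite_induct)
    (simp_all add: hermitian_zero_left[OF assms] invariant_hermitianD(1)[OF assms])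

lemma hermitian_diag_real:
  assumes "invariant_hermitian smul \<rho> h"
  shows "h v v = of_real (Re (h v v))"
proof -
  have "h v v = cnj (h v v)" using assms by (rule invariant_hermitianD(3))
  then show ?thesis by (simp add: complex_eq_iff)
qed

section \<open>Irreducible representations with an invariant form\<close>

context
  fixes smul :: "complex \<Rightarrow> 'v::ab_group_add \<Rightarrow> 'v" and \<rho> :: "'a::field pgl2 \<Rightarrow> 'v \<Rightarrow> 'v"
  assumes irr: "irreducible_rep smul \<rho>"
begin

interpretation complex_rep smul \<rho>
  using irr unfolding irreducible_rep_def by blast

lemma rep_smul: "\<rho> g (smul c u) = smul c (\<rho> g u)"
  using rep_linear by (rule linearD)

lemma irreducible_invariant_subspace:
  assumes "0 \<in> W" "\<And>u v. u \<in> W \<Longrightarrow> v \<in> W \<Longrightarrow> u + v \<in> W" "\<And>c u. u \<in> W \<Longrightarrow> smul c u \<in> W"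
    "\<And>g u. u \<in> W \<Longrightarrow> \<rho> g u \<in> W" "v \<in> W" "v \<noteq> 0"
  shows "w \<in> W"
proof -
  have "subspace W" using assms(1-3) by (rule subspaceI)
  then have "W = {0} \<or> W = UNIV"
    using irr assms(4) unfolding irreducible_rep_def by blast
  then show ?thesis using assms(5,6) by blast
qed

text \<open>If \<open>h v v\<close> vanished, then \<open>h\<close> would vanish on the translates of \<open>v\<close>, which span.\<close>

lemma hermitian_cyclic_nonzero:
  assumes h: "invariant_hermitian smul \<rho> h" and ne: "\<exists>u w. h u w \<noteq> 0" and v: "v \<noteq> 0"
    and coeff: "\<And>g. \<exists>c. h (\<rho> g v) v = c * h v v"
  shows "h v v \<noteq> 0"
proof
  assume 0: "h v v = 0"
  note D = invariant_hermitianD[OF h]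
  have inv: "h (\<rho> g u) w = h u (\<rho> (pinv g) w)" for g u w
    using D(4)[of g u "\<rho> (pinv g) w"] by (simp add: rep_one flip: rep_mult)
  have gv: "h (\<rho> g v) v = 0" for g using coeff[of g] 0 by auto
  have "w \<in> {w. \<forall>g. h w (\<rho> g v) = 0}" for w
  proof (rule irreducible_invariant_subspace[OF _ _ _ _ _ v])
    show "v \<in> {w. \<forall>g. h w (\<rho> g v) = 0}"
    proof (intro CollectI allI)
      show "h v (\<rho> g v) = 0" for g by (subst D(3)) (simp add: gv)
    qed
    show "\<rho> g u \<in> {w. \<forall>g. h w (\<rho> g v) = 0}" if "u \<in> {w. \<forall>g. h w (\<rho> g v) = 0}" for g u
      using that by (simp add: inv flip: rep_mult)
  qed (auto simp: D(1,2) hermitian_zero_left[OF h])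
  then have wv: "h w v = 0" for w
  proof -
    from \<open>\<And>w. w \<in> {w. \<forall>g. h w (\<rho> g v) = 0}\<close>[of w] have "h w (\<rho> 1 v) = 0" by blast
    then show ?thesis by (simp only: rep_one)
  qed
  \<comment> \<open>Now \<open>v\<close> lies in the radical of \<open>h\<close>, an invariant
    subspace, so the radical is everything.\<close>
  have "u \<in> {u. \<forall>w. h u w = 0}" for u
  proof (rule irreducible_invariant_subspace[OF _ _ _ _ _ v])
    show "v \<in> {u. \<forall>w. h u w = 0}"
    proof (intro CollectI allI)
      show "h v w = 0" for w by (subst D(3)) (simp add: wv)
    qed
  qed (auto simp: D(1,2) inv hermitian_zero_left[OF h])
  then show False using ne by blast
qed

text \<open>Cauchy-Schwarz for two vectors of equal length: the square norm of
  \<open>\<rho> g v - z v\<close> is expanded for \<open>z\<close> of absolute value 1. Choosing for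
  \<open>z\<close> the phase of the coefficient gives the bound; in the extremal case the square
  norm is zero.\<close>

lemma
  assumes h: "invariant_hermitian smul \<rho> h" and pos: "\<And>v. v \<noteq> 0 \<Longrightarrow> Re (h v v) > 0"
  shows unitary_coeff_bound: "norm (h (\<rho> g v) v) \<le> Re (h v v)"
    and unitary_coeff_extremal: "z * cnj z = 1 \<Longrightarrow> h (\<rho> g v) v = z * h v v \<Longrightarrow> \<rho> g v = smul z v"
proof -
  note D = invariant_hermitianD[OF h] and R = hermitian_add_right[OF h] hermitian_smul_right[OF h]
  define u where "u = \<rho> g v"
  have uu: "h u u = h v v" unfolding u_def by (rule D(4))
  have nonneg: "Re (h w w) \<ge> 0" for w
    using pos[of w] hermitian_zero_left[OF h, of 0] by (cases "w = 0") auto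
  have expand: "h (u + smul (- z) v) (u + smul (- z) v) = h v v + h v v - (cnj z * h u v + cnj (cnj z * h u v))"
    if "z * cnj z = 1" for z
  proof -
    have "h (u + smul (- z) v) (u + smul (- z) v) =
      h u u - cnj z * h u v - z * h v u + (z * cnj z) * h v v"
      unfolding D(1,2) R by (simp add: algebra_simps)
    also have "h v u = cnj (h u v)" by (rule D(3))
    finally show ?thesis using that uu by simp
  qed
  show "norm (h (\<rho> g v) v) \<le> Re (h v v)"
  proof (cases "h u v = 0")
    case False
    define z where "z = h u v / of_real (norm (h u v))"
    have zz: "z * cnj z = 1"
      using False by (simp add: z_def complex_norm_square power2_eq_square flip: complex_norm_square)
    have "cnj z * h u v = of_real (norm (h u v))"
      using False complex_norm_square[of "h u v"]
      by (simp add: z_def power2_eq_square field_simps)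
    then have "0 \<le> 2 * Re (h v v) - 2 * norm (h u v)"
      using nonneg[of "u + smul (- z) v"] unfolding expand[OF zz] by simp
    then show ?thesis by (simp add: u_def)
  qed (use nonneg in \<open>simp add: u_def\<close>)
  assume zz: "z * cnj z = 1" and eq: "h (\<rho> g v) v = z * h v v"
  have "cnj z * h u v = h v v"
    using zz eq by (simp add: u_def mult.assoc[symmetric] mult.commute)
  moreover have "cnj (h v v) = h v v" by (metis D(3))
  ultimately have "h (u + smul (- z) v) (u + smul (- z) v) = 0"
    unfolding expand[OF zz] by simp
  then have "u + smul (- z) v = 0" using pos[of "u + smul (- z) v"] by fastforce
  then show "\<rho> g v = smul z v" by (simp add: u_def add_eq_0_iff scale_minus_left)
qed

end

section \<open>The spherical vector\<close>

context padic begin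

text \<open>Multiplying by \<open>tmat n y\<close> replaces the bottom row by
  \<open>(c * p ^ n, c * y + d)\<close>. When \<open>c\<close> dominates, exactly one
  \<open>y\<close> makes the second entry no larger than the first; this is the exceptional term in
  the sums over \<open>y\<close> below.\<close>

lemma residue_linear:
  assumes "c \<noteq> 0" "nrm d \<le> nrm c"
  shows "\<exists>!y. y < p ^ n \<and> nrm (c * of_nat y + d :: 'k) \<le> nrm c * (1 / real p) ^ n"
proof -
  have "nrm (- (d / c)) \<le> 1" using assms by (simp add: nrm_divide)
  from residue[OF this, of n] have *: "\<exists>!y. y < p ^ n \<and> nrm (- (d / c) - of_nat y) \<le> (1 / real p) ^ n" .
  have "nrm (c * of_nat y + d) = nrm c * nrm (- (d / c) - of_nat y)" for y
  proof -
    have "c * of_nat y + d = - (c * (- (d / c) - of_nat y))"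
      using assms by (simp add: field_simps)
    then show ?thesis by (simp only: nrm_minus nrm_mult)
  qed
  then have "nrm (c * of_nat y + d) \<le> nrm c * (1 / real p) ^ n \<longleftrightarrow> nrm (- (d / c) - of_nat y) \<le> (1 / real p) ^ n" for y
    using assms by simp
  then show ?thesis using * by simp
qed

abbreviation swap :: "'k pgl2" where "swap \<equiv> pgl2_mat 0 1 1 0"

lemma swap_in_K_max: "swap \<in> K_max"
  by (rule mem_K_max_I) auto

lemma unipotent_in_Iwahori: "nrm x \<le> 1 \<Longrightarrow> pgl2_mat 1 x 0 1 \<in> (Iwahori :: 'k pgl2 set)"
  by (subst mem_Iwahori_iff) auto

lemma tmat_0_0: "tmat 0 0 = 1"
  by (simp add: tmat_def one_pgl2_eq)

lemma tmat_eq: "tmat n y = pgl2_mat 1 (of_nat y) 0 1 * tmat n 0"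
  unfolding tmat_def by (subst pgl2_mat_mult) simp_all

lemma tmat_mult_tmat1: "tmat n 0 * tmat 1 y = pgl2_mat 1 (pp ^ n * of_nat y) 0 1 * tmat (Suc n) 0"
  unfolding tmat_def by (simp add: pgl2_mat_mult mult.commute)

lemma tmat_Suc_mult_diag: "tmat (Suc n) 0 * pgl2_mat 1 0 0 pp = tmat n 0"
proof -
  have "tmat (Suc n) 0 * pgl2_mat 1 0 0 pp = pgl2_mat (pp * pp ^ n) 0 0 pp"
    unfolding tmat_def by (simp add: pgl2_mat_mult)
  also have "\<dots> = tmat n 0"
    unfolding tmat_def by (rule sym, rule pgl2_mat_eqI[of _ _ _ _ pp]) simp_all
  finally show ?thesis .
qed

lemma diag_eq_swap_tmat: "pgl2_mat 1 0 0 pp = swap * tmat 1 0 * swap"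
  unfolding tmat_def by (simp add: pgl2_mat_mult)

lemma om_eq_swap_tmat: "om = swap * tmat 1 0"
  unfolding tmat_def om_def by (simp add: pgl2_mat_mult)

lemma om_eq_diag_swap: "om = pgl2_mat 1 0 0 pp * swap"
  unfolding om_def by (simp add: pgl2_mat_mult)

lemma om_tmat: "om * tmat n 0 = swap * tmat (Suc n) 0"
  using tmat_mult_tmat1[of 1 0] unfolding om_eq_swap_tmat mult.assoc
  by (simp add: tmat_def pgl2_mat_mult)

lemma sqrt_powi: "(x :: real) \<ge> 0 \<Longrightarrow> sqrt (x powi m) = sqrt x powi m"
  by (rule real_sqrt_unique) (simp_all add: zero_le_power_int power2_eq_square flip: power_int_mult_distrib)

text \<open>The function \<open>hecke_seq \<lambda>\<close> gives the values at \<open>diag(p\<^sup>n, 1)\<close> of the spherical function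
  with Hecke eigenvalue \<open>\<lambda>\<close>.\<close>

fun hecke_seq :: "complex \<Rightarrow> nat \<Rightarrow> complex" where
  "hecke_seq l 0 = 1"
| "hecke_seq l (Suc 0) = l / (of_nat p + 1)"
| "hecke_seq l (Suc (Suc n)) = (l * hecke_seq l (Suc n) - hecke_seq l n) / of_nat p"

end

section \<open>The spherical vector in the induced model and its Hecke eigenvalue\<close>

locale spherical = padic p K for p and K :: "'k::{field_char_0,complete_space} itself" +
  fixes \<alpha> \<beta> :: complex and smul :: "complex \<Rightarrow> 'v::ab_group_add \<Rightarrow> 'v"
    and \<rho> :: "'k pgl2 \<Rightarrow> 'v \<Rightarrow> 'v" and v :: 'v
  assumes ups: "unramified_principal_series p \<alpha> \<beta> smul \<rho>"
    and v_nonzero: "v \<noteq> 0" and K_fixed: "\<forall>u\<in>K_max. \<rho> u v = v"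
begin

lemma irr: "irreducible_rep smul \<rho>" and \<alpha>\<beta>: "\<alpha> * \<beta> = 1"
  using ups unfolding unramified_principal_series_def by blast+

sublocale complex_rep smul \<rho>
  using irr unfolding irreducible_rep_def by blast

definition T :: "'v \<Rightarrow> 'k pgl2 \<Rightarrow> complex" where
  "T = (SOME T. Vector_Spaces.linear smul fun_smul T \<and> inj T \<and> range T = induced_space p \<alpha> \<beta> \<and>
          (\<forall>g v. T (\<rho> g v) = (\<lambda>x. T v (x * g))))"

lemma T: "Vector_Spaces.linear smul fun_smul T" "inj T" "range T = induced_space p \<alpha> \<beta>"
    "T (\<rho> g w) = (\<lambda>x. T w (x * g))"
proof -
  have "\<exists>T. Vector_Spaces.linear smul fun_smul T \<and> inj T \<and> range T = induced_space p \<alpha> \<beta> \<and>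
          (\<forall>g v. T (\<rho> g v) = (\<lambda>x. T v (x * g)))"
    using ups unfolding unramified_principal_series_def by blast
  from someI_ex[OF this] show "Vector_Spaces.linear smul fun_smul T" "inj T" "range T = induced_space p \<alpha> \<beta>"
    "T (\<rho> g w) = (\<lambda>x. T w (x * g))"
    unfolding T_def by blast+
qed

text \<open>The Satake parameter combined with the square root of the modulus: the factor by which
  diag(p, 1) acts from the left on \<open>T v\<close>.\<close>

definition \<kappa> :: complex where "\<kappa> = \<alpha> / of_real (sqrt p)"

text \<open>Since \<alpha> \<beta> = 1, this is sqrt p times \<alpha> + \<beta>.\<close>

definition lam :: complex where "lam = of_nat p * \<kappa> + inverse \<kappa>"

lemma \<alpha>_nonzero: "\<alpha> \<noteq> 0" using \<alpha>\<beta> by auto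

lemma \<kappa>_nonzero [simp]: "\<kappa> \<noteq> 0"
  using \<alpha>_nonzero p_gt_1 by (simp add: \<kappa>_def)

lemma T_K_invariant: "u \<in> K_max \<Longrightarrow> T v (x * u) = T v x"
  using T(4)[of u v] K_fixed by metis

lemma T_upper:
  assumes "a \<noteq> 0" "d \<noteq> 0"
  shows "T v (pgl2_mat a b 0 d * g) = \<kappa> powi (pval p a - pval p d) * T v g"
proof -
  have "T v \<in> induced_space p \<alpha> \<beta>" using T(3) by blast
  then have "T v (pgl2_mat a b 0 d * g) =
      \<alpha> powi pval p a * \<beta> powi pval p d * of_real (sqrt (dist a 0 / dist d 0)) * T v g"
    using assms unfolding induced_space_def by blast
  also have "\<beta> powi pval p d = inverse \<alpha> powi pval p d"
    using \<alpha>\<beta> by (metis inverse_unique)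
  also have "sqrt (dist a 0 / dist d 0) = sqrt (real p powi (- (pval p a - pval p d)))"
    using assms p_gt_1 by (simp add: nrm_pval[of a] nrm_pval[of d] flip: power_int_diff)
  also have "\<dots> = inverse (sqrt p) powi (pval p a - pval p d)"
    by (simp only: sqrt_powi[of "real p"] power_int_minus power_int_inverse of_nat_0_le_iff real_sqrt_inverse)
  also have "\<alpha> powi pval p a * inverse \<alpha> powi pval p d = \<alpha> powi (pval p a - pval p d)"
    using \<alpha>_nonzero by (simp add: power_int_diff power_int_inverse divide_inverse)
  also have "\<alpha> powi (pval p a - pval p d) * of_real (inverse (sqrt p) powi (pval p a - pval p d)) =
      \<kappa> powi (pval p a - pval p d)"
    by (simp add: \<kappa>_def power_int_mult_distrib power_int_inverse divide_inverse flip: of_real_power_int)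
  finally show ?thesis .
qed

text \<open>Iwasawa decomposition. Together with \<open>T_mat2\<close> it says that the exponent of
  \<open>\<kappa>\<close> is the valuation of the determinant minus twice the minimal valuation in
  the bottom row.\<close>

lemma T_mat1:
  assumes det: "a * d - b * c \<noteq> 0" and le: "nrm c \<le> nrm d"
  shows "T v (pgl2_mat a b c d) = \<kappa> powi (pval p (a * d - b * c) - 2 * pval p d) * T v 1"
proof -
  have d: "d \<noteq> 0" using det le by auto
  define u where "u = (a * d - b * c) / d"
  have u: "u \<noteq> 0" using det d by (simp add: u_def)
  have "1 * 1 - 0 * (c / d) \<noteq> 0" by simp
  moreover have "u + b * (c / d) = a" using d by (simp add: u_def field_simps)
  ultimately have "pgl2_mat a b c d = pgl2_mat u b 0 d * pgl2_mat 1 0 (c / d) 1"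
    using u d by (subst pgl2_mat_mult) auto
  moreover have "pgl2_mat 1 0 (c / d) 1 \<in> (K_max :: 'k pgl2 set)"
    using le d by (intro mem_K_max_I) (auto simp: nrm_divide)
  ultimately have "T v (pgl2_mat a b c d) = T v (pgl2_mat u b 0 d * 1)"
    using T_K_invariant by simp
  also have "\<dots> = \<kappa> powi (pval p u - pval p d) * T v 1"
    using u d by (rule T_upper)
  also have "pval p (u * d) = pval p u + pval p d" using u d by (rule pval_mult)
  then have "pval p u = pval p (a * d - b * c) - pval p d" using d by (simp add: u_def)
  finally show ?thesis by simp
qed

lemma T_mat2:
  assumes det: "a * d - b * c \<noteq> 0" and le: "nrm d \<le> nrm c"
  shows "T v (pgl2_mat a b c d) = \<kappa> powi (pval p (a * d - b * c) - 2 * pval p c) * T v 1"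
proof -
  have "T v (pgl2_mat a b c d) = T v (pgl2_mat a b c d * swap)"
    using T_K_invariant[OF swap_in_K_max] by simp
  also have "pgl2_mat a b c d * swap = pgl2_mat b a d c"
    using det by (simp add: pgl2_mat_mult)
  also have "b * c - a * d \<noteq> 0" using det by simp
  from T_mat1[OF this le] have "T v (pgl2_mat b a d c) = \<kappa> powi (pval p (b * c - a * d) - 2 * pval p c) * T v 1" .
  also have "pval p (b * c - a * d) = pval p (a * d - b * c)"
    by (rule pval_cong) (rule nrm_diff_commute)
  finally show ?thesis .
qed

lemma T_one_nonzero: "T v 1 \<noteq> 0"
proof
  assume "T v 1 = 0"
  have "T v g = 0" for g
  proof -
    obtain a b c d where g: "a * d - b * c \<noteq> 0" "g = pgl2_mat a b c d" by (rule pgl2_cases)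
    then show ?thesis
      using T_mat1[OF g(1)] T_mat2[OF g(1)] \<open>T v 1 = 0\<close> by (cases "nrm c \<le> nrm d") auto
  qed
  then have "T v = 0" by (simp add: fun_eq_iff)
  moreover have "T 0 = 0" using linearD(3)[OF T(1)] .
  ultimately have "v = 0" using T(2) by (metis injD)
  then show False using v_nonzero by simp
qed

text \<open>Each of the \<open>p + 1\<close> neighbours raises the valuation of the determinant by
  one. The minimal valuation of the bottom row rises for exactly one of them, which contributes the
  inverse of \<open>\<kappa>\<close>; the other \<open>p\<close> contribute \<open>\<kappa>\<close>
  each. The exceptional neighbour is diag(1, p) if \<open>d\<close> strictly dominates the row, and
  some \<open>tmat 1 y0\<close> otherwise.\<close>

lemma hecke_T: "(\<Sum>y<p. T v (x * tmat 1 y)) + T v (x * pgl2_mat 1 0 0 pp) = lam * T v x"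
proof -
  obtain a b c d where x: "a * d - b * c \<noteq> 0" "x = pgl2_mat a b c d" by (rule pgl2_cases)
  define e where "e = pval p (a * d - b * c)"
  have m1: "x * tmat 1 y = pgl2_mat (a * pp) (a * of_nat y + b) (c * pp) (c * of_nat y + d)" for y
    unfolding x(2) tmat_def using x(1) by (subst pgl2_mat_mult) auto
  have D1: "a * pp * (c * of_nat y + d) - (a * of_nat y + b) * (c * pp) = (a * d - b * c) * pp" for y
    by (simp add: algebra_simps)
  have m2: "x * pgl2_mat 1 0 0 pp = pgl2_mat a (b * pp) c (d * pp)"
    unfolding x(2) using x(1) by (subst pgl2_mat_mult) auto
  have D2: "a * (d * pp) - b * pp * c = (a * d - b * c) * pp"
    by (simp add: algebra_simps)
  have Dne: "(a * d - b * c) * pp \<noteq> 0" using x(1) by simp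
  have De: "pval p ((a * d - b * c) * pp) = e + 1"
    using x(1) by (simp add: pval_mult pval_p e_def)
  have N1: "T v (x * tmat 1 y) = \<kappa> powi (e + 1 - 2 * pval p (c * of_nat y + d)) * T v 1"
    if "nrm (c * pp) \<le> nrm (c * of_nat y + d)" for y
    using T_mat1[of "a * pp" "c * of_nat y + d" "a * of_nat y + b" "c * pp"] that Dne
    unfolding m1 D1 De by blast
  have N2: "T v (x * tmat 1 y) = \<kappa> powi (e + 1 - 2 * pval p (c * pp)) * T v 1"
    if "nrm (c * of_nat y + d) \<le> nrm (c * pp)" for y
    using T_mat2[of "a * pp" "c * of_nat y + d" "a * of_nat y + b" "c * pp"] that Dne
    unfolding m1 D1 De by blast
  have N3: "T v (x * pgl2_mat 1 0 0 pp) = \<kappa> powi (e + 1 - 2 * pval p (d * pp)) * T v 1"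
    if "nrm c \<le> nrm (d * pp)"
    using T_mat1[of a "d * pp" "b * pp" c] that Dne unfolding m2 D2 De by blast
  have N4: "T v (x * pgl2_mat 1 0 0 pp) = \<kappa> powi (e + 1 - 2 * pval p c) * T v 1"
    if "nrm (d * pp) \<le> nrm c"
    using T_mat2[of a "d * pp" "b * pp" c] that Dne unfolding m2 D2 De by blast
  have up: "\<kappa> powi (e + 1 - 2 * j) = \<kappa> * \<kappa> powi (e - 2 * j)" for j
    by (simp add: power_int_diff power_int_add)
  have down: "\<kappa> powi (e + 1 - 2 * (j + 1)) = inverse \<kappa> * \<kappa> powi (e - 2 * j)" for j
  proof -
    have "e + 1 - 2 * (j + 1) = (e - 2 * j) - 1" by simp
    then show ?thesis by (simp only: power_int_diff[OF disjI1[OF \<kappa>_nonzero]] power_int_1_right divide_inverse mult.commute)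
  qed
  have yn: "nrm (c * of_nat y) \<le> nrm c" for y
    using nrm_of_int_le_1[of "int y"] by (simp add: nrm_mult mult_left_le)
  show ?thesis
  proof (cases "nrm c < nrm d")
    case True
    then have d: "d \<noteq> 0" by auto
    have "T v (x * tmat 1 y) = \<kappa> * T v x" for y
    proof -
      have cd: "nrm (c * of_nat y + d) = nrm d"
        using yn[of y] True by (intro nrm_add_eq') simp
      have "nrm (c * pp) \<le> nrm (c * of_nat y + d)"
        using True divide_p_less[of "nrm c"] unfolding cd nrm_mult_pp by (cases "c = 0") auto
      then have "T v (x * tmat 1 y) = \<kappa> powi (e + 1 - 2 * pval p (c * of_nat y + d)) * T v 1"
        by (rule N1)
      also have "pval p (c * of_nat y + d) = pval p d" using cd by (rule pval_cong)
      finally show ?thesis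
        unfolding up x(2) using T_mat1[OF x(1)] True by (simp add: e_def)
    qed
    moreover have "T v (x * pgl2_mat 1 0 0 pp) = inverse \<kappa> * T v x"
    proof -
      have "nrm c \<le> nrm (d * pp)" using True nrm_less_iff[of c d] by (simp add: nrm_mult_pp)
      then have "T v (x * pgl2_mat 1 0 0 pp) = \<kappa> powi (e + 1 - 2 * pval p (d * pp)) * T v 1"
        by (rule N3)
      also have "pval p (d * pp) = pval p d + 1" using d by (simp add: pval_mult pval_p)
      finally show ?thesis
        unfolding down x(2) using T_mat1[OF x(1)] True by (simp add: e_def)
    qed
    ultimately show ?thesis by (simp add: lam_def distrib_right)
  next
    case False
    then have dc: "nrm d \<le> nrm c" by simp
    have c: "c \<noteq> 0" using dc x(1) by auto
    have Tx: "T v x = \<kappa> powi (e - 2 * pval p c) * T v 1"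
      unfolding x(2) e_def using x(1) dc by (rule T_mat2)
    obtain y0 where y0: "y0 < p" "nrm (c * of_nat y0 + d) \<le> nrm c / real p"
      and y0_uniq: "\<And>y. y < p \<Longrightarrow> nrm (c * of_nat y + d) \<le> nrm c / real p \<Longrightarrow> y = y0"
      using residue_linear[OF c dc, of 1] by auto
    have "T v (x * tmat 1 y0) = \<kappa> powi (e + 1 - 2 * pval p (c * pp)) * T v 1"
        using y0(2) by (intro N2) (simp add: nrm_mult_pp)
    also have "pval p (c * pp) = pval p c + 1" using c by (simp add: pval_mult pval_p)
    finally have t0: "T v (x * tmat 1 y0) = inverse \<kappa> * T v x"
      unfolding down Tx by simp
    have "T v (x * tmat 1 y) = \<kappa> * T v x" if "y \<in> {..<p} - {y0}" for y
    proof -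
      have "\<not> nrm (c * of_nat y + d) \<le> nrm c / real p" using that y0_uniq by auto
      then have "\<not> nrm (c * of_nat y + d) < nrm c"
        using nrm_less_iff[of "c * of_nat y + d" c] by blast
      moreover have "nrm (c * of_nat y + d) \<le> nrm c" using yn dc by (intro ultrametric_le) auto
      ultimately have cd: "nrm (c * of_nat y + d) = nrm c" by simp
      then have "nrm (c * pp) \<le> nrm (c * of_nat y + d)"
        using c divide_p_less[of "nrm c"] unfolding nrm_mult_pp by simp
      then have "T v (x * tmat 1 y) = \<kappa> powi (e + 1 - 2 * pval p (c * of_nat y + d)) * T v 1"
        by (rule N1)
      also have "pval p (c * of_nat y + d) = pval p c" using cd by (rule pval_cong)
      finally show ?thesis unfolding up Tx by simp
    qed
    then have "(\<Sum>y\<in>{..<p} - {y0}. T v (x * tmat 1 y)) = of_nat (p - 1) * (\<kappa> * T v x)"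
      using y0(1) by simp
    then have s: "(\<Sum>y<p. T v (x * tmat 1 y)) = inverse \<kappa> * T v x + of_nat (p - 1) * (\<kappa> * T v x)"
      using y0(1) t0 by (subst sum.remove[of _ y0]) auto
    have "nrm (d * pp) \<le> nrm c"
      using dc divide_p_less[of "nrm d"] unfolding nrm_mult_pp by (cases "d = 0") auto
    then have "T v (x * pgl2_mat 1 0 0 pp) = \<kappa> powi (e + 1 - 2 * pval p c) * T v 1"
      by (rule N4)
    then have "T v (x * pgl2_mat 1 0 0 pp) = \<kappa> * T v x"
      unfolding up Tx by simp
    then show ?thesis
      using p_gt_1 unfolding s by (simp add: lam_def algebra_simps of_nat_diff)
  qed
qed

text \<open>Injectivity of \<open>T\<close> carries the identity of functions back to the abstract
  space, where it can be paired with any invariant form.\<close>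

lemma hecke_eigenvector: "(\<Sum>y<p. \<rho> (tmat 1 y) v) + \<rho> (pgl2_mat 1 0 0 pp) v = smul lam v"
proof (rule injD[OF T(2)])
  have "T ((\<Sum>y<p. \<rho> (tmat 1 y) v) + \<rho> (pgl2_mat 1 0 0 pp) v)
      = (\<Sum>y<p. T (\<rho> (tmat 1 y) v)) + T (\<rho> (pgl2_mat 1 0 0 pp) v)"
    unfolding linearD(1)[OF T(1)] linearD(4)[OF T(1)] ..
  also have "\<dots> = (\<lambda>x. lam * T v x)"
    unfolding T(4) by (rule ext) (simp only: sum_fun_apply plus_fun_apply hecke_T)
  also have "\<dots> = T (smul lam v)"
    unfolding linearD(2)[OF T(1)] by (simp add: fun_smul_def)
  finally show "T ((\<Sum>y<p. \<rho> (tmat 1 y) v) + \<rho> (pgl2_mat 1 0 0 pp) v) = T (smul lam v)" .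
qed

end

section \<open>The two Iwahori orbits on the projective line\<close>

context padic begin

lemma rep_pgl2_mat:
  assumes "a * d - b * c \<noteq> (0 :: 'k)"
  obtains t where "t \<noteq> 0" "rep_pgl2 (pgl2_mat a b c d) = mat2 (t * a) (t * b) (t * c) (t * d)"
proof -
  have "abs_pgl2 (mat2 a b c d) = abs_pgl2 (rep_pgl2 (pgl2_mat a b c d))"
    by (simp add: abs_rep_pgl2 pgl2_mat_def)
  then obtain t where "t \<noteq> 0" "rep_pgl2 (pgl2_mat a b c d) = smult_mat t (mat2 a b c d)"
    using assms abs_pgl2_eq_iff[of "mat2 a b c d" "rep_pgl2 (pgl2_mat a b c d)"] det_rep_pgl2 by auto
  then show ?thesis using that by (simp add: smult_mat_mat2)
qed

text \<open>Indicator of B times the Iwahori subgroup, for B the upper triangular group; the other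
  orbit is that of \<open>swap\<close>. The comparison is insensitive to scaling, so the chosen
  representative does not matter.\<close>

definition big_cell :: "'k pgl2 \<Rightarrow> complex" where
  "big_cell g = of_bool (nrm (rep_pgl2 g $ 2 $ 1) < nrm (rep_pgl2 g $ 2 $ 2))"

lemma big_cell_mat:
  assumes "a * d - b * c \<noteq> 0"
  shows "big_cell (pgl2_mat a b c d) = of_bool (nrm c < nrm d)"
proof -
  obtain t where "t \<noteq> 0" "rep_pgl2 (pgl2_mat a b c d) = mat2 (t * a) (t * b) (t * c) (t * d)"
    using rep_pgl2_mat[OF assms] .
  then show ?thesis by (simp add: big_cell_def nrm_mult)
qed

lemma big_cell_Iwahori:
  assumes "i \<in> Iwahori" shows "big_cell (g * i) = big_cell g"
proof -
  obtain a b c d where g: "a * d - b * c \<noteq> 0" "g = pgl2_mat a b c d" by (rule pgl2_cases)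
  obtain a' b' c' d' where i: "a' * d' - b' * c' \<noteq> 0" "i = pgl2_mat a' b' c' d'" by (rule pgl2_cases)
  have n: "nrm a' = nrm d'" "nrm b' \<le> nrm d'" "nrm c' < nrm d'"
    using assms i mem_Iwahori_iff by blast+
  then have pos: "0 < nrm d'" using zero_le_dist[of c' 0] by linarith
  have "(a * a' + b * c') * (c * b' + d * d') - (a * b' + b * d') * (c * a' + d * c')
      = (a * d - b * c) * (a' * d' - b' * c')"
    by (simp add: algebra_simps)
  then have det: "(a * a' + b * c') * (c * b' + d * d') - (a * b' + b * d') * (c * a' + d * c') \<noteq> 0"
    using g i by simp
  have "nrm (c * a' + d * c') < nrm (c * b' + d * d') \<longleftrightarrow> nrm c < nrm d"
  proof (cases "nrm c < nrm d")
    case True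
    have "nrm (c * b') < nrm (d * d')"
      using mult_left_mono[OF n(2), of "nrm c"] mult_strict_right_mono[OF True pos] by (simp add: nrm_mult)
    then have "nrm (c * b' + d * d') = nrm d * nrm d'"
      by (subst nrm_add_eq') (auto simp: nrm_mult)
    moreover have "0 < nrm d" using True zero_le_dist[of c 0] by linarith
    then have "nrm (c * a' + d * c') < nrm d * nrm d'"
      using mult_strict_right_mono[OF True pos] mult_strict_left_mono[OF n(3), of "nrm d"] n(1)
      by (intro ultrametric_less) (auto simp: nrm_mult)
    ultimately show ?thesis using True by simp
  next
    case False
    then have c: "0 < nrm c" using g(1) by auto
    have "nrm (d * c') < nrm (c * a')"
      using mult_right_mono[of "nrm d" "nrm c" "nrm c'"] mult_strict_left_mono[OF n(3) c] False n(1)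
      by (simp add: nrm_mult)
    then have "nrm (c * a' + d * c') = nrm c * nrm d'"
      using n(1) by (subst nrm_add_eq) (auto simp: nrm_mult)
    moreover have "nrm (c * b' + d * d') \<le> nrm c * nrm d'"
      using mult_left_mono[OF n(2), of "nrm c"] mult_right_mono[of "nrm d" "nrm c" "nrm d'"] False
      by (intro ultrametric_le) (simp_all add: nrm_mult)
    ultimately show ?thesis using False by simp
  qed
  then show ?thesis
    unfolding g(2) i(2) pgl2_mat_mult[OF g(1) i(1)] big_cell_mat[OF det] big_cell_mat[OF g(1)] by simp
qed

lemma big_cell_upper:
  assumes "a \<noteq> 0" "d \<noteq> 0" shows "big_cell (pgl2_mat a b 0 d * g) = big_cell g"
proof -
  obtain a' b' c' d' where g: "a' * d' - b' * c' \<noteq> 0" "g = pgl2_mat a' b' c' d'" by (rule pgl2_cases)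
  have "(a * a' + b * c') * (d * d') - (a * b' + b * d') * (d * c') = a * d * (a' * d' - b' * c')"
    by (simp add: algebra_simps)
  then have "(a * a' + b * c') * (d * d') - (a * b' + b * d') * (d * c') \<noteq> 0" using g assms by simp
  then show ?thesis
    unfolding g(2) using assms g(1) by (simp add: pgl2_mat_mult big_cell_mat nrm_mult)
qed

lemma right_smooth_Iwahori: "(\<And>g u. u \<in> Iwahori \<Longrightarrow> F (g * u) = F g) \<Longrightarrow> right_smooth (F :: 'k pgl2 \<Rightarrow> complex)"
  unfolding right_smooth_def using open_Iwahori one_in_Iwahori by blast

text \<open>The exponent m for which the coset representative lies in the \<open>K_max\<close>
  double coset of diag(p^m, 1). An \<open>om\<close> on the left alone lengthens by one and on the
  right alone shortens by one, except that \<open>om\<close> itself has exponent 1.\<close>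

definition sph_index :: "nat \<Rightarrow> bool \<Rightarrow> bool \<Rightarrow> nat" where
  "sph_index n a b = (if a then (if b then n else Suc n) else if b then (if n = 0 then 1 else n - 1) else n)"

end

section \<open>Spherical matrix coefficients\<close>

context spherical begin

context
  fixes h :: "'v \<Rightarrow> 'v \<Rightarrow> complex"
  assumes h: "invariant_hermitian smul \<rho> h"
begin

lemma coeff_K_left: "u \<in> K_max \<Longrightarrow> h (\<rho> (u * g) v) v = h (\<rho> g v) v"
  using invariant_hermitianD(4)[OF h, of u "\<rho> g v" v] K_fixed by (simp add: rep_mult)

lemma coeff_K_right: "u \<in> K_max \<Longrightarrow> h (\<rho> (g * u) v) v = h (\<rho> g v) v"
  using K_fixed by (simp add: rep_mult)

text \<open>The unipotent part of \<open>tmat 1 y\<close> stays integral when moved to the left of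
  \<open>tmat n 0\<close>, where invariance absorbs it; hence \<open>p\<close> equal terms.\<close>

lemma coeff_hecke:
  "of_nat p * h (\<rho> (tmat (Suc n) 0) v) v + h (\<rho> (tmat n 0 * pgl2_mat 1 0 0 pp) v) v =
     lam * h (\<rho> (tmat n 0) v) v"
proof -
  note lin = linearD[OF rep_linear]
  have "nrm (pp ^ n * of_nat y) \<le> 1" for y
    using nrm_of_int_le_1[of "int (p ^ n * y)"] by simp
  then have u: "pgl2_mat 1 (pp ^ n * of_nat y) 0 1 \<in> K_max" for y
    using unipotent_in_Iwahori Iwahori_subset_K_max by blast
  have "lam * h (\<rho> (tmat n 0) v) v = h (\<rho> (tmat n 0) (smul lam v)) v"
    unfolding lin(2) invariant_hermitianD(2)[OF h] ..
  also have "\<dots> = (\<Sum>y<p. h (\<rho> (tmat n 0 * tmat 1 y) v) v) + h (\<rho> (tmat n 0 * pgl2_mat 1 0 0 pp) v) v"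
    unfolding hecke_eigenvector[symmetric] lin(1) lin(4) invariant_hermitianD(1)[OF h]
      hermitian_sum_left[OF h] rep_mult ..
  also have "(\<Sum>y<p. h (\<rho> (tmat n 0 * tmat 1 y) v) v) = of_nat p * h (\<rho> (tmat (Suc n) 0) v) v"
    unfolding tmat_mult_tmat1 coeff_K_left[OF u] by simp
  finally show ?thesis by simp
qed

lemma coeff_tmat: "h (\<rho> (tmat n 0) v) v = hecke_seq lam n * h v v"
proof (induction n rule: induct_nat_012)
  case 1
  \<comment> \<open>For \<open>n = 0\<close> all \<open>p + 1\<close> neighbours of the identity lie
    in one double coset, which explains the denominator in \<open>hecke_seq l 1\<close>.\<close>
  have "h (\<rho> (pgl2_mat 1 0 0 pp) v) v = h (\<rho> (tmat 1 0) v) v"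
    unfolding diag_eq_swap_tmat coeff_K_right[OF swap_in_K_max] coeff_K_left[OF swap_in_K_max] ..
  then have "(of_nat p + 1) * h (\<rho> (tmat 1 0) v) v = lam * h v v"
    using coeff_hecke[of 0] by (simp add: tmat_0_0 rep_one algebra_simps)
  then show ?case using of_nat_p_plus_1 by (simp add: field_simps)
next
  case (ge2 n)
  then show ?case
    using coeff_hecke[of "Suc n"] unfolding tmat_Suc_mult_diag by (simp add: field_simps)
qed (simp add: tmat_0_0 rep_one)

lemma coeff_coset_rep: "h (\<rho> (ompow a * tmat n y * ompow b) v) v = hecke_seq lam (sph_index n a b) * h v v"
proof -
  have yI: "pgl2_mat 1 (of_nat y) 0 1 \<in> (Iwahori :: 'k pgl2 set)"
    using nrm_of_int_le_1[of "int y"] by (intro unipotent_in_Iwahori) simp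
  \<comment> \<open>The unipotent carrying \<open>y\<close> is moved to the far left. Past an
    \<open>om\<close> it becomes an \<open>om\<close>-conjugate, which is again in the Iwahori
    subgroup and so in \<open>K_max\<close>.\<close>
  have y0: "h (\<rho> (ompow a * tmat n y * ompow b) v) v = h (\<rho> (ompow a * tmat n 0 * ompow b) v) v"
  proof (cases a)
    case True
    have "ompow a * tmat n y * ompow b = om * pgl2_mat 1 (of_nat y) 0 1 * om * (om * tmat n 0 * ompow b)"
      unfolding tmat_eq[of n y] using True by (simp add: ompow_def mult.assoc)
    then show ?thesis
      using coeff_K_left[OF subsetD[OF Iwahori_subset_K_max om_Iwahori_om[OF yI]]] True
      by (simp add: ompow_def)
  next
    case False
    have "ompow a * tmat n y * ompow b = pgl2_mat 1 (of_nat y) 0 1 * (tmat n 0 * ompow b)"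
      unfolding tmat_eq[of n y] using False by (simp add: ompow_def mult.assoc)
    then show ?thesis
      using coeff_K_left[OF subsetD[OF Iwahori_subset_K_max yI]] False
      by (simp add: ompow_def)
  qed
  have tmat_Suc_om: "tmat (Suc m) 0 * om = tmat m 0 * swap" for m
    unfolding om_eq_diag_swap by (simp only: tmat_Suc_mult_diag mult.assoc[symmetric])
  have FT: "h (\<rho> (tmat n 0 * om) v) v = hecke_seq lam (if n = 0 then 1 else n - 1) * h v v"
  proof (cases n)
    case 0
    then show ?thesis
      using coeff_K_left[OF swap_in_K_max, of "tmat 1 0"] coeff_tmat[of 1]
      by (simp add: tmat_0_0 om_eq_swap_tmat)
  next
    case (Suc m)
    show ?thesis
      using tmat_Suc_om[of m] coeff_K_right[OF swap_in_K_max] coeff_tmat[of m] by (simp add: Suc)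
  qed
  have TF: "h (\<rho> (om * tmat n 0) v) v = hecke_seq lam (Suc n) * h v v"
    unfolding om_tmat coeff_K_left[OF swap_in_K_max] by (rule coeff_tmat)
  have "om * tmat n 0 * om = swap * (tmat n 0 * swap)"
    using tmat_Suc_om[of n] by (simp only: om_tmat mult.assoc)
  then have TT: "h (\<rho> (om * tmat n 0 * om) v) v = hecke_seq lam n * h v v"
    using coeff_K_left[OF swap_in_K_max] coeff_K_right[OF swap_in_K_max] coeff_tmat[of n] by simp
  show ?thesis
    unfolding y0 using FT TF TT coeff_tmat[of n]
    by (cases a; cases b) (simp_all add: ompow_def sph_index_def)
qed

lemma coeff_Iwahori_right: "i \<in> Iwahori \<Longrightarrow> h (\<rho> (g * i) v) v = h (\<rho> g v) v"
  using coeff_K_right[OF subsetD[OF Iwahori_subset_K_max]] .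

text \<open>Supplies the hypothesis of \<open>hermitian_cyclic_nonzero\<close>.\<close>

lemma coeff_exists: "\<exists>c. h (\<rho> g v) v = c * h v v"
proof -
  obtain j where j: "j \<in> Sigma UNIV coset_fibre" "same_coset (coset_rep j) g" using coset_rep_cover by blast
  obtain n y a b where jeq: "j = (n, y, a, b)" using prod_cases4 by blast
  obtain i where "i \<in> Iwahori" "g = coset_rep j * i" using j(2) unfolding same_coset_iff_coset by blast
  then have "h (\<rho> g v) v = h (\<rho> (coset_rep j) v) v" using coeff_Iwahori_right by simp
  also have "\<dots> = hecke_seq lam (sph_index n a b) * h v v"
    unfolding jeq coset_rep_def using coeff_coset_rep by simp
  finally show ?thesis by blast
qed

end

lemma matrix_coeff_coset_rep:
  assumes h: "invariant_hermitian smul \<rho> h" and "\<exists>u w. h u w \<noteq> 0"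
  shows "matrix_coeff \<rho> h v (ompow a * tmat n y * ompow b) = hecke_seq lam (sph_index n a b)"
  unfolding matrix_coeff_def coeff_coset_rep[OF h]
  using hermitian_cyclic_nonzero[OF irr h assms(2) v_nonzero coeff_exists[OF h]] by simp

lemma matrix_coeff_Iwahori:
  assumes h: "invariant_hermitian smul \<rho> h" and "i \<in> Iwahori"
  shows "matrix_coeff \<rho> h v (g * i) = matrix_coeff \<rho> h v g"
  using assms by (simp add: matrix_coeff_def coeff_Iwahori_right)

section \<open>Consequences of unitarity for the Satake parameters\<close>

context
  assumes unit: "unitarizable smul \<rho>"
begin

text \<open>Evaluated with the positive definite form given by \<open>unit\<close>; the result no
  longer refers to any form.\<close>

lemma norm_hecke_seq_le_1: "norm (hecke_seq lam n) \<le> 1"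
proof -
  obtain h where h: "invariant_hermitian smul \<rho> h" and pos: "\<And>v. v \<noteq> 0 \<Longrightarrow> Re (h v v) > 0"
    using unit unfolding unitarizable_def by blast
  have "h v v = of_real (Re (h v v))" by (rule hermitian_diag_real[OF h])
  then have nv: "norm (h v v) = Re (h v v)"
    using pos[OF v_nonzero] by (metis norm_of_real abs_of_pos)
  have "norm (hecke_seq lam n) * Re (h v v) \<le> Re (h v v)"
    using unitary_coeff_bound[OF irr h pos, of "tmat n 0" v] unfolding coeff_tmat[OF h] norm_mult nv .
  then show ?thesis using pos[OF v_nonzero] by simp
qed

text \<open>In the equality case of Cauchy-Schwarz \<open>v\<close> is an eigenvector of diag(p, 1)
  with eigenvalue \<open>z\<close>. In the induced model, evaluation at 1 shows the eigenvalue to be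
  \<open>\<kappa>\<close>.\<close>

lemma lam_extremal:
  assumes z: "z = 1 \<or> z = - 1" and hk1: "hecke_seq lam 1 = z"
  shows "\<kappa> = z"
proof -
  obtain h where h: "invariant_hermitian smul \<rho> h" and pos: "\<And>v. v \<noteq> 0 \<Longrightarrow> Re (h v v) > 0"
    using unit unfolding unitarizable_def by blast
  have "z * cnj z = 1" using z by auto
  moreover have "h (\<rho> (tmat 1 0) v) v = z * h v v"
    unfolding coeff_tmat[OF h] hk1 ..
  ultimately have "\<rho> (tmat 1 0) v = smul z v"
    using unitary_coeff_extremal[OF irr h pos] by blast
  then have "T (\<rho> (tmat 1 0) v) 1 = T (smul z v) 1" by simp
  then have "T v (tmat 1 0) = z * T v 1"
    unfolding T(4) linearD(2)[OF T(1)] by (simp add: fun_smul_def)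
  moreover have "T v (tmat 1 0) = \<kappa> * T v 1"
    unfolding tmat_def using T_mat1[of pp 1 0 0] pval_eqI[of 1 0] by (simp add: pval_p)
  ultimately show ?thesis using T_one_nonzero by simp
qed

text \<open>For \<open>\<kappa> = 1\<close> or \<open>-1\<close> the spherical vector spans an invariant line, although the induced
  representation has dimension at least two.\<close>

lemma \<kappa>_not_sign:
  assumes z: "z = 1 \<or> z = - 1" shows "\<kappa> \<noteq> z"
proof
  assume \<kappa>: "\<kappa> = z"
  \<comment> \<open>For this \<open>\<kappa>\<close> the dependence on the bottom row drops out,
    since its exponent is even, and \<open>T v\<close> is a multiple of a character of the
    determinant.\<close>
  have Tm: "T v (pgl2_mat a b c d) = z powi pval p (a * d - b * c) * T v 1"
    if "a * d - b * c \<noteq> 0" for a b c d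
  proof -
    have "z powi (2 * j) = 1" for j using z by (auto simp: power_int_mult)
    then have "z powi (m - 2 * j) = z powi m" for m j
      using z by (auto simp: power_int_diff)
    then show ?thesis
      using T_mat1[OF that] T_mat2[OF that] by (cases "nrm c \<le> nrm d") (auto simp: \<kappa>)
  qed
  have line: "\<exists>c. \<rho> g v = smul c v" for g
  proof -
    obtain a b c d where g: "a * d - b * c \<noteq> 0" "g = pgl2_mat a b c d" by (rule pgl2_cases)
    define e where "e = pval p (a * d - b * c)"
    have "T v (x * g) = z powi e * T v x" for x
    proof -
      obtain a' b' c' d' where x: "a' * d' - b' * c' \<noteq> 0" "x = pgl2_mat a' b' c' d'" by (rule pgl2_cases)
      have "(a' * a + b' * c) * (c' * b + d' * d) - (a' * b + b' * d) * (c' * a + d' * c)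
        = (a' * d' - b' * c') * (a * d - b * c)"
        by (simp add: algebra_simps)
      then have "T v (x * g) = z powi pval p ((a' * d' - b' * c') * (a * d - b * c)) * T v 1"
        unfolding x(2) g(2) pgl2_mat_mult[OF x(1) g(1)] using x(1) g(1) by (subst Tm) auto
      also have "\<dots> = z powi e * T v x"
        unfolding x(2) Tm[OF x(1)] using x(1) g(1) z by (auto simp: pval_mult power_int_add e_def)
      finally show ?thesis .
    qed
    then have "T (\<rho> g v) = T (smul (z powi e) v)"
      unfolding T(4) linearD(2)[OF T(1)] fun_smul_def by simp
    then show ?thesis using T(2) by (metis injD)
  qed
  have "w \<in> {w. \<exists>c. w = smul c v}" for w
  proof (rule irreducible_invariant_subspace[OF irr _ _ _ _ _ v_nonzero])
    show "\<rho> g u \<in> {w. \<exists>c. w = smul c v}" if "u \<in> {w. \<exists>c. w = smul c v}" for g u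
      using that line[of g] by (auto simp: rep_smul[OF irr])
    show "0 \<in> {w. \<exists>c. w = smul c v}" by (auto intro: exI[of _ 0])
    show "u + u' \<in> {w. \<exists>c. w = smul c v}" if "u \<in> {w. \<exists>c. w = smul c v}" "u' \<in> {w. \<exists>c. w = smul c v}" for u u'
      using that by (auto simp flip: scale_left_distrib)
    show "v \<in> {w. \<exists>c. w = smul c v}" by (auto intro: exI[of _ 1])
  qed auto
  then have span: "\<exists>c. w = smul c v" for w by blast
  \<comment> \<open>Cutting \<open>T v\<close> down to one Iwahori orbit produces a second vector of
    the induced space. It is not proportional to \<open>T v\<close>, since it vanishes at
    \<open>swap\<close> but not at 1.\<close>
  have "(\<lambda>x. T v x * big_cell x) \<in> induced_space p \<alpha> \<beta>"
  proof -
    have "T v \<in> induced_space p \<alpha> \<beta>" using T(3) by blast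
    then have "T v (pgl2_mat a b 0 d * g) =
          \<alpha> powi pval p a * \<beta> powi pval p d * of_real (sqrt (dist a 0 / dist d 0)) * T v g"
      if "a \<noteq> 0" "d \<noteq> 0" for a b d g
      using that unfolding induced_space_def by blast
    moreover have "right_smooth (\<lambda>x. T v x * big_cell x)"
      using T_K_invariant Iwahori_subset_K_max
      by (intro right_smooth_Iwahori) (auto simp: big_cell_Iwahori)
    ultimately show ?thesis by (simp add: induced_space_def big_cell_upper)
  qed
  then obtain w where "T w = (\<lambda>x. T v x * big_cell x)" using T(3) by (metis rangeE)
  moreover obtain c where "w = smul c v" using span by blast
  ultimately have c: "c * T v x = T v x * big_cell x" for x
    using linearD(2)[OF T(1), of c v] by (metis fun_smul_def)
  have "big_cell swap = 0" by (simp add: big_cell_mat)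
  moreover have "T v swap \<noteq> 0"
    using T_K_invariant[OF swap_in_K_max, of 1] T_one_nonzero by simp
  ultimately have "c = 0" using c[of swap] by simp
  moreover have "big_cell 1 = 1" by (simp add: one_pgl2_eq big_cell_mat)
  ultimately show False using c[of 1] T_one_nonzero by simp
qed

text \<open>These are the zeros of the factors to be cancelled. If \<open>p * \<kappa>\<close> is a
  sign \<open>z\<close>, then \<open>lam = z * (p + 1)\<close>, so the coefficient at diag(p, 1)
  equals \<open>z\<close> and \<open>lam_extremal\<close> gives the contradictory
  \<open>\<kappa> = z\<close>. Both \<open>\<kappa> = p\<close> and
  \<open>p ^ 2 * \<kappa> = 1\<close> give \<open>lam = p ^ 2 + 1 / p\<close>, which exceeds the
  unitary bound \<open>p + 1\<close>.\<close>

lemma \<kappa>_excluded: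
  "\<kappa>\<^sup>2 \<noteq> 1" "(of_nat p * \<kappa>)\<^sup>2 \<noteq> 1" "\<kappa> \<noteq> of_nat p" "of_nat p ^ 2 * \<kappa> \<noteq> 1"
proof -
  have P: "(of_nat p :: complex) \<noteq> 0" "(of_nat p + 1 :: complex) \<noteq> 0"
    using of_nat_p_plus_1 by simp_all
  show 1: "\<kappa>\<^sup>2 \<noteq> 1"
    using \<kappa>_not_sign[of 1] \<kappa>_not_sign[of "- 1"] by (auto simp: power2_eq_1_iff)
  show "(of_nat p * \<kappa>)\<^sup>2 \<noteq> 1"
  proof
    assume "(of_nat p * \<kappa>)\<^sup>2 = 1"
    then obtain z where z: "z = 1 \<or> z = - 1" "of_nat p * \<kappa> = z" by (auto simp: power2_eq_1_iff)
    have "lam = z * (of_nat p + 1)"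
    proof -
      have "\<kappa> = z / of_nat p" using z P by (simp add: field_simps)
      then show ?thesis using z P by (auto simp: lam_def field_simps)
    qed
    then have "hecke_seq lam 1 = z" using P by simp
    then have "\<kappa> = z" using lam_extremal z(1) by blast
    then show False using \<kappa>_not_sign z(1) by blast
  qed
  have big: "lam \<noteq> of_nat p ^ 2 + inverse (of_nat p)"
  proof
    assume l: "lam = of_nat p ^ 2 + inverse (of_nat p)"
    have "norm (hecke_seq lam 1) = (real p ^ 2 + inverse (real p)) / (real p + 1)"
    proof -
      have "hecke_seq lam 1 = of_real ((real p ^ 2 + inverse (real p)) / (real p + 1))"
        unfolding l by simp
      then show ?thesis by (simp only: norm_of_real) (simp add: add_nonneg_nonneg)
    qed
    then have "real p ^ 2 + inverse (real p) \<le> real p + 1"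
      using norm_hecke_seq_le_1[of 1] by (simp add: divide_le_eq)
    moreover have "real p * real p \<ge> 2 * real p" using p_gt_1 by (intro mult_right_mono) auto
    moreover have "real p \<ge> 2" "inverse (real p) > 0" using p_gt_1 by auto
    ultimately show False unfolding power2_eq_square by linarith
  qed
  show "\<kappa> \<noteq> of_nat p"
    using big by (auto simp: lam_def power2_eq_square)
  show "of_nat p ^ 2 * \<kappa> \<noteq> 1"
  proof
    assume "of_nat p ^ 2 * \<kappa> = 1"
    then have "inverse \<kappa> = of_nat p ^ 2" by (metis inverse_unique mult.commute)
    moreover from this have "\<kappa> = inverse (of_nat p ^ 2)" by (metis inverse_inverse_eq)
    then have "of_nat p * \<kappa> = inverse (of_nat p)" using P by (simp add: power2_eq_square field_simps)
    ultimately show False using big by (simp add: lam_def)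
  qed
qed

end
end

section \<open>The Steinberg representation\<close>

context padic begin

text \<open>Continuity of the field operations does not come with the type of \<open>'k\<close>;
  convergence is reduced to real null functions through the norm.\<close>

lemma tendsto_nrm: "(f \<longlongrightarrow> l) F \<longleftrightarrow> ((\<lambda>x. nrm (f x - l :: 'k)) \<longlongrightarrow> 0) F"
  by (subst tendsto_dist_iff) (simp add: dist_nrm[symmetric])

lemma tendsto_padic_add:
  assumes "(f \<longlongrightarrow> (l :: 'k)) F" "(g \<longlongrightarrow> m) F"
  shows "((\<lambda>x. f x + g x) \<longlongrightarrow> l + m) F"
  unfolding tendsto_nrm
proof (rule Lim_null_comparison)
  show "((\<lambda>x. nrm (f x - l) + nrm (g x - m)) \<longlongrightarrow> 0) F"
    using tendsto_add[OF assms[unfolded tendsto_nrm]] by simp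
  have "nrm (f x + g x - (l + m)) \<le> nrm (f x - l) + nrm (g x - m)" for x
    using nrm_triangle[of "f x - l" "g x - m"] by (simp add: algebra_simps)
  then show "\<forall>\<^sub>F x in F. norm (nrm (f x + g x - (l + m))) \<le> nrm (f x - l) + nrm (g x - m)"
    by simp
qed

lemma tendsto_padic_mult_left:
  assumes "(f \<longlongrightarrow> (l :: 'k)) F"
  shows "((\<lambda>x. c * f x) \<longlongrightarrow> c * l) F"
proof -
  have "nrm (c * f x - c * l) = nrm c * nrm (f x - l)" for x
    by (simp add: nrm_mult flip: right_diff_distrib)
  then show ?thesis
    using tendsto_mult_right_zero[OF assms[unfolded tendsto_nrm], of "nrm c"] unfolding tendsto_nrm by simp
qed

lemma continuous_on_conj_matrix: "continuous_on (S :: ('k^2^2) set) (\<lambda>A. (X :: 'k^2^2) ** A ** (Y :: 'k^2^2))"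
  unfolding continuous_on_def
proof (intro ballI vec_tendstoI)
  fix A :: "'k^2^2" and i j
  let ?e = "\<lambda>(A :: 'k^2^2) k l. vec_nth (vec_nth A k) l"
  have e: "((\<lambda>A. ?e A k l) \<longlongrightarrow> ?e A k l) (at A within S)" for k l
    by (intro tendsto_vec_nth tendsto_ident_at)
  have c: "?e (X ** A ** Y) i j =
     (?e X i 1 * ?e Y 1 j) * ?e A 1 1 + (?e X i 2 * ?e Y 1 j) * ?e A 2 1 +
     ((?e X i 1 * ?e Y 2 j) * ?e A 1 2 + (?e X i 2 * ?e Y 2 j) * ?e A 2 2)" for A
    by (simp add: matrix_matrix_mult_def sum_2 algebra_simps)
  show "((\<lambda>A. ?e (X ** A ** Y) i j) \<longlongrightarrow> ?e (X ** A ** Y) i j) (at A within S)"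
    unfolding c by (intro tendsto_padic_add tendsto_padic_mult_left e)
qed

text \<open>The stabilizer of a right translate of a function is a conjugate of the original
  stabilizer, so smoothness is preserved only if conjugation preserves openness.\<close>

lemma open_conjugate:
  assumes "open U"
  shows "open {u. g * u * h \<in> (U :: 'k pgl2 set)}"
proof -
  obtain X Y where X: "X = rep_pgl2 g" and Y: "Y = rep_pgl2 h" by blast
  have inv: "invertible X" "invertible Y" using det_rep_pgl2 by (auto simp: X Y invertible_det_nz)
  have abs: "abs_pgl2 (X ** A ** Y) = g * abs_pgl2 A * h" if "invertible A" for A
  proof -
    have d: "det A \<noteq> 0" "det X \<noteq> 0" "det Y \<noteq> 0" "det (X ** A) \<noteq> 0"
      using that inv by (auto simp: invertible_det_nz det_mul)
    have "g * abs_pgl2 A * h = abs_pgl2 X * abs_pgl2 A * abs_pgl2 Y"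
      by (simp add: X Y abs_rep_pgl2)
    also have "\<dots> = abs_pgl2 (X ** A ** Y)"
      using d by (simp add: times_pgl2.abs_eq pgl2_rel_self)
    finally show ?thesis by simp
  qed
  let ?G = "{A :: 'k^2^2. invertible A}"
  have "openin (top_of_set ?G) (?G \<inter> (\<lambda>A. X ** A ** Y) -` {A. invertible A \<and> abs_pgl2 A \<in> U})"
    using assms inv by (intro continuous_openin_preimage[OF continuous_on_conj_matrix])
      (auto simp: open_pgl2_def invertible_mult)
  also have "?G \<inter> (\<lambda>A. X ** A ** Y) -` {A. invertible A \<and> abs_pgl2 A \<in> U}
      = {A. invertible A \<and> abs_pgl2 A \<in> {u. g * u * h \<in> U}}"
    using abs inv by (auto simp: invertible_mult)
  finally show ?thesis unfolding open_pgl2_def .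
qed

lemma right_smooth_translate:
  assumes "right_smooth (F :: 'k pgl2 \<Rightarrow> complex)"
  shows "right_smooth (\<lambda>x. F (x * g))"
proof -
  obtain U where U: "open U" "1 \<in> U" "\<And>x u. u \<in> U \<Longrightarrow> F (x * u) = F x"
    using assms unfolding right_smooth_def by blast
  have "F (x * u * g) = F (x * g)" if "pinv g * u * g \<in> U" for x u
    using U(3)[OF that, of "x * g"] by (simp add: mult.assoc)
  then show ?thesis
    unfolding right_smooth_def using open_conjugate[OF U(1), of "pinv g" g] U(2)
    by (intro exI[of _ "{u. pinv g * u * g \<in> U}"]) simp
qed

lemma right_smooth_diff:
  assumes "right_smooth (F :: 'k pgl2 \<Rightarrow> complex)" "right_smooth G"
  shows "right_smooth (\<lambda>x. F x - G x)"
proof -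
  obtain U where U: "open U" "1 \<in> U" "\<And>x u. u \<in> U \<Longrightarrow> F (x * u) = F x"
    using assms unfolding right_smooth_def by blast
  obtain V where V: "open V" "1 \<in> V" "\<And>x u. u \<in> V \<Longrightarrow> G (x * u) = G x"
    using assms unfolding right_smooth_def by blast
  show ?thesis
    unfolding right_smooth_def using U V by (intro exI[of _ "U \<inter> V"]) auto
qed

lemma unram_quad_char_mat:
  assumes "\<epsilon> = 1 \<or> \<epsilon> = - 1" "a * d - b * c \<noteq> 0"
  shows "unram_quad_char p \<epsilon> (pgl2_mat a b c d :: 'k pgl2) = \<epsilon> powi pval p (a * d - b * c)"
proof -
  obtain t where t: "t \<noteq> 0" "rep_pgl2 (pgl2_mat a b c d) = mat2 (t * a) (t * b) (t * c) (t * d)"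
    using rep_pgl2_mat[OF assms(2)] .
  have "t * a * (t * d) - t * b * (t * c) = (t * t) * (a * d - b * c)"
    by (simp add: algebra_simps)
  then have "pval p (t * a * (t * d) - t * b * (t * c)) = 2 * pval p t + pval p (a * d - b * c)"
    using t(1) assms(2) by (simp add: pval_mult)
  moreover have "\<epsilon> powi (2 * j) = 1" for j using assms(1) by (auto simp: power_int_mult)
  ultimately show ?thesis
    using assms(1) by (auto simp: unram_quad_char_def t(2) power_int_add)
qed

text \<open>If \<open>d\<close> dominates the bottom row, all \<open>p ^ n\<close> translates stay
  in the cell; otherwise all but the one singled out by \<open>residue_linear\<close>. Modulo
  constants the operator is therefore the identity.\<close>

lemma sum_big_cell:
  "(\<Sum>y<p ^ n. big_cell (x * tmat n y)) = of_nat (p ^ n) - 1 + big_cell x"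
proof -
  obtain a b c d where x: "a * d - b * c \<noteq> 0" "x = pgl2_mat a b c d" by (rule pgl2_cases)
  have D: "a * pp ^ n * (c * of_nat y + d) - (a * of_nat y + b) * (c * pp ^ n) = (a * d - b * c) * pp ^ n" for y
    by (simp add: algebra_simps)
  have m: "big_cell (x * tmat n y) = of_bool (nrm (c * pp ^ n) < nrm (c * of_nat y + d))" for y
  proof -
    have "x * tmat n y = pgl2_mat (a * pp ^ n) (a * of_nat y + b) (c * pp ^ n) (c * of_nat y + d)"
      unfolding x(2) tmat_def using x(1) by (subst pgl2_mat_mult) auto
    then show ?thesis using x(1) D[of y] by (simp add: big_cell_mat)
  qed
  show ?thesis
  proof (cases "nrm c < nrm d")
    case True
    have "nrm (c * pp ^ n) < nrm (c * of_nat y + d)" for y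
    proof -
      have "nrm (c * of_nat y) \<le> nrm c" "nrm (c * pp ^ n) \<le> nrm c"
        using nrm_of_int_le_1[of "int y"] nrm_of_int_le_1[of "int p ^ n"] by (simp_all add: nrm_mult mult_left_le)
      then show ?thesis using True nrm_add_eq'[of "c * of_nat y" d] by simp
    qed
    then show ?thesis unfolding m using True x by (simp add: big_cell_mat)
  next
    case False
    then have dc: "nrm d \<le> nrm c" by simp
    have c: "c \<noteq> 0" using dc x(1) by auto
    have "\<exists>!y. y < p ^ n \<and> \<not> nrm (c * pp ^ n) < nrm (c * of_nat y + d)"
      using residue_linear[OF c dc, of n] by (simp add: not_less nrm_mult nrm_p_power)
    then obtain y0 where y0: "y0 < p ^ n" "\<not> nrm (c * pp ^ n) < nrm (c * of_nat y0 + d)"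
      "\<And>y. y < p ^ n \<Longrightarrow> \<not> nrm (c * pp ^ n) < nrm (c * of_nat y + d) \<Longrightarrow> y = y0"
      by blast
    have "(\<Sum>y<p ^ n. big_cell (x * tmat n y)) = (\<Sum>y\<in>{..<p ^ n} - {y0}. big_cell (x * tmat n y))"
      using y0(1,2) by (subst sum.remove[of _ y0]) (auto simp: m)
    also have "\<dots> = (\<Sum>y\<in>{..<p ^ n} - {y0}. 1)"
      using y0(3) by (intro sum.cong) (auto simp: m)
    also have "\<dots> = of_nat (p ^ n) - 1"
      using y0(1) by (simp add: of_nat_diff)
    finally show ?thesis using False x by (simp add: big_cell_mat)
  qed
qed

text \<open>\<open>om\<close> exchanges the two orbits, so it acts by -1 modulo constants.\<close>

lemma big_cell_om: "big_cell (x * om) = 1 - big_cell x"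
proof -
  obtain a b c d where x: "a * d - b * c \<noteq> 0" "x = pgl2_mat a b c d" by (rule pgl2_cases)
  have "b * pp * c - a * (d * pp) = - pp * (a * d - b * c)"
    by (simp add: algebra_simps)
  then have "b * pp * c - a * (d * pp) \<noteq> 0" using x by simp
  moreover have "nrm (d * pp) < nrm c \<longleftrightarrow> \<not> nrm c < nrm d"
  proof
    assume "nrm (d * pp) < nrm c"
    then show "\<not> nrm c < nrm d" using nrm_less_iff[of c d] by (auto simp: nrm_mult_pp)
  next
    assume "\<not> nrm c < nrm d"
    moreover from this have "c \<noteq> 0" using x(1) by auto
    ultimately show "nrm (d * pp) < nrm c"
      using divide_p_less[of "nrm d"] unfolding nrm_mult_pp by (cases "d = 0") auto
  qed
  ultimately show ?thesis
    unfolding x(2) pgl2_mat_mult_om[OF x(1)] using x(1) by (simp add: big_cell_mat)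
qed

end

section \<open>The Iwahori-fixed vector of the twisted Steinberg representation\<close>

locale steinberg_twist = padic p K for p and K :: "'k::{field_char_0,complete_space} itself" +
  fixes smul :: "complex \<Rightarrow> 'v::ab_group_add \<Rightarrow> 'v" and \<rho> :: "'k pgl2 \<Rightarrow> 'v \<Rightarrow> 'v" and v :: 'v
  assumes twist: "unramified_quadratic_twist_of_steinberg p smul \<rho>"
    and v_nonzero: "v \<noteq> 0" and I_fixed: "\<forall>u\<in>Iwahori. \<rho> u v = v"
begin

lemma irr: "irreducible_rep smul \<rho>"
  using twist unfolding unramified_quadratic_twist_of_steinberg_def by blast

sublocale complex_rep smul \<rho>
  using irr unfolding irreducible_rep_def by blast

text \<open>A function \<open>F\<close> that represents the Iwahori-fixed vector is Iwahori-invariant up to constants,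
  hence invariant, hence constant on the two Iwahori orbits of the projective line.\<close>

lemma eigenvalues:
  obtains \<eta> :: complex and e :: "nat \<Rightarrow> complex"
  where "\<eta> = 1 \<or> \<eta> = - 1" "\<And>n. e n = 1 \<or> e n = - 1" "\<rho> om v = smul \<eta> v"
    "\<And>n. (\<Sum>y<p ^ n. \<rho> (tmat n y) v) = smul (e n) v"
proof -
  obtain \<epsilon> where \<epsilon>: "\<epsilon> = 1 \<or> \<epsilon> = - 1"
    and st: "is_steinberg smul (\<lambda>g w. smul (unram_quad_char p \<epsilon> g) (\<rho> g w))"
    using twist unfolding unramified_quadratic_twist_of_steinberg_def by blast
  obtain Q where Q: "Vector_Spaces.linear fun_smul smul Q" "Q ` smooth_on_P1 = UNIV"
      "{F \<in> smooth_on_P1. Q F = 0} = {F. \<exists>c. F = (\<lambda>_. c)}"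
      "\<And>g F. F \<in> smooth_on_P1 \<Longrightarrow> Q (\<lambda>x. F (x * g)) = smul (unram_quad_char p \<epsilon> g) (\<rho> g (Q F))"
    using st unfolding is_steinberg_def by blast
  note lin = linearD[OF Q(1)]
  have \<epsilon>\<epsilon>: "\<epsilon> powi j = 1 \<or> \<epsilon> powi j = - 1" for j
    using \<epsilon> by (auto simp: power_int_def minus_one_power_iff split: if_splits)
  have Q_const: "Q (\<lambda>_. c) = 0" for c using Q(3) by blast
  obtain F where F: "F \<in> smooth_on_P1" "Q F = v" using Q(2) by (metis UNIV_I imageE)
  have smooth: "right_smooth F" and upper: "a \<noteq> 0 \<Longrightarrow> d \<noteq> 0 \<Longrightarrow> F (pgl2_mat a b 0 d * g) = F g" for a b d g
    using F(1) unfolding smooth_on_P1_def by blast+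
  have upper1: "F (pgl2_mat a b 0 d) = F 1" if "a \<noteq> 0" "d \<noteq> 0" for a b d
    using upper[OF that, of b 1] by simp
  have char_I: "unram_quad_char p \<epsilon> i = 1" if "i \<in> Iwahori" for i :: "'k pgl2"
  proof -
    obtain a b c d where i: "a * d - b * c \<noteq> 0" "i = pgl2_mat a b c d" by (rule pgl2_cases)
    then have n: "nrm a = nrm d" "nrm b \<le> nrm d" "nrm c < nrm d"
      using that mem_Iwahori_iff by blast+
    then have pos: "0 < nrm d" using zero_le_dist[of c 0] by linarith
    have "nrm (b * c) < nrm (a * d)"
      using mult_right_mono[OF n(2), of "nrm c"] mult_strict_left_mono[OF n(3) pos] n(1)
      by (simp add: nrm_mult)
    then have "nrm (a * d - b * c) = nrm (d * d)"
      using nrm_diff_eq[of "b * c" "a * d"] n(1) by (simp add: nrm_mult)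
    then have "pval p (a * d - b * c) = pval p (d * d)" by (rule pval_cong)
    then have "pval p (a * d - b * c) = 2 * pval p d" using pos by (simp add: pval_mult)
    then show ?thesis
      unfolding i(2) unram_quad_char_mat[OF \<epsilon> i(1)] using \<epsilon> by (auto simp: power_int_mult)
  qed
  \<comment> \<open>Invariance of \<open>v\<close> only makes the translate of \<open>F\<close>
    agree with \<open>F\<close> in the quotient by constants.\<close>
  have const: "\<exists>c. \<forall>x. F (x * i) = F x + c" if i: "i \<in> Iwahori" for i
  proof -
    have "(\<lambda>x. F (x * i) - F x) \<in> smooth_on_P1"
      unfolding smooth_on_P1_def
      using right_smooth_diff[OF right_smooth_translate[OF smooth] smooth] upper
      by (simp add: mult.assoc)
    moreover have "Q (\<lambda>x. F (x * i) - F x) = 0"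
    proof -
      have "Q (\<lambda>x. F (x * i) - F x) = Q ((\<lambda>x. F (x * i)) - F)"
        by (simp add: fun_diff_def)
      also have "\<dots> = Q (\<lambda>x. F (x * i)) - Q F" by (rule lin(5))
      also have "Q (\<lambda>x. F (x * i)) = v"
        unfolding Q(4)[OF F(1)] char_I[OF i] F(2) using I_fixed i by simp
      finally show ?thesis using F(2) by simp
    qed
    ultimately obtain c where "(\<lambda>x. F (x * i) - F x) = (\<lambda>_. c)" using Q(3) by blast
    then have "F (x * i) = F x + c" for x by (metis add.commute diff_add_cancel)
    then show ?thesis by blast
  qed
  \<comment> \<open>The additive constant is shown to vanish at a fixed point of the unipotent on
    the projective line: \<open>swap\<close> for lower unipotents, 1 for upper ones.\<close>
  have inv_lower: "F (x * pgl2_mat 1 0 z 1) = F x" if "nrm z < 1" for x z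
  proof -
    have "pgl2_mat 1 0 z 1 \<in> (Iwahori :: 'k pgl2 set)" using that by (subst mem_Iwahori_iff) auto
    then obtain c where c: "F (x * pgl2_mat 1 0 z 1) = F x + c" for x using const by blast
    have "swap * pgl2_mat 1 0 z 1 = pgl2_mat 1 z 0 1 * swap"
      by (simp add: pgl2_mat_mult)
    then have "F (swap * pgl2_mat 1 0 z 1) = F swap" using upper[of 1 1 z swap] by simp
    then show ?thesis using c by simp
  qed
  have inv_upper: "F (x * pgl2_mat 1 z 0 1) = F x" if z: "nrm z \<le> 1" for x z
  proof -
    obtain c where c: "F (x * pgl2_mat 1 z 0 1) = F x + c" for x
      using const[OF unipotent_in_Iwahori[OF z]] by blast
    show ?thesis using c[of x] c[of 1] upper1[of 1 1 z] by simp
  qed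
  have Feq: "F x = F swap + (F 1 - F swap) * big_cell x" for x
  proof -
    obtain a b c d where x: "a * d - b * c \<noteq> 0" "x = pgl2_mat a b c d" by (rule pgl2_cases)
    show ?thesis
    proof (cases "nrm c < nrm d")
      case True
      then have d: "d \<noteq> 0" by auto
      define u where "u = (a * d - b * c) / d"
      have u: "u \<noteq> 0" using x d by (simp add: u_def)
      have "1 * 1 - 0 * (c / d) \<noteq> 0" by simp
      moreover have "u + b * (c / d) = a" using d by (simp add: u_def field_simps)
      ultimately have "x = pgl2_mat u b 0 d * pgl2_mat 1 0 (c / d) 1"
        unfolding x(2) using u d by (subst pgl2_mat_mult) auto
      then have "F x = F 1"
        using inv_lower[of "c / d"] True d u upper1 by (simp add: nrm_divide)
      then show ?thesis using True x by (simp add: big_cell_mat)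
    next
      case False
      then have c: "c \<noteq> 0" using x by auto
      define u where "u = b - a * d / c"
      have u: "u \<noteq> 0" using x c by (simp add: u_def field_simps)
      have "u + a * (d / c) = b" using c by (simp add: u_def)
      then have "x = pgl2_mat u a 0 c * swap * pgl2_mat 1 (d / c) 0 1"
        unfolding x(2) using u c by (simp add: pgl2_mat_mult add.commute)
      then have "F x = F swap"
        using inv_upper[of "d / c"] False c u upper by (simp add: nrm_divide)
      then show ?thesis using False x by (simp add: big_cell_mat)
    qed
  qed
  \<comment> \<open>By \<open>big_cell_om\<close> the translate is a constant minus
    \<open>F\<close>, so \<open>om\<close> has eigenvalue -1 up to the sign of the twist.\<close>
  have om: "(\<lambda>x. F (x * om)) = (\<lambda>_. F 1 + F swap) - F"
  proof
    fix x
    have "F (x * om) = F swap + (F 1 - F swap) * (1 - big_cell x)"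
      unfolding big_cell_om[symmetric] by (rule Feq)
    also have "\<dots> = F 1 + F swap - (F swap + (F 1 - F swap) * big_cell x)"
      by (simp add: algebra_simps)
    also have "\<dots> = ((\<lambda>_. F 1 + F swap) - F) x"
      unfolding Feq[of x, symmetric] by simp
    finally show "F (x * om) = \<dots>" .
  qed
  have "smul (unram_quad_char p \<epsilon> om) (\<rho> om v) = - v"
    using Q(4)[OF F(1), of om] unfolding om lin(5) Q_const F(2) by simp
  moreover have om_sgn: "unram_quad_char p \<epsilon> (om :: 'k pgl2) = 1 \<or> unram_quad_char p \<epsilon> (om :: 'k pgl2) = - 1"
    unfolding om_def by (subst (1 2) unram_quad_char_mat[OF \<epsilon>]) (use \<epsilon>\<epsilon> in auto)
  ultimately have 1: "\<rho> om v = smul (- unram_quad_char p \<epsilon> om) v"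
    by (metis scale_minus_left scale_one add.inverse_inverse)
  have 2: "(\<Sum>y<p ^ n. \<rho> (tmat n y) v) = smul (\<epsilon> powi int n) v" for n
  proof -
    have ch: "unram_quad_char p \<epsilon> (tmat n y) = \<epsilon> powi int n" for y
    proof -
      have "pval p (pp ^ n) = int n"
        by (rule pval_eqI) (simp add: nrm_p_power power_int_minus power_one_over inverse_eq_divide)
      then show ?thesis unfolding tmat_def by (subst unram_quad_char_mat[OF \<epsilon>]) auto
    qed
    \<comment> \<open>By \<open>sum_big_cell\<close> the translates add up to \<open>F\<close> plus
      a constant, which \<open>Q\<close> kills; the eigenvalue is then the sign of the twist
      alone.\<close>
    have "(\<Sum>y<p ^ n. (\<lambda>x. F (x * tmat n y))) = (\<lambda>_. of_nat (p ^ n) * F swap + (F 1 - F swap) * (of_nat (p ^ n) - 1) - F swap) + F"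
    proof
      fix x
      have "(\<Sum>y<p ^ n. (\<lambda>x. F (x * tmat n y))) x = (\<Sum>y<p ^ n. F swap + (F 1 - F swap) * big_cell (x * tmat n y))"
        unfolding sum_fun_apply by (intro sum.cong refl Feq)
      also have "\<dots> = of_nat (p ^ n) * F swap + (F 1 - F swap) * (of_nat (p ^ n) - 1 + big_cell x)"
        unfolding sum.distrib sum_distrib_left[symmetric] sum_big_cell by simp
      also have "\<dots> = ((\<lambda>_. of_nat (p ^ n) * F swap + (F 1 - F swap) * (of_nat (p ^ n) - 1) - F swap) + F) x"
        unfolding plus_fun_apply arg_cong[OF Feq[of x], of "\<lambda>t. _ + t"] by (simp add: algebra_simps)
      finally show "(\<Sum>y<p ^ n. (\<lambda>x. F (x * tmat n y))) x = \<dots>" .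
    qed
    then have "Q (\<Sum>y<p ^ n. (\<lambda>x. F (x * tmat n y))) = v"
      by (simp only: lin(1) Q_const F(2) add_0_left)
    then have "v = smul (\<epsilon> powi int n) (\<Sum>y<p ^ n. \<rho> (tmat n y) v)"
      unfolding lin(4) Q(4)[OF F(1)] ch F(2) by (simp add: scale_sum_right)
    then show ?thesis
      using \<epsilon>\<epsilon>[of "int n"] by (metis scale_minus_left scale_one add.inverse_inverse)
  qed
  have "- unram_quad_char p \<epsilon> (om :: 'k pgl2) = 1 \<or> - unram_quad_char p \<epsilon> (om :: 'k pgl2) = - 1"
    using om_sgn by auto
  then show ?thesis
    using \<epsilon>\<epsilon> 1 2 by (rule that)
qed

text \<open>Integral upper unipotents fix \<open>v\<close>, so all \<open>p ^ n\<close> vectors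
  \<open>\<rho> (tmat n y) v\<close> have the same pairing with \<open>v\<close>. They add up to
  plus or minus \<open>v\<close>, so each pairing is the fraction \<open>1 / p ^ n\<close> of
  \<open>h v v\<close> up to sign; \<open>om\<close> on either side changes only the sign.\<close>

lemma coeff_coset_rep:
  assumes h: "invariant_hermitian smul \<rho> h"
  shows "\<exists>z. (z = 1 \<or> z = - 1) \<and>
    h (\<rho> (ompow a * tmat n y * ompow b) v) v = z / of_nat p ^ n * h v v"
proof -
  obtain \<eta> e where \<eta>: "\<eta> = 1 \<or> \<eta> = - 1" and e: "\<And>n. e n = 1 \<or> e n = - 1"
    and om: "\<rho> om v = smul \<eta> v" and sum: "\<And>n. (\<Sum>y<p ^ n. \<rho> (tmat n y) v) = smul (e n) v"
    by (rule eigenvalues) blast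
  note D = invariant_hermitianD[OF h]
  have right: "h (\<rho> (g * om) v) v = \<eta> * h (\<rho> g v) v" for g
    unfolding rep_mult om rep_smul[OF irr] D(2) ..
  have left: "h (\<rho> (om * g) v) v = \<eta> * h (\<rho> g v) v" for g
  proof -
    have "h (\<rho> (om * g) v) v * cnj \<eta> = h (\<rho> om (\<rho> g v)) (\<rho> om v)"
      unfolding om hermitian_smul_right[OF h] rep_mult by (rule mult.commute)
    also have "\<dots> = h (\<rho> g v) v" by (rule D(4))
    finally have "h (\<rho> g v) v = h (\<rho> (om * g) v) v * cnj \<eta>" by simp
    then show ?thesis using \<eta> by auto
  qed
  have t: "h (\<rho> (tmat n y) v) v = e n / of_nat p ^ n * h v v" for n y
  proof -
    have c: "h (\<rho> (tmat n y) v) v = h (\<rho> (tmat n 0) v) v" for y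
    proof -
      have "pgl2_mat 1 (of_nat y) 0 1 \<in> (Iwahori :: 'k pgl2 set)"
        using nrm_of_int_le_1[of "int y"] by (intro unipotent_in_Iwahori) simp
      then have "\<rho> (pgl2_mat 1 (of_nat y) 0 1) v = v" using I_fixed by blast
      then show ?thesis
        using D(4)[of "pgl2_mat 1 (of_nat y) 0 1" "\<rho> (tmat n 0) v" v]
        unfolding tmat_eq[of n y] rep_mult by simp
    qed
    have "(\<Sum>y<p ^ n. h (\<rho> (tmat n 0) v) v) = (\<Sum>y<p ^ n. h (\<rho> (tmat n y) v) v)"
      by (intro sum.cong refl c[symmetric])
    also have "\<dots> = e n * h v v"
      unfolding hermitian_sum_left[OF h, symmetric] sum D(2) ..
    finally have "of_nat p ^ n * h (\<rho> (tmat n 0) v) v = e n * h v v"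
      by simp
    then have "h (\<rho> (tmat n 0) v) v = e n / of_nat p ^ n * h v v" by (simp add: field_simps)
    then show ?thesis using c[of y] by simp
  qed
  have "h (\<rho> (ompow a * tmat n y * ompow b) v) v =
    (if a then \<eta> else 1) * (if b then \<eta> else 1) * e n / of_nat p ^ n * h v v"
    by (cases a; cases b) (simp_all add: ompow_def left right t mult.assoc del: om_om_mult)
  moreover have "(if a then \<eta> else 1) * (if b then \<eta> else 1) * e n = 1 \<or> (if a then \<eta> else 1) * (if b then \<eta> else 1) * e n = - 1"
    using \<eta> e[of n] by auto
  ultimately show ?thesis by blast
qed

lemma coeff_Iwahori_right: "i \<in> Iwahori \<Longrightarrow> h (\<rho> (g * i) v) v = h (\<rho> g v) v"
  using I_fixed by (simp add: rep_mult)

lemma coeff_exists: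
  assumes h: "invariant_hermitian smul \<rho> h"
  shows "\<exists>c. h (\<rho> g v) v = c * h v v"
proof -
  obtain j where j: "j \<in> Sigma UNIV coset_fibre" "same_coset (coset_rep j) g" using coset_rep_cover by blast
  obtain n y a b where jeq: "j = (n, y, a, b)" using prod_cases4 by blast
  obtain i where i: "i \<in> Iwahori" "g = coset_rep j * i" using j(2) unfolding same_coset_iff_coset by blast
  have "h (\<rho> g v) v = h (\<rho> (ompow a * tmat n y * ompow b) v) v"
    unfolding i(2) coeff_Iwahori_right[OF i(1)] unfolding jeq coset_rep_def by simp
  then show ?thesis using coeff_coset_rep[OF h, of a n y b] by metis
qed

lemma matrix_coeff_coset_rep:
  assumes h: "invariant_hermitian smul \<rho> h" and "\<exists>u w. h u w \<noteq> 0"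
  shows "matrix_coeff \<rho> h v (ompow a * tmat n y * ompow b) ^ 2 = 1 / of_nat p ^ (2 * n)"
proof -
  have nz: "h v v \<noteq> 0"
    using hermitian_cyclic_nonzero[OF irr h assms(2) v_nonzero coeff_exists[OF h]] .
  obtain z where z: "z = 1 \<or> z = - 1"
    and e: "h (\<rho> (ompow a * tmat n y * ompow b) v) v = z / of_nat p ^ n * h v v"
    using coeff_coset_rep[OF h] by blast
  have "matrix_coeff \<rho> h v (ompow a * tmat n y * ompow b) = z / of_nat p ^ n"
    unfolding matrix_coeff_def e using nz by simp
  then show ?thesis using z by (auto simp: power_divide power_mult mult.commute)
qed

lemma matrix_coeff_Iwahori:
  "i \<in> Iwahori \<Longrightarrow> matrix_coeff \<rho> h v (g * i) = matrix_coeff \<rho> h v g"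
  by (simp add: matrix_coeff_def coeff_Iwahori_right)

end

section \<open>Summation and normalization\<close>

context spherical begin

context
  assumes unit: "unitarizable smul \<rho>"
begin

text \<open>The unitary bound gives convergence by comparison with a geometric series. Summing the
  three-term recurrence yields a linear equation for the sum.\<close>

lemma spherical_series:
  defines "P \<equiv> of_nat p :: complex" and "u \<equiv> inverse (of_nat p * \<kappa>)"
  shows "(\<lambda>n. hecke_seq lam n / P ^ n) sums ((P\<^sup>2 - lam / (P + 1)) / (P\<^sup>2 * (1 - \<kappa> / P) * (1 - u / P)))"
proof -
  have P: "P \<noteq> 0" "P + 1 \<noteq> 0"
    unfolding P_def using of_nat_p_plus_1 by simp_all
  define a where "a = (\<lambda>n. hecke_seq lam n / P ^ n)"
  have "summable a"
  proof (rule summable_comparison_test')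
    show "summable (\<lambda>n. (1 / real p) ^ n)"
      using real_p_gt_1 by (intro summable_geometric) simp
    show "norm (a n) \<le> (1 / real p) ^ n" for n
      using norm_hecke_seq_le_1[OF unit, of n]
      by (simp add: a_def P_def norm_divide norm_power power_one_over divide_simps)
  qed
  then obtain S where S: "a sums S" by blast
  have S1: "(\<lambda>n. a (Suc n)) sums (S - 1)"
    using S by (subst sums_Suc_iff) (simp add: a_def)
  have S2: "(\<lambda>n. a (Suc (Suc n))) sums (S - 1 - lam / (P + 1) / P)"
    using S1 by (subst sums_Suc_iff) (simp add: a_def P_def)
  have "P\<^sup>2 * a (Suc (Suc n)) + a n / P = lam * a (Suc n)" for n
    using P by (simp add: a_def P_def power2_eq_square field_simps)
  then have "(\<lambda>n. lam * a (Suc n)) sums (P\<^sup>2 * (S - 1 - lam / (P + 1) / P) + S / P)"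
    using sums_add[OF sums_mult[OF S2, of "P\<^sup>2"] sums_divide[OF S, of P]] by simp
  then have "P\<^sup>2 * (S - 1 - lam / (P + 1) / P) + S / P = lam * (S - 1)"
    using sums_mult[OF S1, of lam] sums_unique2 by blast
  moreover have "P\<^sup>2 * (S - 1 - L / P) + S / P = S * (P\<^sup>2 + 1 / P) - P\<^sup>2 - P * L" for L
    using P by (simp add: field_simps power2_eq_square)
  ultimately have "S * (P\<^sup>2 + 1 / P) - P\<^sup>2 - P * (lam / (P + 1)) = lam * (S - 1)" by metis
  then have "S * (P\<^sup>2 + 1 / P - lam) = P\<^sup>2 + P * (lam / (P + 1)) - lam"
    by (simp add: algebra_simps)
  also have "\<dots> = P\<^sup>2 - lam / (P + 1)"
    using P by (simp add: field_simps)
  \<comment> \<open>The reciprocal Hecke polynomial factors because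
    \<open>P * \<kappa> * u = 1\<close>, so that \<open>lam = P * \<kappa> + P * u\<close>.\<close>
  also have den: "P\<^sup>2 + 1 / P - lam = P\<^sup>2 * (1 - \<kappa> / P) * (1 - u / P)"
    using P by (simp add: lam_def u_def P_def[symmetric] field_simps power2_eq_square)
  finally have "S * (P\<^sup>2 * (1 - \<kappa> / P) * (1 - u / P)) = P\<^sup>2 - lam / (P + 1)" .
  moreover have "1 - \<kappa> / P \<noteq> 0"
    using \<kappa>_excluded(3)[OF unit] P by (simp add: P_def field_simps)
  moreover have "1 - u / P \<noteq> 0"
    using \<kappa>_excluded(4)[OF unit] P
    by (simp add: P_def u_def field_simps power2_eq_square)
  ultimately have "S = (P\<^sup>2 - lam / (P + 1)) / (P\<^sup>2 * (1 - \<kappa> / P) * (1 - u / P))"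
    using P by (simp add: eq_divide_eq)
  then show ?thesis using S by (simp add: a_def)
qed

text \<open>The weight is \<open>p ^ n\<close> cosets times \<open>P ^ (-2 * n)\<close> from the
  squared Steinberg coefficient. The four bit patterns only shift the index of the spherical
  coefficient, so all terms reduce to the sum in \<open>spherical_series\<close>.\<close>

lemma coset_series:
  defines "P \<equiv> of_nat p :: complex" and "u \<equiv> inverse (of_nat p * \<kappa>)"
  defines "w \<equiv> \<lambda>n a b. hecke_seq lam (sph_index n a b) / P ^ (2 * n)"
  shows "(\<Sum>n. of_nat (p ^ n) * (w n False False + w n False True +
      (if n = 0 then 0 else w n True False + w n True True))) / (P + 1) =
    (1 - 1 / P) * (1 + \<kappa>) * (1 + u) / (P * (1 - \<kappa> / P) * (1 - u / P))"
proof -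
  have P: "P \<noteq> 0" "P + 1 \<noteq> 0"
    unfolding P_def using of_nat_p_plus_1 by simp_all
  define a where "a = (\<lambda>n. hecke_seq lam n / P ^ n)"
  define Den where "Den = P\<^sup>2 * (1 - \<kappa> / P) * (1 - u / P)"
  define S where "S = (P\<^sup>2 - lam / (P + 1)) / Den"
  have S: "a sums S"
    using spherical_series unfolding a_def S_def Den_def P_def u_def .
  have S1: "(\<lambda>n. a (Suc n)) sums (S - 1)"
    using S by (subst sums_Suc_iff) (simp add: a_def)
  have S2: "(\<lambda>n. a (Suc (Suc n))) sums (S - 1 - lam / (P + 1) / P)"
    using S1 by (subst sums_Suc_iff) (simp add: a_def P_def)
  define t where "t = (\<lambda>n. of_nat (p ^ n) * (w n False False + w n False True +
      (if n = 0 then 0 else w n True False + w n True True)))"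
  have w: "of_nat (p ^ n) * w n b b' = hecke_seq lam (sph_index n b b') / P ^ n" for n b b'
    using P by (simp add: w_def P_def[symmetric] mult_2 power_add)
  \<comment> \<open>Equal bits keep the index and give \<open>2 * a (Suc n)\<close>. A right
    \<open>om\<close> lowers it and a left \<open>om\<close> raises it, which accounts for the
    factors \<open>1 / P\<close> and \<open>P\<close>.\<close>
  have "t (Suc n) = 2 * a (Suc n) + a n / P + P * a (Suc (Suc n))" for n
    using P unfolding t_def distrib_left if_distrib[of "(*) _"] w
    by (simp add: sph_index_def a_def field_simps del: hecke_seq.simps)
  then have "(\<lambda>n. t (Suc n)) sums (2 * (S - 1) + S / P + P * (S - 1 - lam / (P + 1) / P))"
    using sums_add[OF sums_add[OF sums_mult[OF S1, of 2] sums_divide[OF S, of P]] sums_mult[OF S2, of P]] by simp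
  \<comment> \<open>For \<open>n = 0\<close> only the cosets of 1 and of \<open>om\<close>
    remain.\<close>
  moreover have "t 0 = 1 + lam / (P + 1)"
    by (simp add: t_def w_def sph_index_def P_def)
  ultimately have "t sums (2 * (S - 1) + S / P + P * (S - 1 - lam / (P + 1) / P) + (1 + lam / (P + 1)))"
    by (subst (asm) sums_Suc_iff) simp
  then have sum: "suminf t = 2 * (S - 1) + S / P + P * (S - 1 - lam / (P + 1) / P) + (1 + lam / (P + 1))"
    by (rule sums_unique[symmetric])
  \<comment> \<open>The total is divisible by \<open>P + 1\<close> as a polynomial in
    \<open>P\<close>, \<open>S\<close> and the first coefficient; this cancels the inverse
    volume.\<close>
  have "suminf t / (P + 1) = (P + 1) / P * S - 1"
  proof -
    have "2 * (S - 1) + S / P + P * (S - 1 - L / P) + (1 + L) = ((P + 1) / P * S - 1) * (P + 1)" for L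
      using P(1) by (simp add: field_simps)
    then show ?thesis unfolding sum using nonzero_mult_div_cancel_right[OF P(2)] by metis
  qed
  also have Den: "Den \<noteq> 0"
  proof -
    have "1 - \<kappa> / P \<noteq> 0"
      using \<kappa>_excluded(3)[OF unit] P by (simp add: P_def field_simps)
    moreover have "1 - u / P \<noteq> 0"
      using \<kappa>_excluded(4)[OF unit] P
      by (simp add: P_def u_def field_simps power2_eq_square)
    ultimately show ?thesis using P by (simp add: Den_def)
  qed
  have "(P + 1) / P * S - 1 = ((P + 1) * (P\<^sup>2 - lam / (P + 1)) - P * Den) / (P * Den)"
  proof -
    have "(P + 1) / P * (N / Den) - 1 = ((P + 1) * N - P * Den) / (P * Den)" for N
      using P(1) Den by (simp add: field_simps)
    then show ?thesis unfolding S_def .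
  qed
  also have "(P + 1) * (P\<^sup>2 - lam / (P + 1)) = (P + 1) * P\<^sup>2 - lam"
    using P by (simp add: field_simps)
  also have "(P + 1) * P\<^sup>2 - lam - P * Den = P * P * (1 - 1 / P) * (1 + \<kappa>) * (1 + u)"
  proof -
    have "Den = P\<^sup>2 + 1 / P - lam"
      using P by (simp add: Den_def lam_def u_def P_def[symmetric] field_simps power2_eq_square)
    \<comment> \<open>The last factor splits as
      \<open>P + 1 + lam = P * (1 + \<kappa>) * (1 + u)\<close>, again by
      \<open>P * \<kappa> * u = 1\<close>.\<close>
    then have "(P + 1) * P\<^sup>2 - lam - P * Den = (P - 1) * (P + 1 + lam)"
      using P by (simp add: field_simps power2_eq_square)
    also have "\<dots> = P * P * (1 - 1 / P) * (1 + \<kappa>) * (1 + u)"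
      using P by (simp add: lam_def u_def P_def[symmetric] field_simps)
    finally show ?thesis .
  qed
  finally show ?thesis
    using P Den unfolding t_def[symmetric] by (simp add: Den_def power2_eq_square mult.assoc)
qed

end

text \<open>The zeta factors cancel, since \<open>L_ad_steinberg p\<close> is
  \<open>zeta_p p 2\<close>. The rest is rewritten with \<open>u = \<beta> / sqrt p\<close>: the
  squares of the Satake parameters over \<open>p\<close> become squares of \<open>\<kappa>\<close>
  and \<open>u\<close>, and the exponent -3/2 contributes an extra \<open>1 / P\<close>.\<close>

lemma normalizing_factor:
  defines "P \<equiv> of_nat p :: complex" and "u \<equiv> inverse (of_nat p * \<kappa>)"
  shows "zeta_p p 2 ^ 3 / zeta_p p 2 * (L_half_triple p \<alpha> \<beta> / (L_ad_unramified p \<alpha> \<beta> * (L_ad_steinberg p)\<^sup>2)) =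
    (1 - \<kappa>\<^sup>2) * (1 - 1 / P) * (1 - u\<^sup>2) / ((1 - \<kappa>) * (1 - u) * (1 - \<kappa> / P) * (1 - u / P))"
proof -
  have "real p powr - 2 = 1 / real p ^ 2"
    using p_gt_1 by (simp add: powr_minus_divide)
  moreover have "1 < real p ^ 2" using real_p_gt_1 by (simp add: one_less_power)
  then have "1 / real p ^ 2 \<noteq> 1" by (auto simp: divide_eq_eq)
  ultimately have z: "zeta_p p 2 \<noteq> 0"
    unfolding zeta_p_def of_real_eq_0_iff by simp
  have sq: "complex_of_real (sqrt (real p)) ^ 2 = P" "complex_of_real (sqrt (real p)) \<noteq> 0"
    using p_gt_1 by (simp_all add: P_def flip: of_real_power)
  have half: "real p powr (-1/2) = 1 / sqrt (real p)"
    using p_gt_1 by (simp add: powr_minus_divide powr_half_sqrt)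
  have "real p powr (-3/2) = real p powr (- 1) * real p powr (-1/2)"
    unfolding powr_add[symmetric] by simp
  then have three: "real p powr (-3/2) = 1 / sqrt (real p) / real p"
    using p_gt_1 half by (simp add: powr_minus_divide)
  have \<beta>: "\<beta> = inverse \<alpha>" using \<alpha>\<beta> by (metis inverse_unique)
  have u: "u = \<beta> / complex_of_real (sqrt (real p))"
    unfolding u_def P_def[symmetric] \<kappa>_def \<beta> sq(1)[symmetric] using sq(2) \<alpha>_nonzero
    by (simp add: field_simps power2_eq_square)
  have "L_half_triple p \<alpha> \<beta> = inverse ((1 - \<kappa>) * (1 - u) * (1 - \<kappa> / P) * (1 - u / P))"
    unfolding L_half_triple_def half three u by (simp add: \<kappa>_def P_def)
  moreover have "inverse A / inverse B = B / A" for A B :: complex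
    by (simp add: divide_inverse mult.commute)
  moreover have "L_ad_unramified p \<alpha> \<beta> = inverse ((1 - \<kappa>\<^sup>2) * (1 - 1 / P) * (1 - u\<^sup>2))"
    unfolding L_ad_unramified_def u by (simp add: \<kappa>_def power_divide sq(1) P_def[symmetric])
  moreover have "zeta_p p 2 ^ 3 / zeta_p p 2 * (x / (y * (L_ad_steinberg p)\<^sup>2)) = x / y" for x y
    using z by (simp add: L_ad_steinberg_def power2_eq_square power3_eq_cube)
  ultimately show ?thesis by metis
qed

end

theorem lemma4p4:
  fixes \<phi> f :: "complex \<Rightarrow> complex" and k q p :: nat
    and \<mu> :: "'k::{field_char_0,complete_space} pgl2 measure"
    and smul\<^sub>\<phi> :: "complex \<Rightarrow> 'v::ab_group_add \<Rightarrow> 'v" and \<rho>\<^sub>\<phi> :: "'k pgl2 \<Rightarrow> 'v \<Rightarrow> 'v"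
    and smul\<^sub>f :: "complex \<Rightarrow> 'w::ab_group_add \<Rightarrow> 'w" and \<rho>\<^sub>f :: "'k pgl2 \<Rightarrow> 'w \<Rightarrow> 'w"
    and v\<^sub>\<phi> :: 'v and v\<^sub>f :: 'w
    and h\<^sub>\<phi> :: "'v \<Rightarrow> 'v \<Rightarrow> complex" and h\<^sub>f :: "'w \<Rightarrow> 'w \<Rightarrow> complex"
    and \<alpha> \<beta> :: complex
  assumes maass: "even_maass_eigencuspform \<phi>"
    and newform: "holomorphic_newform k q f" and "squarefree q"
    and "prime p" and "p dvd q"
    and Qp: "is_padic_field p TYPE('k)"
    and haar: "haar_pgl2 \<mu>"
    and "local_component p 1 K_max 0 \<phi> smul\<^sub>\<phi> \<rho>\<^sub>\<phi> v\<^sub>\<phi>"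
    and "local_component p (q div p) Iwahori k f smul\<^sub>f \<rho>\<^sub>f v\<^sub>f"
    and "unramified_principal_series p \<alpha> \<beta> smul\<^sub>\<phi> \<rho>\<^sub>\<phi>"
    and "v\<^sub>\<phi> \<noteq> 0" and "\<forall>u\<in>K_max. \<rho>\<^sub>\<phi> u v\<^sub>\<phi> = v\<^sub>\<phi>"
    and "unramified_quadratic_twist_of_steinberg p smul\<^sub>f \<rho>\<^sub>f"
    and "v\<^sub>f \<noteq> 0" and "\<forall>u\<in>Iwahori. \<rho>\<^sub>f u v\<^sub>f = v\<^sub>f"
    and "invariant_hermitian smul\<^sub>\<phi> \<rho>\<^sub>\<phi> h\<^sub>\<phi>" and "\<exists>u w. h\<^sub>\<phi> u w \<noteq> 0"
    and "invariant_hermitian smul\<^sub>f \<rho>\<^sub>f h\<^sub>f" and "\<exists>u w. h\<^sub>f u w \<noteq> 0"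
  shows "normalized_local_integral p \<alpha> \<beta> \<mu> \<rho>\<^sub>\<phi> h\<^sub>\<phi> v\<^sub>\<phi> \<rho>\<^sub>f h\<^sub>f v\<^sub>f = 1 / of_nat p"
proof -
  interpret padic p "TYPE('k)" by unfold_locales (fact Qp)
  interpret S: spherical p "TYPE('k)" \<alpha> \<beta> smul\<^sub>\<phi> \<rho>\<^sub>\<phi> v\<^sub>\<phi>
    by unfold_locales fact+
  interpret St: steinberg_twist p "TYPE('k)" smul\<^sub>f \<rho>\<^sub>f v\<^sub>f
    by unfold_locales fact+
  note h\<phi> = \<open>invariant_hermitian smul\<^sub>\<phi> \<rho>\<^sub>\<phi> h\<^sub>\<phi>\<close> \<open>\<exists>u w. h\<^sub>\<phi> u w \<noteq> 0\<close>
  note hf = \<open>invariant_hermitian smul\<^sub>f \<rho>\<^sub>f h\<^sub>f\<close> \<open>\<exists>u w. h\<^sub>f u w \<noteq> 0\<close>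
  have unit: "unitarizable smul\<^sub>\<phi> \<rho>\<^sub>\<phi>"
    using \<open>local_component p 1 K_max 0 \<phi> smul\<^sub>\<phi> \<rho>\<^sub>\<phi> v\<^sub>\<phi>\<close> unfolding local_component_def by blast
  define P where "P = (of_nat p :: complex)"
  define \<kappa> where "\<kappa> = S.\<kappa>"
  define u where "u = inverse (P * \<kappa>)"
  define m where "m = matrix_coeff \<rho>\<^sub>\<phi> h\<^sub>\<phi> v\<^sub>\<phi>"
  define m' where "m' = matrix_coeff \<rho>\<^sub>f h\<^sub>f v\<^sub>f"
  define w where "w = (\<lambda>n a b. hecke_seq S.lam (sph_index n a b) / P ^ (2 * n))"
  \<comment> \<open>The complex conjugate vector is \<open>v\<^sub>f\<close> itself, so the two
    Steinberg coefficients multiply to a square and their signs disappear.\<close>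
  have "pgl2_mat (- 1) 0 0 1 \<in> (Iwahori :: 'k pgl2 set)"
    by (subst mem_Iwahori_iff) auto
  then have bar: "\<rho>\<^sub>f (pgl2_mat (- 1) 0 0 1) v\<^sub>f = v\<^sub>f"
    using \<open>\<forall>u\<in>Iwahori. \<rho>\<^sub>f u v\<^sub>f = v\<^sub>f\<close> by blast
  have "local_integral \<mu> \<rho>\<^sub>\<phi> h\<^sub>\<phi> v\<^sub>\<phi> \<rho>\<^sub>f h\<^sub>f v\<^sub>f = (\<integral>g. m g * (m' g)\<^sup>2 \<partial>\<mu>)"
    unfolding local_integral_def bar m_def m'_def by (simp add: power2_eq_square mult.assoc)
  also have "\<dots> = (\<Sum>n. of_nat (p ^ n) * (w n False False + w n False True +
      (if n = 0 then 0 else w n True False + w n True True))) / (of_nat p + 1)"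
  proof (rule integral_Iwahori_cosets[OF haar])
    show "m (g * i) * (m' (g * i))\<^sup>2 = m g * (m' g)\<^sup>2" if "i \<in> Iwahori" for g i
      using S.matrix_coeff_Iwahori[OF h\<phi>(1) that] St.matrix_coeff_Iwahori[OF that]
      by (simp add: m_def m'_def)
    show "m (ompow a * tmat n y * ompow b) * (m' (ompow a * tmat n y * ompow b))\<^sup>2 = w n a b" for n y a b
      unfolding m_def m'_def S.matrix_coeff_coset_rep[OF h\<phi>] St.matrix_coeff_coset_rep[OF hf]
      by (simp add: w_def P_def)
    show "summable (\<lambda>n. real p ^ n * norm (w n a b))" for a b
    proof (rule summable_comparison_test')
      show "summable (\<lambda>n. (1 / real p) ^ n)"
        using real_p_gt_1 by (intro summable_geometric) simp
      show "norm (real p ^ n * norm (w n a b)) \<le> (1 / real p) ^ n" for n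
      proof -
        have "real p ^ n * norm (w n a b) = norm (hecke_seq S.lam (sph_index n a b)) * (1 / real p) ^ n"
          using p_gt_1 by (simp add: w_def P_def norm_divide norm_power norm_mult power_mult power2_eq_square power_one_over power_mult_distrib)
        also have "\<dots> \<le> 1 * (1 / real p) ^ n"
          using S.norm_hecke_seq_le_1[OF unit] by (intro mult_right_mono) auto
        finally show ?thesis by simp
      qed
    qed
  qed
  also have "\<dots> = (1 - 1 / P) * (1 + \<kappa>) * (1 + u) / (P * (1 - \<kappa> / P) * (1 - u / P))"
    using S.coset_series[OF unit] unfolding w_def P_def \<kappa>_def u_def .
  finally have int: "local_integral \<mu> \<rho>\<^sub>\<phi> h\<^sub>\<phi> v\<^sub>\<phi> \<rho>\<^sub>f h\<^sub>f v\<^sub>f =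
      (1 - 1 / P) * (1 + \<kappa>) * (1 + u) / (P * (1 - \<kappa> / P) * (1 - u / P))" .
  have P: "P \<noteq> 0" "1 - 1 / P \<noteq> 0"
    using p_gt_1 by (simp_all add: P_def)
  \<comment> \<open>In the order listed: invertibility of \<open>\<kappa>\<close>, then nonvanishing
    of 1 - \<kappa>^2, 1 - u^2, 1 - \<kappa>/P and 1 - u/P.\<close>
  have \<kappa>: "\<kappa> \<noteq> 0" "\<kappa>\<^sup>2 \<noteq> 1" "(P * \<kappa>)\<^sup>2 \<noteq> 1" "\<kappa> \<noteq> P" "P\<^sup>2 * \<kappa> \<noteq> 1"
    using S.\<kappa>_nonzero S.\<kappa>_excluded[OF unit] by (simp_all add: \<kappa>_def P_def)
  have "u\<^sup>2 \<noteq> 1" using \<kappa>(3) by (simp only: u_def power_inverse inverse_eq_1_iff) simp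
  moreover have ne: "1 - \<kappa> / P \<noteq> 0" "1 - u / P \<noteq> 0"
    using \<kappa> P by (simp_all add: u_def field_simps power2_eq_square)
  moreover have "1 + x \<noteq> 0 \<and> 1 - x \<noteq> 0" if "x\<^sup>2 \<noteq> 1" for x :: complex
    using that by (auto simp: add_eq_0_iff)
  ultimately have nz: "1 + \<kappa> \<noteq> 0" "1 - \<kappa> \<noteq> 0" "1 + u \<noteq> 0" "1 - u \<noteq> 0"
    using \<kappa>(2) by blast+
  have sq: "1 - x\<^sup>2 = (1 + x) * (1 - x)" for x :: complex
    by (simp add: power2_eq_square algebra_simps)
  \<comment> \<open>After factoring the differences of squares, everything cancels except the single
    \<open>P\<close> in the denominator of the integral.\<close>
  show ?thesis
    unfolding normalized_local_integral_def S.normalizing_factor int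
    unfolding P_def[symmetric] \<kappa>_def[symmetric] u_def[symmetric] sq
    using P ne nz by (simp add: divide_simps)
qed

end
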